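(* Let $\Phi$ be an invariant purely discrete random measure on $\mathbb R^d$ with finite intensity $\gamma$. Let $L$ be an invariant probability kernel from $\Omega\times\mathbb R^d$ to $\mathbb R^d$, and let $T$ be the random transport given by $T(\mathrm d(x,y)):=L(x,\mathrm dy)\,\Phi(\mathrm dx)$. Let $K$ be another invariant probability kernel from $\Omega\times\mathbb R^d$ to $\mathbb R^d$ satisfying $$\mathbb E[K_x\otimes K_y\mid T]=L_x\otimes L_y,\quad x,y\in\Phi,\ x\neq y,\ \mathbb P\text{-a.s.}$$ Assume that $\mathbb E^\Phi_0\Phi\{0\}<\infty$, and that $K\Phi$ or $L\Phi$ is locally square-integrable. Let $\eta:=\alpha_{K\Phi}-\alpha_{L\Phi}$. Then $$\hat\beta_{K\Phi}=\hat\beta_{L\Phi}+\hat\eta\cdot\lambda_d .$$ Further, $$\hat\eta(k)=\gamma\,\mathbb E^\Phi_0\big[\big(|\hat K_0(k)|^2-|\hat L_0(k)|^2\big)\Phi\{0\}\big],\quad k\in\mathbb R^d,$$ and $\hat\eta$ is continuous with $\hat\eta(0)=0$.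
   Context: $\lambda_d$ is Lebesgue measure and $\mathcal B^d$ the Borel $\sigma$-field on $\mathbb R^d$. $(\Omega,\mathcal A,\mathbb P)$ is a probability space, $(\Omega,\mathcal A)$ is a Borel space, and there is a measurable flow on $\Omega$: maps $\theta_x\colon\Omega\to\Omega$, $x\in\mathbb R^d$, with $(\omega,x)\mapsto\theta_x\omega$ measurable, $\theta_0=\mathrm{id}$, $\theta_x\circ\theta_y=\theta_{x+y}$, and $\mathbb P(\theta_xA)=\mathbb P(A)$ for all $x\in\mathbb R^d$, $A\in\mathcal A$. A random measure $\Phi$ on $\mathbb R^d$ is a random locally finite measure. It is invariant if $\Phi(\omega,B+x)=\Phi(\theta_x\omega,B)$ for all $\omega,x,B$, and locally square-integrable if $\mathbb E\Phi(B)^2<\infty$ for all bounded $B\in\mathcal B^d$. It is purely discrete if it can be written as $\Phi=\sum_{n\ge1}Y_n\delta_{X_n}$ with random $Y_n\ge0$ and $X_n\in\mathbb R^d$; $\Phi\{x\}:=\Phi(\{x\})$, and $x\in\Phi$ means $\Phi\{x\}>0$. The intensity $\gamma:=\mathbb E\Phi([0,1]^d)$ is assumed positive and finite. The Palm probability measure is $\mathbb P^\Phi_0(A):=\gamma^{-1}\mathbb E\int_{[0,1]^d}\mathbf 1_A(\theta_x)\,\Phi(\mathrm dx)$, with expectation $\mathbb E^\Phi_0$. The reduced second moment measure of a stationary random measure $\Psi$ is $\alpha_\Psi(B):=\mathbb E\int \mathbf 1\{x\in[0,1]^d,\,y-x\in B\}\,\Psi^2(\mathrm d(x,y))$. A random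 transport is a random measure $T$ on $\mathbb R^d\times\mathbb R^d$ such that $T(\cdot\times\mathbb R^d)$ is locally finite. A probability kernel $K$ from $\Omega\times\mathbb R^d$ to $\mathbb R^d$ is invariant if $K(\omega,x,B+x)=K(\theta_x\omega,0,B)$ for all $\omega,x,B$. Write $K_x=K(x)$ for the random probability measure $\omega\mapsto K(\omega,x,\cdot)$ and $K\Phi(\omega,\cdot):=\int K(\omega,x,\cdot)\,\Phi(\omega,\mathrm dx)$ (of intensity $\gamma$). In the conditional-expectation hypothesis, $x,y\in\Phi$ are the ($T$-measurably enumerated) atoms of $\Phi=T(\cdot\times\mathbb R^d)$, and conditional expectations of random measures are taken setwise. Under the hypotheses both $K\Phi$ and $L\Phi$ are locally square-integrable and $\eta$ extends from bounded Borel sets to a signed measure of finite total variation. Fourier conventions: $\hat f(k)=\int f(x)e^{-i\langle k,x\rangle}\mathrm dx$; for a signed measure $\nu$ of finite total variation, $\hat\nu(k)=\int e^{-i\langle k,x\rangle}\nu(\mathrm dx)$; $\hat K_0:=\widehat{K_0}$. The covariance measure of a stationary locally square-integrable random measure $\Psi$ with intensity $\gamma_\Psi$ is $\beta_\Psi:=\alpha_\Psi-\gamma_\Psi^2\lambda_d$ (on bounded Borel sets); its Bartlett spectral measure $\hat\beta_\Psi$ is the unique locally finite measure with $\int (f\star g)\,\mathrm d\beta_\Psi=(2\pi)^{-d}\int\hat f(k)\overline{\hat g(k)}\,\hat\beta_\Psi(\mathrm dk)$ for all bounded measurable $f,g\colon\mathbb R^d\to\mathbb R$ with bounded support, where $(f\star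 g)(y)=\int f(x)g(x-y)\,\mathrm dx$. $h\cdot\lambda_d$ denotes the measure with density $h$. *)

theory Defs
  imports "HOL-Probability.Probability"
begin

section \<open>Stationary setting\<close>

text \<open>A Borel space in the sense of Kallenberg.\<close>

definition borel_space :: "'w measure \<Rightarrow> bool" where
  "borel_space M \<longleftrightarrow>
     (\<exists>(f :: 'w \<Rightarrow> real) S. S \<in> sets borel \<and> S \<subseteq> {0..1} \<and> bij_betw f (space M) S \<and>
        f \<in> measurable M (restrict_space borel S) \<and>
        the_inv_into (space M) f \<in> measurable (restrict_space borel S) M)"

definition stationary_flow :: "'w measure \<Rightarrow> (real ^ 'd \<Rightarrow> 'w \<Rightarrow> 'w) \<Rightarrow> bool" where
  "stationary_flow M \<theta> \<longleftrightarrow>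
     (\<lambda>(\<omega>, x). \<theta> x \<omega>) \<in> measurable (M \<Otimes>\<^sub>M borel) M \<and>
     (\<forall>\<omega>\<in>space M. \<theta> 0 \<omega> = \<omega>) \<and>
     (\<forall>x y. \<forall>\<omega>\<in>space M. \<theta> x (\<theta> y \<omega>) = \<theta> (x + y) \<omega>) \<and>
     (\<forall>x. \<forall>A\<in>sets M. emeasure M (\<theta> x ` A) = emeasure M A)"

abbreviation unit_cube :: "(real ^ 'd) set" where
  "unit_cube \<equiv> cbox 0 1"

definition random_measure :: "'w measure \<Rightarrow> ('w \<Rightarrow> (real ^ 'd) measure) \<Rightarrow> bool" where
  "random_measure M \<Phi> \<longleftrightarrow>
     (\<forall>\<omega>\<in>space M. sets (\<Phi> \<omega>) = sets borel \<and>
        (\<forall>B\<in>sets borel. bounded B \<longrightarrow> emeasure (\<Phi> \<omega>) B < \<infinity>)) \<and>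
     (\<forall>B\<in>sets borel. (\<lambda>\<omega>. emeasure (\<Phi> \<omega>) B) \<in> borel_measurable M)"

definition invariant_measure ::
  "'w measure \<Rightarrow> (real ^ 'd \<Rightarrow> 'w \<Rightarrow> 'w) \<Rightarrow> ('w \<Rightarrow> (real ^ 'd) measure) \<Rightarrow> bool" where
  "invariant_measure M \<theta> \<Phi> \<longleftrightarrow>
     (\<forall>\<omega>\<in>space M. \<forall>x. \<forall>B\<in>sets borel.
        emeasure (\<Phi> \<omega>) ((\<lambda>y. y + x) ` B) = emeasure (\<Phi> (\<theta> x \<omega>)) B)"

definition purely_discrete :: "'w measure \<Rightarrow> ('w \<Rightarrow> (real ^ 'd) measure) \<Rightarrow> bool" where
  "purely_discrete M \<Phi> \<longleftrightarrow>
     (\<exists>(Y :: nat \<Rightarrow> 'w \<Rightarrow> real) (X :: nat \<Rightarrow> 'w \<Rightarrow> real ^ 'd).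
        (\<forall>n. Y n \<in> borel_measurable M \<and> X n \<in> borel_measurable M) \<and>
        (\<forall>\<omega>\<in>space M. (\<forall>n. 0 \<le> Y n \<omega>) \<and>
           (\<forall>B\<in>sets borel. emeasure (\<Phi> \<omega>) B = (\<Sum>n. ennreal (Y n \<omega>) * indicator B (X n \<omega>)))))"

definition locally_square_integrable :: "'w measure \<Rightarrow> ('w \<Rightarrow> (real ^ 'd) measure) \<Rightarrow> bool" where
  "locally_square_integrable M \<Phi> \<longleftrightarrow>
     (\<forall>B\<in>sets borel. bounded B \<longrightarrow> (\<integral>\<^sup>+\<omega>. (emeasure (\<Phi> \<omega>) B)\<^sup>2 \<partial>M) < \<infinity>)"

definition intensity :: "'w measure \<Rightarrow> ('w \<Rightarrow> (real ^ 'd) measure) \<Rightarrow> ennreal" where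
  "intensity M \<Phi> = (\<integral>\<^sup>+\<omega>. emeasure (\<Phi> \<omega>) unit_cube \<partial>M)"

definition palm ::
  "'w measure \<Rightarrow> (real ^ 'd \<Rightarrow> 'w \<Rightarrow> 'w) \<Rightarrow> ('w \<Rightarrow> (real ^ 'd) measure) \<Rightarrow> 'w measure" where
  "palm M \<theta> \<Phi> = measure_of (space M) (sets M)
     (\<lambda>A. (\<integral>\<^sup>+\<omega>. (\<integral>\<^sup>+x\<in>unit_cube. indicator A (\<theta> x \<omega>) \<partial>\<Phi> \<omega>) \<partial>M) / intensity M \<Phi>)"

text \<open>The reduced second moment measure.\<close>

definition second_moment :: "'w measure \<Rightarrow> ('w \<Rightarrow> (real ^ 'd) measure) \<Rightarrow> (real ^ 'd) measure" where
  "second_moment M \<Psi> = measure_of UNIV (sets borel)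
     (\<lambda>B. \<integral>\<^sup>+\<omega>. emeasure (\<Psi> \<omega> \<Otimes>\<^sub>M \<Psi> \<omega>) {(x, y). x \<in> unit_cube \<and> y - x \<in> B} \<partial>M)"


section \<open>Kernels and transports\<close>

definition invariant_kernel ::
  "'w measure \<Rightarrow> (real ^ 'd \<Rightarrow> 'w \<Rightarrow> 'w) \<Rightarrow> ('w \<Rightarrow> real ^ 'd \<Rightarrow> (real ^ 'd) measure) \<Rightarrow> bool" where
  "invariant_kernel M \<theta> K \<longleftrightarrow>
     (\<lambda>(\<omega>, x). K \<omega> x) \<in> measurable (M \<Otimes>\<^sub>M borel) (prob_algebra borel) \<and>
     (\<forall>\<omega>\<in>space M. \<forall>x. \<forall>B\<in>sets borel.
        emeasure (K \<omega> x) ((\<lambda>y. y + x) ` B) = emeasure (K (\<theta> x \<omega>) 0) B)"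

text \<open>The Giry bind is used here with a first argument that is only locally finite; it still
  integrates the kernel, see the two evaluation lemmas.\<close>

definition kernel_measure ::
  "('w \<Rightarrow> real ^ 'd \<Rightarrow> (real ^ 'd) measure) \<Rightarrow> ('w \<Rightarrow> (real ^ 'd) measure) \<Rightarrow> 'w \<Rightarrow> (real ^ 'd) measure" where
  "kernel_measure K \<Phi> \<omega> = \<Phi> \<omega> \<bind> K \<omega>"

definition transport ::
  "('w \<Rightarrow> real ^ 'd \<Rightarrow> (real ^ 'd) measure) \<Rightarrow> ('w \<Rightarrow> (real ^ 'd) measure) \<Rightarrow>
     'w \<Rightarrow> ((real ^ 'd) \<times> (real ^ 'd)) measure" where
  "transport L \<Phi> \<omega> = \<Phi> \<omega> \<bind> (\<lambda>x. distr (L \<omega> x) borel (Pair x))"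

lemma invariant_kernel_section:
  assumes "invariant_kernel M \<theta> K" "\<omega> \<in> space M"
  shows "K \<omega> \<in> measurable borel (prob_algebra borel)"
proof -
  have *: "(\<lambda>(\<omega>, x). K \<omega> x) \<in> measurable (M \<Otimes>\<^sub>M borel) (prob_algebra borel)"
    using assms(1) unfolding invariant_kernel_def by (rule conjunct1)
  show ?thesis
    using measurable_compose[OF measurable_Pair1'[OF assms(2)] *] by simp
qed

lemma emeasure_kernel_measure:
  assumes "random_measure M \<Phi>" "invariant_kernel M \<theta> K" "\<omega> \<in> space M" "B \<in> sets borel"
  shows "emeasure (kernel_measure K \<Phi> \<omega>) B = (\<integral>\<^sup>+x. emeasure (K \<omega> x) B \<partial>\<Phi> \<omega>)"
proof -
  have s[measurable_cong]: "sets (\<Phi> \<omega>) = sets borel"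
    using assms(1,3) by (auto simp: random_measure_def)
  have sp: "space (\<Phi> \<omega>) = UNIV" using sets_eq_imp_space_eq[OF s] by simp
  have "K \<omega> \<in> measurable (\<Phi> \<omega>) (subprob_algebra borel)"
    using measurable_prob_algebraD[OF invariant_kernel_section[OF assms(2,3)]]
    by (simp add: measurable_cong_sets[OF s refl])
  then show ?thesis
    unfolding kernel_measure_def using assms(4) sp by (intro emeasure_bind) auto
qed

lemma emeasure_transport:
  fixes \<Phi> :: "'w \<Rightarrow> (real ^ 'd) measure"
  assumes "random_measure M \<Phi>" "invariant_kernel M \<theta> L" "\<omega> \<in> space M" "C \<in> sets borel"
  shows "emeasure (transport L \<Phi> \<omega>) C = (\<integral>\<^sup>+x. emeasure (L \<omega> x) {y. (x, y) \<in> C} \<partial>\<Phi> \<omega>)"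
proof -
  have s[measurable_cong]: "sets (\<Phi> \<omega>) = sets borel"
    using assms(1,3) by (auto simp: random_measure_def)
  have sp: "space (\<Phi> \<omega>) = UNIV" using sets_eq_imp_space_eq[OF s] by simp
  have L[measurable]: "L \<omega> \<in> measurable (\<Phi> \<omega>) (subprob_algebra borel)"
    using measurable_prob_algebraD[OF invariant_kernel_section[OF assms(2,3)]]
    by (simp add: measurable_cong_sets[OF s refl])
  have sL: "sets (L \<omega> x) = sets borel" "space (L \<omega> x) = UNIV" for x
    using measurable_space[OF L, of x] sp by (auto simp: space_subprob_algebra dest: sets_eq_imp_space_eq)
  have "(\<lambda>x. distr (L \<omega> x) (borel :: ((real ^ 'd) \<times> (real ^ 'd)) measure) (Pair x))
     \<in> measurable (\<Phi> \<omega>) (subprob_algebra borel)"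
    by (rule measurable_distr2[OF _ L]) (simp add: borel_prod measurable_cong_sets[OF sets_pair_measure_cong[OF s refl] refl])
  then have "emeasure (transport L \<Phi> \<omega>) C =
      (\<integral>\<^sup>+x. emeasure (distr (L \<omega> x) borel (Pair x)) C \<partial>\<Phi> \<omega>)"
    unfolding transport_def using assms(4) sp by (intro emeasure_bind) auto
  also have "\<dots> = (\<integral>\<^sup>+x. emeasure (L \<omega> x) {y. (x, y) \<in> C} \<partial>\<Phi> \<omega>)"
  proof (rule nn_integral_cong)
    fix x
    have "Pair x \<in> measurable (L \<omega> x) (borel :: ((real ^ 'd) \<times> (real ^ 'd)) measure)"
      by (simp add: measurable_cong_sets[OF sL(1) refl] borel_prod[symmetric])
    then show "emeasure (distr (L \<omega> x) borel (Pair x)) C = emeasure (L \<omega> x) {y. (x, y) \<in> C}"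
      using assms(4) sL by (simp add: emeasure_distr vimage_def)
  qed
  finally show ?thesis .
qed

text \<open>The sigma-field on the probability space generated by a random transport.\<close>

definition transport_field ::
  "'w measure \<Rightarrow> ('w \<Rightarrow> ((real ^ 'd) \<times> (real ^ 'd)) measure) \<Rightarrow> 'w measure" where
  "transport_field M T = sigma (space M)
     {(\<lambda>\<omega>. emeasure (T \<omega>) C) -` U \<inter> space M | C U. C \<in> sets borel \<and> U \<in> sets borel}"

text \<open>The condition that, given \<open>T\<close>, the conditional expectation of \<open>K\<^sub>x \<otimes> K\<^sub>y\<close> is
  \<open>L\<^sub>x \<otimes> L\<^sub>y\<close> for distinct atoms \<open>x, y\<close> of \<open>\<Phi>\<close>: the atoms are among the points \<open>X n\<close> of a
  \<open>T\<close>-measurable sequence (which may contain repetitions and points that are not atoms), and the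
  identity is required setwise on the event that \<open>X m\<close> and \<open>X n\<close> are distinct atoms.\<close>

definition conditional_product_condition ::
  "'w measure \<Rightarrow> ('w \<Rightarrow> (real ^ 'd) measure) \<Rightarrow> ('w \<Rightarrow> ((real ^ 'd) \<times> (real ^ 'd)) measure) \<Rightarrow>
     ('w \<Rightarrow> real ^ 'd \<Rightarrow> (real ^ 'd) measure) \<Rightarrow> ('w \<Rightarrow> real ^ 'd \<Rightarrow> (real ^ 'd) measure) \<Rightarrow> bool" where
  "conditional_product_condition M \<Phi> T K L \<longleftrightarrow>
     (\<exists>X :: nat \<Rightarrow> 'w \<Rightarrow> real ^ 'd.
        (\<forall>n. X n \<in> borel_measurable (transport_field M T)) \<and>
        (\<forall>\<omega>\<in>space M. \<forall>x. emeasure (\<Phi> \<omega>) {x} > 0 \<longrightarrow> (\<exists>n. X n \<omega> = x)) \<and>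
        (\<forall>m n. \<forall>C\<in>sets (borel \<Otimes>\<^sub>M borel). AE \<omega> in M.
           emeasure (\<Phi> \<omega>) {X m \<omega>} > 0 \<and> emeasure (\<Phi> \<omega>) {X n \<omega>} > 0 \<and> X m \<omega> \<noteq> X n \<omega> \<longrightarrow>
           real_cond_exp M (transport_field M T)
             (\<lambda>\<omega>. measure (K \<omega> (X m \<omega>) \<Otimes>\<^sub>M K \<omega> (X n \<omega>)) C) \<omega>
           = measure (L \<omega> (X m \<omega>) \<Otimes>\<^sub>M L \<omega> (X n \<omega>)) C))"


section \<open>Finite signed measures\<close>

text \<open>A signed measure is a real set function, relevant only on Borel sets; integrals are taken
  with respect to its Jordan decomposition.\<close>

definition jordan_pos :: "('a::topological_space set \<Rightarrow> real) \<Rightarrow> 'a measure" where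
  "jordan_pos \<nu> = measure_of UNIV (sets borel)
     (\<lambda>B. SUP A\<in>{A \<in> sets borel. A \<subseteq> B}. ennreal (\<nu> A))"

definition jordan_neg :: "('a::topological_space set \<Rightarrow> real) \<Rightarrow> 'a measure" where
  "jordan_neg \<nu> = jordan_pos (\<lambda>A. - \<nu> A)"

definition finite_signed_measure :: "('a::topological_space set \<Rightarrow> real) \<Rightarrow> bool" where
  "finite_signed_measure \<nu> \<longleftrightarrow>
     (\<forall>A :: nat \<Rightarrow> 'a set. range A \<subseteq> sets borel \<longrightarrow> disjoint_family A \<longrightarrow>
        (\<lambda>n. \<nu> (A n)) sums \<nu> (\<Union>n. A n)) \<and>
     emeasure (jordan_pos \<nu>) UNIV + emeasure (jordan_neg \<nu>) UNIV < \<infinity>"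


section \<open>Fourier transforms and the Bartlett spectral measure\<close>

definition fourier_fun :: "(real ^ 'd \<Rightarrow> real) \<Rightarrow> real ^ 'd \<Rightarrow> complex" where
  "fourier_fun f k = (\<integral>x. complex_of_real (f x) * cis (- (k \<bullet> x)) \<partial>lborel)"

definition fourier_measure :: "(real ^ 'd) measure \<Rightarrow> real ^ 'd \<Rightarrow> complex" where
  "fourier_measure \<mu> k = (\<integral>x. cis (- (k \<bullet> x)) \<partial>\<mu>)"

definition fourier_signed :: "((real ^ 'd) set \<Rightarrow> real) \<Rightarrow> real ^ 'd \<Rightarrow> complex" where
  "fourier_signed \<nu> k = fourier_measure (jordan_pos \<nu>) k - fourier_measure (jordan_neg \<nu>) k"

definition cross_corr :: "(real ^ 'd \<Rightarrow> real) \<Rightarrow> (real ^ 'd \<Rightarrow> real) \<Rightarrow> real ^ 'd \<Rightarrow> real" where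
  "cross_corr f g y = (\<integral>x. f x * g (x - y) \<partial>lborel)"

definition test_fun :: "(real ^ 'd \<Rightarrow> real) \<Rightarrow> bool" where
  "test_fun f \<longleftrightarrow> f \<in> borel_measurable borel \<and> bounded (range f) \<and> bounded {x. f x \<noteq> 0}"

text \<open>Integration with respect to the covariance measure, the (locally finite) signed measure
  \<open>\<alpha>\<^sub>\<Psi> - \<gamma>\<^sub>\<Psi>\<^sup>2 \<lambda>\<^sub>d\<close>.\<close>

definition covariance_integral ::
  "'w measure \<Rightarrow> ('w \<Rightarrow> (real ^ 'd) measure) \<Rightarrow> (real ^ 'd \<Rightarrow> real) \<Rightarrow> real" where
  "covariance_integral M \<Psi> h =
     (\<integral>y. h y \<partial>second_moment M \<Psi>) - (enn2real (intensity M \<Psi>))\<^sup>2 * (\<integral>y. h y \<partial>lborel)"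

text \<open>\<open>\<nu>\<close> is the Bartlett spectral measure of \<open>\<Psi>\<close>. Integrability of the right-hand side has to be
  required, since non-integrable functions have Bochner integral \<open>0\<close>.\<close>

definition is_bartlett_measure ::
  "'w measure \<Rightarrow> ('w \<Rightarrow> (real ^ 'd) measure) \<Rightarrow> (real ^ 'd) measure \<Rightarrow> bool" where
  "is_bartlett_measure M \<Psi> \<nu> \<longleftrightarrow>
     sets \<nu> = sets borel \<and>
     (\<forall>B\<in>sets borel. bounded B \<longrightarrow> emeasure \<nu> B < \<infinity>) \<and>
     (\<forall>f g. test_fun f \<longrightarrow> test_fun g \<longrightarrow>
        integrable \<nu> (\<lambda>k. fourier_fun f k * cnj (fourier_fun g k)) \<and>
        complex_of_real (covariance_integral M \<Psi> (cross_corr f g)) =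
          complex_of_real (1 / (2 * pi) ^ CARD('d)) *
          (\<integral>k. fourier_fun f k * cnj (fourier_fun g k) \<partial>\<nu>))"

end

(* The second moment of K Phi splits into the contribution of pairs of distinct atoms of Phi,
   which by conditioning on T is the same for K and L, and a diagonal contribution. By the refined
   Campbell theorem the latter contributes to the reduced second moment measure a finite measure
   D_K, the law of the difference of two independent K_0-distributed points under
   gamma Phi{0} P_0^Phi. Hence eta = D_K - D_L, and the transform of D_K is
   gamma E_0 [|K_0^|^2 Phi{0}], which is real and nonnegative.
   For the spectral measures take a tent function f and its translates: the finite measures
   |f^|^2 (beta_K + D_L^ lambda) and |f^|^2 (beta_L + D_K^ lambda) have the same Fourier transform,
   by Fourier inversion for the autocorrelation of f. They therefore coincide, and f^ has no zeros
   on a given bounded set if the support of f is small. *)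

theory Submission
  imports Defs
begin

section \<open>Sums of measures\<close>

text \<open>The spectral measures, the second moment measures and Lebesgue measure may all be
  infinite, so the comparisons are not differences of finite measures. They are therefore written as
  equalities of two sums of nonnegative measures, \<open>add_measure P Q = add_measure R S\<close>,
  and become differences only for finite measures or on bounded sets. This is also where the sign of
  the transform of D_K matters: it makes the transform a density that can be added on the other
  side. The weight |f^|^2 is there because the uniqueness theorem for Fourier transforms covers
  finite measures only. Uniqueness and inversion in R^d both come from one Fubini identity with a
  Gaussian, \<open>fourier_gauss_smoothing\<close>. A second obstacle is that K Phi is known to be
  locally finite only almost surely, so its product with itself is computed outside a null set. The
  condition E_0 Phi{0} < infinity enters as the finiteness of D_K and D_L, which gives eta its
  finite total variation and carries local square-integrability from one transport to the
  other.\<close>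

definition add_measure :: "'a measure \<Rightarrow> 'a measure \<Rightarrow> 'a measure" where
  "add_measure P Q = measure_of (space P) (sets P) (\<lambda>A. emeasure P A + emeasure Q A)"

lemma sets_add_measure[simp, measurable_cong]: "sets (add_measure P Q) = sets P"
  and space_add_measure[simp]: "space (add_measure P Q) = space P"
  by (auto simp: add_measure_def)

lemma emeasure_add_measure:
  assumes "sets Q = sets P"
  shows "emeasure (add_measure P Q) A = emeasure P A + emeasure Q A"
proof (cases "A \<in> sets P")
  case True
  show ?thesis unfolding add_measure_def
  proof (rule emeasure_measure_of_sigma[OF _ _ _ True])
    show "sigma_algebra (space P) (sets P)" ..
    show "positive (sets P) (\<lambda>A. emeasure P A + emeasure Q A)" by (simp add: positive_def)
    show "countably_additive (sets P) (\<lambda>A. emeasure P A + emeasure Q A)"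
    proof (rule countably_additiveI)
      fix A :: "nat \<Rightarrow> _" assume A: "range A \<subseteq> sets P" "disjoint_family A"
      have "(\<Sum>i. emeasure P (A i) + emeasure Q (A i)) = (\<Sum>i. emeasure P (A i)) + (\<Sum>i. emeasure Q (A i))"
        by (rule suminf_add[symmetric]) auto
      then show "(\<Sum>i. emeasure P (A i) + emeasure Q (A i)) = emeasure P (\<Union>i. A i) + emeasure Q (\<Union>i. A i)"
        using A assms by (simp add: suminf_emeasure)
    qed
  qed
next
  case False
  then show ?thesis using assms by (simp add: emeasure_notin_sets)
qed

lemma nn_integral_add_measure:
  assumes Q: "sets Q = sets P" and "f \<in> borel_measurable P"
  shows "(\<integral>\<^sup>+x. f x \<partial>add_measure P Q) = (\<integral>\<^sup>+x. f x \<partial>P) + (\<integral>\<^sup>+x. f x \<partial>Q)"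
  using assms(2)
proof (induction rule: borel_measurable_induct)
  case (cong f g)
  have "space Q = space P" using Q by (rule sets_eq_imp_space_eq)
  then show ?case using cong nn_integral_cong[of P f g] nn_integral_cong[of Q f g]
      nn_integral_cong[of "add_measure P Q" f g] by simp
next
  case (set A)
  then show ?case using Q by (simp add: emeasure_add_measure)
next
  case (mult u c)
  then show ?case using measurable_cong_sets[OF Q refl]
    by (subst (1 2 3) nn_integral_cmult) (auto simp: distrib_left measurable_cong_sets[OF Q refl] measurable_cong_sets[of "add_measure P Q" P])
next
  case (add u v)
  then show ?case
    by (subst (1 2 3) nn_integral_add)
      (auto simp: measurable_cong_sets[OF Q refl] measurable_cong_sets[of "add_measure P Q" P] ac_simps)
next
  case (seq U)
  have m: "U i \<in> borel_measurable Q" "U i \<in> borel_measurable (add_measure P Q)" for i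
    using seq by (auto simp: measurable_cong_sets[OF Q refl] measurable_cong_sets[of "add_measure P Q" P])
  have i: "incseq (\<lambda>i. \<integral>\<^sup>+x. U i x \<partial>N)" for N
    using seq(3) by (auto simp: incseq_def le_fun_def intro!: nn_integral_mono)
  have "(SUP i. (\<integral>\<^sup>+x. U i x \<partial>P) + (\<integral>\<^sup>+x. U i x \<partial>Q)) = (SUP i. (\<integral>\<^sup>+x. U i x \<partial>P)) + (SUP i. (\<integral>\<^sup>+x. U i x \<partial>Q))"
    by (rule ennreal_SUP_add[OF i i])
  moreover have f: "(\<Squnion> range U) x = (SUP i. U i x)" for x by (simp add: image_comp)
  moreover have "(\<integral>\<^sup>+x. (SUP i. U i x) \<partial>N) = (SUP i. \<integral>\<^sup>+x. U i x \<partial>N)"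
    if "\<And>i. U i \<in> borel_measurable N" for N
    by (rule nn_integral_monotone_convergence_SUP[OF seq(3) that])
  ultimately show ?case using seq(1,5) m i unfolding f by simp
qed

lemma finite_measure_add_measure:
  assumes "sets Q = sets P" "finite_measure P" "finite_measure Q"
  shows "finite_measure (add_measure P Q)"
  using assms sets_eq_imp_space_eq[OF assms(1)]
  by (intro finite_measureI) (auto simp: emeasure_add_measure finite_measure.emeasure_finite)

lemma real_integral_add_measure:
  fixes f :: "'a \<Rightarrow> real"
  assumes Q: "sets Q = sets P" and i: "integrable P f" "integrable Q f"
  shows "integrable (add_measure P Q) f"
    and "(\<integral>x. f x \<partial>add_measure P Q) = (\<integral>x. f x \<partial>P) + (\<integral>x. f x \<partial>Q)"
proof -
  have m[measurable]: "f \<in> borel_measurable P" "f \<in> borel_measurable Q" using i by auto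
  have mA: "f \<in> borel_measurable (add_measure P Q)"
    by (simp add: measurable_cong_sets[of "add_measure P Q" P])
  have eq: "(\<integral>\<^sup>+x. ennreal (g x) \<partial>add_measure P Q) = (\<integral>\<^sup>+x. ennreal (g x) \<partial>P) + (\<integral>\<^sup>+x. ennreal (g x) \<partial>Q)"
    if [measurable]: "g \<in> borel_measurable P" for g :: "'a \<Rightarrow> real"
    by (rule nn_integral_add_measure[OF Q]) measurable
  show I: "integrable (add_measure P Q) f"
    using i mA eq[of "\<lambda>x. norm (f x)"] unfolding integrable_iff_bounded by auto
  \<comment> \<open>Finite positive and negative parts are needed because \<open>enn2real\<close> is
    additive only on finite values.\<close>
  have fin: "(\<integral>\<^sup>+x. ennreal (f x) \<partial>P) < \<infinity>" "(\<integral>\<^sup>+x. ennreal (f x) \<partial>Q) < \<infinity>"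
      "(\<integral>\<^sup>+x. ennreal (- f x) \<partial>P) < \<infinity>" "(\<integral>\<^sup>+x. ennreal (- f x) \<partial>Q) < \<infinity>"
    using real_integrable_def[of P f] real_integrable_def[of Q f] i by (auto simp: top.not_eq_extremum)
  show "(\<integral>x. f x \<partial>add_measure P Q) = (\<integral>x. f x \<partial>P) + (\<integral>x. f x \<partial>Q)"
    unfolding real_lebesgue_integral_def[OF I] real_lebesgue_integral_def[OF i(1)]
      real_lebesgue_integral_def[OF i(2)] using fin
    by (subst (1 2) eq) (auto simp: enn2real_plus)
qed

lemma complex_integral_add_measure:
  fixes f :: "'a \<Rightarrow> complex"
  assumes Q: "sets Q = sets P" and i: "integrable P f" "integrable Q f"
  shows "integrable (add_measure P Q) f"
    and "(\<integral>x. f x \<partial>add_measure P Q) = (\<integral>x. f x \<partial>P) + (\<integral>x. f x \<partial>Q)"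
proof -
  have r: "integrable P (\<lambda>x. Re (f x))" "integrable Q (\<lambda>x. Re (f x))"
      "integrable P (\<lambda>x. Im (f x))" "integrable Q (\<lambda>x. Im (f x))"
    using i by auto
  note R = real_integral_add_measure[OF Q r(1,2)] and J = real_integral_add_measure[OF Q r(3,4)]
  show I: "integrable (add_measure P Q) f"
  proof -
    have "integrable (add_measure P Q) (\<lambda>x. complex_of_real (Re (f x)) + \<i> * complex_of_real (Im (f x)))"
      using R(1) J(1) by (intro Bochner_Integration.integrable_add integrable_mult_right) auto
    then show ?thesis by (simp add: complex_eq[symmetric])
  qed
  show "(\<integral>x. f x \<partial>add_measure P Q) = (\<integral>x. f x \<partial>P) + (\<integral>x. f x \<partial>Q)"
    using R(2) J(2) i I by (simp add: complex_eq_iff)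
qed

lemma add_measure_eqI:
  assumes "sets Q = sets P" "sets R = sets P" "sets S = sets P"
    and "\<And>A. A \<in> sets P \<Longrightarrow> emeasure P A + emeasure Q A = emeasure R A + emeasure S A"
  shows "add_measure P Q = add_measure R S"
  using assms by (intro measure_eqI) (auto simp: emeasure_add_measure)

section \<open>Jordan decomposition\<close>

text \<open>\<open>Y\<close> is a Hahn set for \<open>P - N\<close>: the supremum defining the
  positive part of \<open>B\<close> is attained at \<open>B \<inter> Y\<close>. The mass is stated
  additively, so that no truncated extended subtraction has to be undone later.\<close>

lemma jordan_pos_diff:
  fixes P N :: "'a::topological_space measure"
  assumes P: "finite_measure P" "sets P = sets borel" and N: "finite_measure N" "sets N = sets borel"
    and Y: "Y \<in> sets borel"
    and YP: "\<And>X. X \<in> sets borel \<Longrightarrow> X \<subseteq> Y \<Longrightarrow> emeasure N X \<le> emeasure P X"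
    and YN: "\<And>X. X \<in> sets borel \<Longrightarrow> X \<inter> Y = {} \<Longrightarrow> emeasure P X \<le> emeasure N X"
  shows "sets (jordan_pos (\<lambda>B. measure P B - measure N B)) = sets borel"
    and "\<And>B. B \<in> sets borel \<Longrightarrow>
      emeasure (jordan_pos (\<lambda>B. measure P B - measure N B)) B + emeasure N (B \<inter> Y) = emeasure P (B \<inter> Y)"
proof -
  interpret P: finite_measure P by fact
  interpret N: finite_measure N by fact
  \<comment> \<open>Densities by the indicator of \<open>Y\<close> restrict both measures to the set
    where \<open>N\<close> lies below \<open>P\<close>, the situation in which
    \<open>diff_measure\<close> is an honest difference.\<close>
  let ?P = "density P (indicator Y)" and ?N = "density N (indicator Y)"
  have e: "emeasure ?P B = emeasure P (B \<inter> Y)" "emeasure ?N B = emeasure N (B \<inter> Y)" if "B \<in> sets borel" for B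
    using that P N Y by (auto simp: emeasure_density indicator_inter_arith[symmetric] Int_commute mult.commute)
  have le: "emeasure N (B \<inter> Y) \<le> emeasure P (B \<inter> Y)" if "B \<in> sets borel" for B
    using that Y by (intro YP) auto
  have fin: "finite_measure ?P" "finite_measure ?N"
    using e[of UNIV] P N sets_eq_imp_space_eq[OF P(2)] sets_eq_imp_space_eq[OF N(2)]
    by (auto intro!: finite_measureI)
  have D: "emeasure (diff_measure ?P ?N) B = emeasure P (B \<inter> Y) - emeasure N (B \<inter> Y)"
    if "B \<in> sets borel" for B
    using that P N fin e le by (subst emeasure_diff_measure) auto
  have S: "(SUP A\<in>{A \<in> sets borel. A \<subseteq> B}. ennreal (measure P A - measure N A)) = emeasure P (B \<inter> Y) - emeasure N (B \<inter> Y)"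
    if B: "B \<in> sets borel" for B
  proof (rule antisym)
    show "(SUP A\<in>{A \<in> sets borel. A \<subseteq> B}. ennreal (measure P A - measure N A)) \<le> emeasure P (B \<inter> Y) - emeasure N (B \<inter> Y)"
    proof (rule SUP_least)
      \<comment> \<open>Passing from \<open>A\<close> to \<open>B \<inter> Y\<close> drops
        \<open>A - Y\<close>, where the signed mass is nonpositive, and adds
        \<open>(B - A) \<inter> Y\<close>, where it is nonnegative.\<close>
      fix A assume A: "A \<in> {A \<in> sets borel. A \<subseteq> B}"
      have sA: "A \<in> sets P" "A \<in> sets N" "B \<in> sets P" "B \<in> sets N" "Y \<in> sets P" "Y \<in> sets N" using A P N B Y by auto
      have "measure P A = measure P (A \<inter> Y) + measure P (A - Y)"
        using sA by (subst P.finite_measure_Union[symmetric]) (auto intro!: arg_cong[where f="measure P"])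
      moreover have "measure N A = measure N (A \<inter> Y) + measure N (A - Y)"
        using sA by (subst N.finite_measure_Union[symmetric]) (auto intro!: arg_cong[where f="measure N"])
      moreover have "measure P (A - Y) \<le> measure N (A - Y)"
        using YN[of "A - Y"] sA P N by (auto simp: P.emeasure_eq_measure N.emeasure_eq_measure)
      moreover have "measure P (B \<inter> Y) = measure P (A \<inter> Y) + measure P ((B - A) \<inter> Y)"
        using sA A by (subst P.finite_measure_Union[symmetric]) (auto intro!: arg_cong[where f="measure P"])
      moreover have "measure N (B \<inter> Y) = measure N (A \<inter> Y) + measure N ((B - A) \<inter> Y)"
        using sA A by (subst N.finite_measure_Union[symmetric]) (auto intro!: arg_cong[where f="measure N"])
      moreover have "measure N ((B - A) \<inter> Y) \<le> measure P ((B - A) \<inter> Y)"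
        using YP[of "(B - A) \<inter> Y"] sA P N by (auto simp: P.emeasure_eq_measure N.emeasure_eq_measure)
      ultimately have "measure P A - measure N A \<le> measure P (B \<inter> Y) - measure N (B \<inter> Y)" by linarith
      then show "ennreal (measure P A - measure N A) \<le> emeasure P (B \<inter> Y) - emeasure N (B \<inter> Y)"
        by (simp add: P.emeasure_eq_measure N.emeasure_eq_measure ennreal_minus ennreal_leI)
    qed
    show "emeasure P (B \<inter> Y) - emeasure N (B \<inter> Y) \<le> (SUP A\<in>{A \<in> sets borel. A \<subseteq> B}. ennreal (measure P A - measure N A))"
      using B Y by (intro SUP_upper2[of "B \<inter> Y"]) (auto simp: P.emeasure_eq_measure N.emeasure_eq_measure ennreal_minus)
  qed
  \<comment> \<open>\<open>measure_of\<close> applied to the supremum is meaningful because the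
    supremum agrees on Borel sets with a genuine measure.\<close>
  have J: "jordan_pos (\<lambda>B. measure P B - measure N B) = diff_measure ?P ?N"
  proof -
    have "jordan_pos (\<lambda>B. measure P B - measure N B) = measure_of UNIV (sets borel) (emeasure (diff_measure ?P ?N))"
      unfolding jordan_pos_def
      by (rule measure_of_eq) (auto simp: sets.sigma_sets_eq[of borel, simplified] S D)
    also have "\<dots> = diff_measure ?P ?N"
      using measure_of_of_measure[of "diff_measure ?P ?N"] P sets_eq_imp_space_eq[OF P(2)] by simp
    finally show ?thesis .
  qed
  show "sets (jordan_pos (\<lambda>B. measure P B - measure N B)) = sets borel"
    using P unfolding J by simp
  show "emeasure (jordan_pos (\<lambda>B. measure P B - measure N B)) B + emeasure N (B \<inter> Y) = emeasure P (B \<inter> Y)"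
    if "B \<in> sets borel" for B
    unfolding J D[OF that] using le[OF that] by (simp add: diff_add_cancel_ennreal)
qed

text \<open>The complement of the Hahn set serves the swapped pair, so the negative part needs no
  separate argument. The closing identity says in additive form that the Jordan parts differ by
  \<open>P - N\<close>; integration against \<open>\<eta>\<close> requires nothing more.\<close>

lemma jordan_diff:
  fixes P N :: "'a::topological_space measure"
  assumes P: "finite_measure P" "sets P = sets borel" and N: "finite_measure N" "sets N = sets borel"
  defines "\<eta> \<equiv> \<lambda>B. measure P B - measure N B"
  shows "finite_measure (jordan_pos \<eta>)" "sets (jordan_pos \<eta>) = sets borel"
    "finite_measure (jordan_neg \<eta>)" "sets (jordan_neg \<eta>) = sets borel"
    and "add_measure (jordan_pos \<eta>) N = add_measure (jordan_neg \<eta>) P"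
proof -
  interpret P: finite_measure P by fact
  interpret N: finite_measure N by fact
  have sp: "space P = UNIV" "space N = UNIV"
    using sets_eq_imp_space_eq[OF P(2)] sets_eq_imp_space_eq[OF N(2)] by simp_all
  have sets_PN: "sets N = sets P" and UNIV_P: "UNIV \<in> sets P"
    unfolding P(2) N(2) by auto
  obtain Y where "Y \<in> sets P" and Y1: "\<forall>X\<in>sets P. X \<subseteq> Y \<longrightarrow> N X \<le> P X"
    and Y2: "\<forall>X\<in>sets P. X \<subseteq> UNIV \<longrightarrow> X \<inter> Y = {} \<longrightarrow> P X \<le> N X"
    using unsigned_Hahn_decomposition[OF sets_PN UNIV_P P.emeasure_finite N.emeasure_finite] by metis
  then have Y: "Y \<in> sets borel" "\<And>X. X \<in> sets borel \<Longrightarrow> X \<subseteq> Y \<Longrightarrow> N X \<le> P X"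
      "\<And>X. X \<in> sets borel \<Longrightarrow> X \<inter> Y = {} \<Longrightarrow> P X \<le> N X"
    unfolding P(2) by blast+
  have p: "sets (jordan_pos \<eta>) = sets borel"
      "\<And>B. B \<in> sets borel \<Longrightarrow> emeasure (jordan_pos \<eta>) B + emeasure N (B \<inter> Y) = emeasure P (B \<inter> Y)"
    unfolding \<eta>_def using jordan_pos_diff[OF P N Y] by blast+
  have Y': "- Y \<in> sets borel" "\<And>X. X \<in> sets borel \<Longrightarrow> X \<subseteq> - Y \<Longrightarrow> P X \<le> N X"
      "\<And>X. X \<in> sets borel \<Longrightarrow> X \<inter> - Y = {} \<Longrightarrow> N X \<le> P X"
    using Y by auto
  have neg: "jordan_neg \<eta> = jordan_pos (\<lambda>B. measure N B - measure P B)"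
    by (simp add: jordan_neg_def \<eta>_def)
  have n: "sets (jordan_neg \<eta>) = sets borel"
      "\<And>B. B \<in> sets borel \<Longrightarrow> emeasure (jordan_neg \<eta>) B + emeasure P (B \<inter> - Y) = emeasure N (B \<inter> - Y)"
    unfolding neg using jordan_pos_diff[OF N P Y'] by blast+
  have sp': "space (jordan_pos \<eta>) = UNIV" "space (jordan_neg \<eta>) = UNIV"
    using sets_eq_imp_space_eq[OF p(1)] sets_eq_imp_space_eq[OF n(1)] by simp_all
  show sets: "sets (jordan_pos \<eta>) = sets borel" "sets (jordan_neg \<eta>) = sets borel" by (rule p(1), rule n(1))
  have 1: "emeasure (jordan_pos \<eta>) UNIV \<le> emeasure P Y" using p(2)[of UNIV] 
    by (simp flip: le_iff_add) (metis le_iff_add)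
  have 2: "emeasure (jordan_neg \<eta>) UNIV \<le> emeasure N (- Y)" using n(2)[of UNIV] 
    by (simp flip: le_iff_add) (metis le_iff_add)
  show "finite_measure (jordan_pos \<eta>)" using 1 sp' by (intro finite_measureI) (auto simp: top_unique)
  show "finite_measure (jordan_neg \<eta>)" using 2 sp' by (intro finite_measureI) (auto simp: top_unique)
  show "add_measure (jordan_pos \<eta>) N = add_measure (jordan_neg \<eta>) P"
  proof (rule add_measure_eqI)
    fix B assume "B \<in> sets (jordan_pos \<eta>)"
    then have B: "B \<in> sets borel" using sets by simp
    have "emeasure P B = emeasure P (B \<inter> Y) + emeasure P (B \<inter> - Y)"
      "emeasure N B = emeasure N (B \<inter> Y) + emeasure N (B \<inter> - Y)"
      using B Y(1) P(2) N(2)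
      by (subst plus_emeasure; force simp: Int_Un_distrib[symmetric])+
    then show "emeasure (jordan_pos \<eta>) B + emeasure N B = emeasure (jordan_neg \<eta>) B + emeasure P B"
      using p(2)[OF B] n(2)[OF B] by (metis add.commute add.left_commute)
  qed (use sets P N in auto)
qed

lemma finite_signed_measure_diff:
  fixes P N :: "'a::topological_space measure"
  assumes P: "finite_measure P" "sets P = sets borel" and N: "finite_measure N" "sets N = sets borel"
  shows "finite_signed_measure (\<lambda>B. measure P B - measure N B)"
proof -
  note j = jordan_diff[OF P N]
  show ?thesis unfolding finite_signed_measure_def
    using finite_measure.emeasure_finite[OF j(1)] finite_measure.emeasure_finite[OF j(3)] P N
    by (auto simp: less_top[symmetric] intro!: sums_diff finite_measure.finite_measure_UNION)
qed

lemma integrable_cis: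
  fixes P :: "(real ^ 'd) measure"
  assumes "finite_measure P" "sets P = sets borel"
  shows "integrable P (\<lambda>x. cis (- (k \<bullet> x)))"
proof -
  interpret finite_measure P by fact
  have "(\<lambda>x. cis (- (k \<bullet> x))) \<in> borel_measurable P"
    unfolding measurable_cong_sets[OF assms(2) refl]
    by (intro borel_measurable_continuous_onI continuous_intros)
  then show ?thesis by (intro integrable_const_bound[of _ 1]) auto
qed

text \<open>A signed integral does not depend on which pair of finite measures represents the signed
  measure. The Jordan decomposition can thus be forgotten in favour of two explicit laws.\<close>

lemma fourier_signed_diff:
  fixes P N :: "(real ^ 'd) measure"
  assumes P: "finite_measure P" "sets P = sets borel" and N: "finite_measure N" "sets N = sets borel"
  shows "fourier_signed (\<lambda>B. measure P B - measure N B) k = fourier_measure P k - fourier_measure N k"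
proof -
  note j = jordan_diff[OF P N]
  have "fourier_measure (jordan_pos (\<lambda>B. measure P B - measure N B)) k + fourier_measure N k =
    fourier_measure (jordan_neg (\<lambda>B. measure P B - measure N B)) k + fourier_measure P k"
    unfolding fourier_measure_def using j P N
    by (subst (1 2) complex_integral_add_measure(2)[symmetric]) (auto intro!: integrable_cis)
  then show ?thesis unfolding fourier_signed_def by (simp add: algebra_simps)
qed

section \<open>Gaussian smoothing in euclidean space\<close>

text \<open>The standard Gaussian density without its normalising constant: the value 1 at the
  origin makes it a damping factor, and the total mass sqrt(2 pi)^d is carried along as an explicit
  constant.\<close>

definition gauss :: "'a::euclidean_space \<Rightarrow> real" where
  "gauss x = exp (- (x \<bullet> x) / 2)"

lemma continuous_on_gauss[continuous_intros]:
  "continuous_on A f \<Longrightarrow> continuous_on A (\<lambda>x. gauss (f x))"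
  unfolding gauss_def by (intro continuous_intros) auto

lemma borel_measurable_gauss[measurable]: "gauss \<in> borel_measurable borel"
  by (intro borel_measurable_continuous_onI continuous_intros)

lemma borel_measurable_cis[measurable]: "cis \<in> borel_measurable borel"
  by (intro borel_measurable_continuous_onI continuous_intros)

lemma gauss_nonneg[simp]: "0 \<le> gauss x"
  and gauss_le_1[simp]: "gauss x \<le> 1" and gauss_minus[simp]: "gauss (- x) = gauss x"
  by (auto simp: gauss_def)

lemma gauss_prod: "gauss x = (\<Prod>b\<in>Basis. exp (- (x \<bullet> b)\<^sup>2 / 2))"
  unfolding gauss_def by (subst euclidean_inner)
    (simp add: exp_sum[symmetric] sum_negf sum_divide_distrib power2_eq_square flip: sum_divide_distrib)

text \<open>This is the characteristic function of the standard normal law, rescaled by sqrt(2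
  pi).\<close>

lemma fourier_gauss_real:
  fixes t :: real
  shows "integrable lborel (\<lambda>z. cis (t * z) * complex_of_real (exp (- z\<^sup>2 / 2)))"
    and "(\<integral>z. cis (t * z) * complex_of_real (exp (- z\<^sup>2 / 2)) \<partial>lborel)
      = complex_of_real (sqrt (2 * pi) * exp (- t\<^sup>2 / 2))"
proof -
  have e: "std_normal_density z = exp (- z\<^sup>2 / 2) / sqrt (2 * pi)" for z
    by (simp add: std_normal_density_def)
  have "integrable lborel (\<lambda>z. exp (- z\<^sup>2 / 2) :: real)"
    using integrable_mult_left[OF integrable_std_normal_moment[of 0], of "sqrt (2 * pi)"]
    by (simp add: e)
  then show i: "integrable lborel (\<lambda>z. cis (t * z) * complex_of_real (exp (- z\<^sup>2 / 2)))"
    by (rule Bochner_Integration.integrable_bound) (auto simp: norm_mult)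
  have "complex_of_real (exp (- t\<^sup>2 / 2)) = char std_normal_distribution t"
    by (simp add: char_std_normal_distribution)
  also have "\<dots> = (\<integral>z. std_normal_density z *\<^sub>R cis (t * z) \<partial>lborel)"
    unfolding char_def by (subst integral_density) (auto simp: cis_conv_exp)
  also have "\<dots> = (\<integral>z. (cis (t * z) * complex_of_real (exp (- z\<^sup>2 / 2))) / complex_of_real (sqrt (2 * pi)) \<partial>lborel)"
    by (intro Bochner_Integration.integral_cong) (auto simp: e scaleR_conv_of_real)
  also have "\<dots> = (\<integral>z. cis (t * z) * complex_of_real (exp (- z\<^sup>2 / 2)) \<partial>lborel) / complex_of_real (sqrt (2 * pi))"
    by simp
  finally show "(\<integral>z. cis (t * z) * complex_of_real (exp (- z\<^sup>2 / 2)) \<partial>lborel)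
      = complex_of_real (sqrt (2 * pi) * exp (- t\<^sup>2 / 2))"
    by (simp add: field_simps)
qed

lemma cis_sum: "finite A \<Longrightarrow> cis (\<Sum>i\<in>A. f i) = (\<Prod>i\<in>A. cis (f i))"
  by (induction rule: finite_induct) (auto simp: cis_mult[symmetric])

text \<open>Lebesgue measure is the image of a product of one-dimensional ones under the basis
  expansion, along which the integrand factorises.\<close>

lemma fourier_gauss:
  fixes k :: "'a::euclidean_space"
  shows "integrable lborel (\<lambda>z. cis (k \<bullet> z) * complex_of_real (gauss z))" (is ?I)
    and "(\<integral>z. cis (k \<bullet> z) * complex_of_real (gauss z) \<partial>lborel)
      = complex_of_real (sqrt (2 * pi) ^ DIM('a) * gauss k)" (is ?E)
proof -
  interpret product_sigma_finite "\<lambda>b :: 'a. lborel :: real measure" ..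
  let ?F = "\<lambda>b z. cis ((k \<bullet> b) * z) * complex_of_real (exp (- z\<^sup>2 / 2))"
  let ?T = "\<lambda>f :: 'a \<Rightarrow> real. \<Sum>b\<in>Basis. f b *\<^sub>R b"
  have eq: "cis (k \<bullet> ?T f) * complex_of_real (gauss (?T f)) = (\<Prod>b\<in>Basis. ?F b (f b))" for f
    by (simp add: gauss_prod inner_sum_right cis_sum prod.distrib mult.commute)
  have T[measurable]: "?T \<in> borel_measurable (PiM Basis (\<lambda>b. lborel))"
    by measurable
  have m: "(\<lambda>z :: 'a. cis (k \<bullet> z) * complex_of_real (gauss z)) \<in> borel_measurable borel"
    by measurable
  have P: "integrable (PiM Basis (\<lambda>b. lborel)) (\<lambda>f. \<Prod>b\<in>Basis. ?F b (f b))"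
    by (rule product_integrable_prod[OF finite_Basis fourier_gauss_real(1)])
  show ?I
    unfolding lborel_eq[where 'a='a] integrable_distr_eq[OF T m] eq by (rule P)
  have "(\<integral>z. cis (k \<bullet> z) * complex_of_real (gauss z) \<partial>lborel) = (\<integral>f. (\<Prod>b\<in>Basis. ?F b (f b)) \<partial>PiM Basis (\<lambda>b. lborel))"
    unfolding lborel_eq[where 'a='a] integral_distr[OF T m] eq ..
  also have "\<dots> = (\<Prod>b\<in>Basis. \<integral>z. ?F b z \<partial>lborel)"
    by (rule product_integral_prod[OF finite_Basis fourier_gauss_real(1)])
  also have "\<dots> = complex_of_real (sqrt (2 * pi) ^ DIM('a) * gauss k)"
    unfolding fourier_gauss_real(2) by (simp add: gauss_prod prod.distrib)
  finally show ?E .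
qed

lemma integrable_gauss: "integrable lborel (gauss :: 'a::euclidean_space \<Rightarrow> real)"
  and integral_gauss: "(\<integral>z. gauss (z :: 'a) \<partial>lborel) = sqrt (2 * pi) ^ DIM('a::euclidean_space)"
proof -
  have i: "integrable lborel (\<lambda>z :: 'a. complex_of_real (gauss z))"
    using fourier_gauss(1)[of "0 :: 'a"] by simp
  show "integrable lborel (gauss :: 'a \<Rightarrow> real)" using integrable_Re[OF i] by simp
  have "complex_of_real (\<integral>z. gauss (z :: 'a) \<partial>lborel) = complex_of_real (sqrt (2 * pi) ^ DIM('a))"
    using fourier_gauss(2)[of "0 :: 'a"] by (simp add: gauss_def)
  then show "(\<integral>z. gauss (z :: 'a) \<partial>lborel) = sqrt (2 * pi) ^ DIM('a)"
    using of_real_eq_iff by blast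
qed

lemma nn_integral_lborel_affine:
  fixes f :: "'a::euclidean_space \<Rightarrow> ennreal"
  assumes [measurable]: "f \<in> borel_measurable borel" and c: "c \<noteq> 0"
  shows "(\<integral>\<^sup>+x. f x \<partial>lborel) = ennreal (\<bar>c\<bar> ^ DIM('a)) * (\<integral>\<^sup>+x. f (t + c *\<^sub>R x) \<partial>lborel)"
  by (subst lborel_affine[OF c, of t])
    (simp add: nn_integral_density nn_integral_distr nn_integral_cmult)

lemma integral_lborel_affine:
  fixes f :: "'a::euclidean_space \<Rightarrow> 'b::{banach, second_countable_topology}"
  assumes [measurable]: "f \<in> borel_measurable borel" and c: "c \<noteq> 0"
  shows "(\<integral>x. f x \<partial>lborel) = \<bar>c\<bar> ^ DIM('a) *\<^sub>R (\<integral>x. f (t + c *\<^sub>R x) \<partial>lborel)"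
  by (subst lborel_affine[OF c, of t])
    (simp add: integral_density integral_distr)

text \<open>Parseval's relation between \<open>P\<close> and a Gaussian, that is Fubini for one
  function of (k, z). On the left \<open>P\<close> enters only through its transform; on the right
  stands, for c > 0, \<open>P\<close> smoothed around \<open>s\<close> at scale 1/c.\<close>

lemma fourier_gauss_smoothing:
  fixes P :: "(real ^ 'd) measure"
  assumes P: "finite_measure P" "sets P = sets borel"
  shows "(\<integral>z. cis (- c * (z \<bullet> s)) * complex_of_real (gauss z) * fourier_measure P (- c *\<^sub>R z) \<partial>lborel)
    = complex_of_real (sqrt (2 * pi) ^ CARD('d) * (\<integral>k. gauss (c *\<^sub>R (k - s)) \<partial>P))"
proof -
  interpret P: finite_measure P by fact
  interpret pair_sigma_finite P lborel ..
  note [measurable_cong] = P(2)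
  let ?g = "\<lambda>k z. cis ((c *\<^sub>R (k - s)) \<bullet> z) * complex_of_real (gauss z)"
  have i: "integrable (P \<Otimes>\<^sub>M lborel) (\<lambda>(k, z). ?g k z)"
  proof (rule integrableI_bounded)
    have "(\<integral>\<^sup>+x. ennreal (norm (case x of (k, z) \<Rightarrow> ?g k z)) \<partial>(P \<Otimes>\<^sub>M lborel)) = (\<integral>\<^sup>+k. \<integral>\<^sup>+z. ennreal (gauss (z :: real ^ 'd)) \<partial>lborel \<partial>P)"
      by (subst lborel.nn_integral_fst[symmetric]) (auto simp: norm_mult)
    also have "\<dots> < \<infinity>"
      using integrable_gauss[where 'a="real^'d"]
      by (simp add: nn_integral_eq_integral ennreal_mult_eq_top_iff less_top[symmetric])
    finally show "(\<integral>\<^sup>+x. ennreal (norm (case x of (k, z) \<Rightarrow> ?g k z)) \<partial>(P \<Otimes>\<^sub>M lborel)) < \<infinity>" .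
  qed measurable
  have "(\<integral>z. cis (- c * (z \<bullet> s)) * complex_of_real (gauss z) * fourier_measure P (- c *\<^sub>R z) \<partial>lborel)
     = (\<integral>z. (\<integral>k. ?g k z \<partial>P) \<partial>lborel)"
  proof (rule Bochner_Integration.integral_cong[OF refl])
    fix z
    have "(\<integral>k. ?g k z \<partial>P) = (\<integral>k. (cis (- c * (z \<bullet> s)) * complex_of_real (gauss z)) * cis (- ((- c *\<^sub>R z) \<bullet> k)) \<partial>P)"
      by (intro Bochner_Integration.integral_cong) (auto simp: cis_mult algebra_simps inner_diff_right inner_commute)
    then show "cis (- c * (z \<bullet> s)) * complex_of_real (gauss z) * fourier_measure P (- c *\<^sub>R z) = (\<integral>k. ?g k z \<partial>P)"
      unfolding fourier_measure_def by (simp only: integral_mult_right_zero)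
  qed
  also have "\<dots> = (\<integral>k. (\<integral>z. ?g k z \<partial>lborel) \<partial>P)"
    by (rule Fubini_integral[OF i])
  also have "\<dots> = (\<integral>k. complex_of_real (sqrt (2 * pi) ^ CARD('d) * gauss (c *\<^sub>R (k - s))) \<partial>P)"
    by (subst fourier_gauss(2)) simp
  also have "\<dots> = complex_of_real (sqrt (2 * pi) ^ CARD('d) * (\<integral>k. gauss (c *\<^sub>R (k - s)) \<partial>P))"
    by (subst integral_complex_of_real) simp
  finally show ?thesis .
qed

text \<open>The bound on \<open>\<phi>\<close> gives the integrable majorant
  \<open>C * gauss z\<close>, and continuity gives pointwise convergence. \<open>Suc n\<close> makes
  every scale positive.\<close>

lemma gauss_mollify_tendsto:
  fixes \<phi> :: "'a::euclidean_space \<Rightarrow> real"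
  assumes \<phi>: "continuous_on UNIV \<phi>" "\<And>x. \<bar>\<phi> x\<bar> \<le> C"
  shows "(\<lambda>n. \<integral>z. \<phi> (k + (1 / real (Suc n)) *\<^sub>R z) * gauss z \<partial>lborel) \<longlonglongrightarrow> sqrt (2 * pi) ^ DIM('a) * \<phi> k"
proof -
  have [measurable]: "\<phi> \<in> borel_measurable borel"
    using \<phi>(1) by (rule borel_measurable_continuous_onI)
  have "(\<lambda>n. \<integral>z. \<phi> (k + (1 / real (Suc n)) *\<^sub>R z) * gauss z \<partial>lborel) \<longlonglongrightarrow> (\<integral>z. \<phi> k * gauss (z :: 'a) \<partial>lborel)"
  proof (rule integral_dominated_convergence[where w="\<lambda>z. C * gauss z"])
    show "AE z in lborel. (\<lambda>n. \<phi> (k + (1 / real (Suc n)) *\<^sub>R z) * gauss z) \<longlonglongrightarrow> \<phi> k * gauss z"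
    proof (rule AE_I2)
      fix z :: 'a
      have "(\<lambda>n. k + (1 / real (Suc n)) *\<^sub>R z) \<longlonglongrightarrow> k + 0 *\<^sub>R z"
        by (intro tendsto_intros LIMSEQ_Suc[OF lim_1_over_n])
      then have "(\<lambda>n. \<phi> (k + (1 / real (Suc n)) *\<^sub>R z)) \<longlonglongrightarrow> \<phi> k"
        using continuous_on_tendsto_compose[OF \<phi>(1), of _ k] by simp
      then show "(\<lambda>n. \<phi> (k + (1 / real (Suc n)) *\<^sub>R z) * gauss z) \<longlonglongrightarrow> \<phi> k * gauss z"
        by (intro tendsto_intros)
    qed
    show "AE z in lborel. norm (\<phi> (k + (1 / real (Suc n)) *\<^sub>R z) * gauss z) \<le> C * gauss z" for n
      using \<phi>(2) by (auto simp: abs_mult intro!: mult_right_mono)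
  qed (auto intro: integrable_gauss)
  then show ?thesis by (simp add: integral_gauss mult.commute)
qed

text \<open>The substitution s = k + z/c moves the smoothing from the function to the measure. The
  right-hand side involves \<open>P\<close> only through Gaussian averages, which
  \<open>fourier_gauss_smoothing\<close> expresses by the transform. With nonnegative integrals
  Tonelli applies without an integrability check.\<close>

lemma nn_integral_mollify:
  fixes \<phi> :: "real ^ 'd \<Rightarrow> real"
  assumes P: "finite_measure P" "sets P = sets borel" and \<phi>[measurable]: "\<phi> \<in> borel_measurable borel"
    and nn: "\<And>x. 0 \<le> \<phi> x" and c: "0 < c"
  shows "(\<integral>\<^sup>+k. (\<integral>\<^sup>+z. ennreal (\<phi> (k + (1 / c) *\<^sub>R z) * gauss z) \<partial>lborel) \<partial>P)
     = ennreal (c ^ CARD('d)) * (\<integral>\<^sup>+s. ennreal (\<phi> s * (\<integral>k. gauss (c *\<^sub>R (k - s)) \<partial>P)) \<partial>lborel)"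
proof -
  interpret P: finite_measure P by fact
  interpret pair_sigma_finite P lborel ..
  note [measurable_cong] = P(2)
  have "(\<integral>\<^sup>+z. ennreal (\<phi> (k + (1 / c) *\<^sub>R z) * gauss z) \<partial>lborel)
     = ennreal (c ^ CARD('d)) * (\<integral>\<^sup>+s. ennreal (\<phi> s * gauss (c *\<^sub>R (k - s))) \<partial>lborel)" for k
  proof -
    have "gauss (c *\<^sub>R (s - k)) = gauss (c *\<^sub>R (k - s))" for s
      using gauss_minus[of "c *\<^sub>R (s - k)"] by (simp add: scaleR_minus_right[symmetric] del: gauss_minus scaleR_minus_right)
    then show ?thesis
      using c by (subst nn_integral_lborel_affine[where c=c and t="- c *\<^sub>R k"])
       (auto simp: algebra_simps)
  qed
  then have "(\<integral>\<^sup>+k. (\<integral>\<^sup>+z. ennreal (\<phi> (k + (1 / c) *\<^sub>R z) * gauss z) \<partial>lborel) \<partial>P)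
     = ennreal (c ^ CARD('d)) * (\<integral>\<^sup>+k. (\<integral>\<^sup>+s. ennreal (\<phi> s * gauss (c *\<^sub>R (k - s))) \<partial>lborel) \<partial>P)"
    by (simp add: nn_integral_cmult)
  also have "(\<integral>\<^sup>+k. (\<integral>\<^sup>+s. ennreal (\<phi> s * gauss (c *\<^sub>R (k - s))) \<partial>lborel) \<partial>P)
     = (\<integral>\<^sup>+s. (\<integral>\<^sup>+k. ennreal (\<phi> s * gauss (c *\<^sub>R (k - s))) \<partial>P) \<partial>lborel)"
    by (rule Fubini'[symmetric]) measurable
  also have "\<dots> = (\<integral>\<^sup>+s. ennreal (\<phi> s * (\<integral>k. gauss (c *\<^sub>R (k - s)) \<partial>P)) \<partial>lborel)"
  proof (rule nn_integral_cong)
    fix s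
    have "integrable P (\<lambda>k. gauss (c *\<^sub>R (k - s)))"
      by (intro P.integrable_const_bound[of _ 1]) auto
    then show "(\<integral>\<^sup>+k. ennreal (\<phi> s * gauss (c *\<^sub>R (k - s))) \<partial>P) = ennreal (\<phi> s * (\<integral>k. gauss (c *\<^sub>R (k - s)) \<partial>P))"
      using nn by (simp add: ennreal_mult nn_integral_cmult nn_integral_eq_integral)
  qed
  finally show ?thesis .
qed

section \<open>Uniqueness of Fourier transforms of finite measures\<close>

text \<open>Gaussian mollifications of \<open>\<phi>\<close> have equal integrals under both
  measures, and they converge boundedly to \<open>\<phi>\<close> up to the constant sqrt(2
  pi)^d.\<close>

lemma integral_continuous_eq_of_fourier_eq:
  fixes P Q :: "(real ^ 'd) measure"
  assumes P: "finite_measure P" "sets P = sets borel" and Q: "finite_measure Q" "sets Q = sets borel"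
    and eq: "\<And>k. fourier_measure P k = fourier_measure Q k"
    and \<phi>: "continuous_on UNIV (\<phi> :: real ^ 'd \<Rightarrow> real)" "\<And>x. 0 \<le> \<phi> x" "\<And>x. \<phi> x \<le> C"
  shows "(\<integral>x. \<phi> x \<partial>P) = (\<integral>x. \<phi> x \<partial>Q)"
proof -
  have m[measurable]: "\<phi> \<in> borel_measurable borel"
    using \<phi>(1) by (rule borel_measurable_continuous_onI)
  have C: "\<bar>\<phi> x\<bar> \<le> C" for x using \<phi>(2,3)[of x] by simp
  let ?F = "\<lambda>n k. \<integral>z. \<phi> (k + (1 / real (Suc n)) *\<^sub>R z) * gauss z \<partial>lborel"
  have i: "integrable lborel (\<lambda>z. \<phi> (k + (1 / real (Suc n)) *\<^sub>R z) * gauss z)" for n k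
    by (rule Bochner_Integration.integrable_bound[OF integrable_mult_right[OF integrable_gauss, of C]])
      (use C in \<open>auto simp: abs_mult intro!: mult_right_mono order_trans[OF C abs_ge_self]\<close>)
  have F0: "0 \<le> ?F n k" for n k using \<phi>(2) by (intro integral_nonneg_AE) auto
  have FC: "?F n k \<le> C * sqrt (2 * pi) ^ CARD('d)" for n k
  proof -
    have "?F n k \<le> (\<integral>z. C * gauss (z :: real ^ 'd) \<partial>lborel)"
      using \<phi>(3) by (intro integral_mono i integrable_mult_right integrable_gauss mult_right_mono) auto
    then show ?thesis by (simp add: integral_gauss)
  qed
  have lim: "(\<lambda>n. \<integral>k. ?F n k \<partial>R) \<longlonglongrightarrow> sqrt (2 * pi) ^ CARD('d) * (\<integral>k. \<phi> k \<partial>R)"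
    if R: "finite_measure R" "sets R = sets borel" for R
  proof -
    note [measurable_cong] = R(2)
    interpret R: finite_measure R by fact
    have "(\<lambda>n. \<integral>k. ?F n k \<partial>R) \<longlonglongrightarrow> (\<integral>k. sqrt (2 * pi) ^ CARD('d) * \<phi> k \<partial>R)"
      by (rule integral_dominated_convergence[where w="\<lambda>_. C * sqrt (2 * pi) ^ CARD('d)"])
        (use F0 FC gauss_mollify_tendsto[OF \<phi>(1) C] in \<open>auto\<close>)
    then show ?thesis by simp
  qed
  have "(\<integral>k. ?F n k \<partial>P) = (\<integral>k. ?F n k \<partial>Q)" for n
  proof -
    \<comment> \<open>The Bochner integral of the nonnegative \<open>?F n\<close> is rewritten as a
      nonnegative integral, the form in which \<open>nn_integral_mollify\<close> applies.\<close>
    have F: "(\<integral>k. ?F n k \<partial>R) = enn2real (\<integral>\<^sup>+k. (\<integral>\<^sup>+z. ennreal (\<phi> (k + (1 / real (Suc n)) *\<^sub>R z) * gauss z) \<partial>lborel) \<partial>R)"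
      if R: "sets R = sets borel" for R
    proof -
      note [measurable_cong] = R
      have "ennreal (?F n k) = (\<integral>\<^sup>+z. ennreal (\<phi> (k + (1 / real (Suc n)) *\<^sub>R z) * gauss z) \<partial>lborel)" for k
        using \<phi>(2) by (intro nn_integral_eq_integral[symmetric] i) auto
      then show ?thesis
        using F0 by (subst integral_eq_nn_integral) auto
    qed
    have "(\<integral>k. gauss (real (Suc n) *\<^sub>R (k - s)) \<partial>P) = (\<integral>k. gauss (real (Suc n) *\<^sub>R (k - s)) \<partial>Q)" for s
    proof -
      have "complex_of_real (sqrt (2 * pi) ^ CARD('d) * (\<integral>k. gauss (real (Suc n) *\<^sub>R (k - s)) \<partial>P))
        = complex_of_real (sqrt (2 * pi) ^ CARD('d) * (\<integral>k. gauss (real (Suc n) *\<^sub>R (k - s)) \<partial>Q))"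
        unfolding fourier_gauss_smoothing[OF P, symmetric] fourier_gauss_smoothing[OF Q, symmetric] eq ..
      then show ?thesis unfolding of_real_eq_iff by simp
    qed
    then show ?thesis
      unfolding F[OF P(2)] F[OF Q(2)]
      using nn_integral_mollify[OF P m \<phi>(2), of "real (Suc n)"] nn_integral_mollify[OF Q m \<phi>(2), of "real (Suc n)"]
      by simp
  qed
  then have "sqrt (2 * pi) ^ CARD('d) * (\<integral>k. \<phi> k \<partial>P) = sqrt (2 * pi) ^ CARD('d) * (\<integral>k. \<phi> k \<partial>Q)"
    using LIMSEQ_unique[OF lim[OF P]] lim[OF Q] by simp
  then show ?thesis by simp
qed

text \<open>The indicator of an open set is a pointwise limit of truncated multiples of the distance
  to its complement, and the open sets form an intersection-stable generator of the Borel
  sets.\<close>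

lemma finite_measure_eqI_continuous:
  fixes P Q :: "'a::metric_space measure"
  assumes P: "finite_measure P" "sets P = sets borel" and Q: "finite_measure Q" "sets Q = sets borel"
    and eq: "\<And>\<phi> :: 'a \<Rightarrow> real. continuous_on UNIV \<phi> \<Longrightarrow> (\<And>x. 0 \<le> \<phi> x) \<Longrightarrow> (\<And>x. \<phi> x \<le> 1) \<Longrightarrow>
      (\<integral>x. \<phi> x \<partial>P) = (\<integral>x. \<phi> x \<partial>Q)"
  shows "P = Q"
proof -
  interpret P: finite_measure P by fact
  interpret Q: finite_measure Q by fact
  have sp: "space P = UNIV" "space Q = UNIV"
    using sets_eq_imp_space_eq[OF P(2)] sets_eq_imp_space_eq[OF Q(2)] by simp_all
  have U: "measure P U = measure Q U" if "open U" for U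
  \<comment> \<open>\<open>infdist\<close> to the empty set is 0 by convention, which would give the
    wrong limit, so the whole space is treated apart.\<close>
  proof (cases "- U = {}")
    case True
    then have "U = UNIV" by auto
    then show ?thesis using eq[of "\<lambda>_. 1"] sp by simp
  next
    case False
    define \<phi> where "\<phi> n x = min 1 (real n * infdist x (- U))" for n x
    have c: "continuous_on UNIV (\<phi> n)" for n
      unfolding \<phi>_def by (intro continuous_intros)
    have b: "0 \<le> \<phi> n x" "\<phi> n x \<le> 1" for n x
      by (auto simp: \<phi>_def infdist_nonneg)
    have l: "(\<lambda>n. \<phi> n x) \<longlonglongrightarrow> indicator U x" for x
    proof (cases "x \<in> U")
      case True
      have "infdist x (- U) \<noteq> 0"
        using in_closed_iff_infdist_zero[of "- U" x] False True \<open>open U\<close> by auto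
      then have d: "0 < infdist x (- U)" using infdist_nonneg[of x "- U"] by simp
      obtain N where N: "1 < real N * infdist x (- U)"
        using reals_Archimedean3[OF d] by blast
      have "eventually (\<lambda>n. \<phi> n x = 1) sequentially"
        using eventually_ge_at_top[of N]
      proof eventually_elim
        case (elim n)
        have "real N * infdist x (- U) \<le> real n * infdist x (- U)"
          using elim d by (intro mult_right_mono) auto
        then show ?case using N by (simp add: \<phi>_def)
      qed
      then show ?thesis using True by (simp add: tendsto_eventually)
    next
      case False
      then show ?thesis by (simp add: \<phi>_def)
    qed
    have lim: "(\<lambda>n. \<integral>x. \<phi> n x \<partial>R) \<longlonglongrightarrow> measure R U" if R: "finite_measure R" "sets R = sets borel" for R
    proof -
      note [measurable_cong] = R(2)
      interpret R: finite_measure R by fact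
      have [measurable]: "\<phi> n \<in> borel_measurable borel" for n
        using c by (rule borel_measurable_continuous_onI)
      have "U \<in> sets R" using R(2) \<open>open U\<close> by simp
      have "(\<lambda>n. \<integral>x. \<phi> n x \<partial>R) \<longlonglongrightarrow> (\<integral>x. indicator U x \<partial>R)"
        by (rule integral_dominated_convergence[where w="\<lambda>_. 1"])
          (use l b \<open>U \<in> sets R\<close> in auto)
      then show ?thesis using \<open>U \<in> sets R\<close> sets.sets_into_space by fastforce
    qed
    show ?thesis using lim[OF P] lim[OF Q] eq[OF c b] LIMSEQ_unique by auto
  qed
  show ?thesis
  proof (rule measure_eqI_generator_eq[where E="{S. open S}" and \<Omega>=UNIV and A="\<lambda>_. UNIV"])
    show "sets P = sigma_sets UNIV {S. open S}" "sets Q = sigma_sets UNIV {S. open S}"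
      using P Q by (auto simp: borel_def)
  qed (auto simp: Int_stable_def P.emeasure_eq_measure Q.emeasure_eq_measure U)
qed

lemma fourier_measure_inject:
  fixes P Q :: "(real ^ 'd) measure"
  assumes P: "finite_measure P" "sets P = sets borel" and Q: "finite_measure Q" "sets Q = sets borel"
    and "\<And>k. fourier_measure P k = fourier_measure Q k"
  shows "P = Q"
  by (rule finite_measure_eqI_continuous[OF P Q integral_continuous_eq_of_fourier_eq[OF P Q assms(5)]])

section \<open>Fourier inversion and autocorrelations\<close>

lemma continuous_on_fourier_measure:
  fixes P :: "(real ^ 'd) measure"
  assumes P: "finite_measure P" "sets P = sets borel"
  shows "continuous_on A (fourier_measure P)"
proof (rule continuous_on_sequentiallyI)
  interpret finite_measure P by fact
  note [measurable_cong] = P(2)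
  fix u :: "nat \<Rightarrow> real ^ 'd" and a
  assume u: "u \<longlonglongrightarrow> a"
  show "(\<lambda>n. fourier_measure P (u n)) \<longlonglongrightarrow> fourier_measure P a"
    unfolding fourier_measure_def
  proof (rule integral_dominated_convergence[where w="\<lambda>_. 1"])
    show "AE x in P. (\<lambda>n. cis (- (u n \<bullet> x))) \<longlonglongrightarrow> cis (- (a \<bullet> x))"
    proof (rule AE_I2)
      fix x
      have "(\<lambda>n. - (u n \<bullet> x)) \<longlonglongrightarrow> - (a \<bullet> x)" using u by (intro tendsto_intros)
      then show "(\<lambda>n. cis (- (u n \<bullet> x))) \<longlonglongrightarrow> cis (- (a \<bullet> x))"
        by (rule tendsto_cis)
    qed
  qed auto
qed

lemma finite_measure_density_lborel:
  fixes f :: "real ^ 'd \<Rightarrow> real"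
  assumes "integrable lborel f" "\<And>x. 0 \<le> f x"
  shows "finite_measure (density lborel (\<lambda>x. ennreal (f x)))"
  using assms by (intro finite_measureI) (auto simp: emeasure_density nn_integral_eq_integral)

lemma fourier_measure_density:
  fixes f :: "real ^ 'd \<Rightarrow> real"
  assumes "integrable lborel f" "\<And>x. 0 \<le> f x"
  shows "fourier_measure (density lborel (\<lambda>x. ennreal (f x))) k = fourier_fun f k"
proof -
  have [measurable]: "f \<in> borel_measurable borel" using assms(1) by auto
  show ?thesis unfolding fourier_measure_def fourier_fun_def
    using assms(2) by (subst integral_density) (auto simp: scaleR_conv_of_real)
qed

text \<open>\<open>h\<close> is read as the density of a finite measure, to which Gaussian smoothing
  applies. Integrability of \<open>F\<close> is a conclusion: it comes from \<open>F\<close> being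
  nonnegative together with the continuity of \<open>h\<close> at 0.\<close>

lemma fourier_inversion:
  fixes h F :: "real ^ 'd \<Rightarrow> real"
  assumes h: "continuous_on UNIV h" "\<And>x. 0 \<le> h x" "\<And>x. h x \<le> C" "integrable lborel h"
    and F: "\<And>k. fourier_fun h k = complex_of_real (F k)" "\<And>k. 0 \<le> F k"
  shows "integrable lborel F"
    and "(\<integral>k. cis (k \<bullet> s) * complex_of_real (F k) \<partial>lborel) = complex_of_real ((2 * pi) ^ CARD('d) * h s)"
proof -
  define \<nu> where "\<nu> = density lborel (\<lambda>x. ennreal (h x))"
  have \<nu>: "finite_measure \<nu>" "sets \<nu> = sets borel"
    using finite_measure_density_lborel[OF h(4,2)] by (auto simp: \<nu>_def)
  have F\<nu>: "fourier_measure \<nu> k = complex_of_real (F k)" for k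
    using fourier_measure_density[OF h(4,2)] F(1) by (simp add: \<nu>_def)
  have Feq: "F = (\<lambda>k. Re (fourier_measure \<nu> k))" by (simp add: F\<nu>)
  have [measurable]: "F \<in> borel_measurable borel"
    unfolding Feq
    by (intro borel_measurable_continuous_onI continuous_intros continuous_on_fourier_measure \<nu>)
  have [measurable]: "h \<in> borel_measurable borel"
    using h(1) by (rule borel_measurable_continuous_onI)
  \<comment> \<open>A bound on \<open>F\<close> makes each damped integrand integrable before
    \<open>F\<close> itself is known to be so.\<close>
  have Fb: "F k \<le> (\<integral>x. h x \<partial>lborel)" for k
  proof -
    have "F k = norm (fourier_fun h k)" using F by simp
    also have "\<dots> \<le> (\<integral>x. norm (complex_of_real (h x) * cis (- (k \<bullet> x))) \<partial>lborel)"
      unfolding fourier_fun_def by (rule integral_norm_bound)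
    also have "\<dots> = (\<integral>x. h x \<partial>lborel)" using h(2) by (simp add: norm_mult)
    finally show ?thesis .
  qed
  let ?c = "\<lambda>n. 1 / real (Suc n)"
  \<comment> \<open>Substituting k = -(n+1) z brings the damped inversion integral into the form of
    \<open>fourier_gauss_smoothing\<close>; the second substitution, on the right, cancels the
    factor (n+1)^d.\<close>
  have G: "(\<integral>k. cis (k \<bullet> s) * complex_of_real (gauss (?c n *\<^sub>R k) * F k) \<partial>lborel)
    = complex_of_real (sqrt (2 * pi) ^ CARD('d) * (\<integral>v. h (s + ?c n *\<^sub>R v) * gauss v \<partial>lborel))" for n s
  proof -
    let ?m = "real (Suc n)"
    have m: "- ?m \<noteq> 0" "?c n \<noteq> 0" by auto
    have "(\<integral>k. cis (k \<bullet> s) * complex_of_real (gauss (?c n *\<^sub>R k) * F k) \<partial>lborel)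
      = \<bar>- ?m\<bar> ^ CARD('d) *\<^sub>R (\<integral>z. cis ((0 + (- ?m) *\<^sub>R z) \<bullet> s) * complex_of_real (gauss (?c n *\<^sub>R (0 + (- ?m) *\<^sub>R z)) * F (0 + (- ?m) *\<^sub>R z)) \<partial>lborel)"
      by (subst integral_lborel_affine[OF _ m(1), where t=0]) (simp_all del: of_nat_Suc)
    also have "\<dots> = ?m ^ CARD('d) *\<^sub>R (\<integral>z. cis (- ?m * (z \<bullet> s)) * complex_of_real (gauss z) * fourier_measure \<nu> (- ?m *\<^sub>R z) \<partial>lborel)"
      by (simp add: F\<nu> mult.assoc del: of_nat_Suc)
    also have "\<dots> = ?m ^ CARD('d) *\<^sub>R complex_of_real (sqrt (2 * pi) ^ CARD('d) * (\<integral>k. gauss (?m *\<^sub>R (k - s)) \<partial>\<nu>))"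
      by (subst fourier_gauss_smoothing[OF \<nu>]) simp
    also have "(\<integral>k. gauss (?m *\<^sub>R (k - s)) \<partial>\<nu>) = (\<integral>k. h k * gauss (?m *\<^sub>R (k - s)) \<partial>lborel)"
      unfolding \<nu>_def using h(2) by (subst integral_density) auto
    also have "\<dots> = (?c n) ^ CARD('d) * (\<integral>v. h (s + ?c n *\<^sub>R v) * gauss v \<partial>lborel)"
      by (subst integral_lborel_affine[OF _ m(2), where t=s]) (simp_all del: of_nat_Suc)
    finally show ?thesis
      by (simp add: scaleR_conv_of_real power_divide field_simps del: of_nat_Suc)
  qed
  have lim: "(\<lambda>n. \<integral>v. h (s + ?c n *\<^sub>R v) * gauss v \<partial>lborel) \<longlonglongrightarrow> sqrt (2 * pi) ^ CARD('d) * h s" for s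
    using gauss_mollify_tendsto[OF h(1), of C s] h(2,3) by simp
  \<comment> \<open>One factor sqrt(2 pi)^d stems from the transform of the Gaussian, the other from
    its mass in the mollification limit.\<close>
  have gc: "sqrt (2 * pi) ^ CARD('d) * (sqrt (2 * pi) ^ CARD('d) * x) = (2 * pi) ^ CARD('d) * x" for x
  proof -
    have "sqrt (2 * pi) ^ CARD('d) * sqrt (2 * pi) ^ CARD('d) = (2 * pi) ^ CARD('d)"
      by (subst power_mult_distrib[symmetric]) simp
    then show ?thesis by (metis mult.assoc)
  qed
  \<comment> \<open>At \<open>s = 0\<close> the damped integrals increase, so their convergence yields integrability of \<open>F\<close>.\<close>
  have ig: "integrable lborel (\<lambda>k. gauss (?c n *\<^sub>R k) * F k)" for n
  proof (rule Bochner_Integration.integrable_bound)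
    have "integrable lborel (\<lambda>k :: real ^ 'd. gauss (0 + ?c n *\<^sub>R k))"
    proof -
      have "(\<integral>\<^sup>+k. ennreal (gauss (k :: real ^ 'd)) \<partial>lborel) = ennreal (\<bar>?c n\<bar> ^ DIM(real ^ 'd)) * (\<integral>\<^sup>+k. ennreal (gauss (0 + ?c n *\<^sub>R k :: real ^ 'd)) \<partial>lborel)"
        by (rule nn_integral_lborel_affine) auto
      moreover have "(\<integral>\<^sup>+k. ennreal (gauss (k :: real ^ 'd)) \<partial>lborel) < \<infinity>"
        by (simp add: nn_integral_eq_integral integrable_gauss)
      ultimately have "(\<integral>\<^sup>+k. ennreal (gauss (0 + ?c n *\<^sub>R k :: real ^ 'd)) \<partial>lborel) < \<infinity>"
        by (auto simp: ennreal_mult_less_top)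
      then show ?thesis by (intro integrableI_bounded) auto
    qed
    then show "integrable lborel (\<lambda>k :: real ^ 'd. (\<integral>x. h x \<partial>lborel) * gauss (?c n *\<^sub>R k))" by simp
    show "AE k in lborel. norm (gauss (?c n *\<^sub>R k) * F k) \<le> norm ((\<integral>x. h x \<partial>lborel) * gauss (?c n *\<^sub>R k))"
      using Fb F(2) order_trans[OF F(2) Fb]
      by (auto simp: abs_mult mult.commute intro!: mult_right_mono)
  qed auto
  have gl: "(\<lambda>n. gauss (?c n *\<^sub>R k)) \<longlonglongrightarrow> 1" for k :: "real ^ 'd"
  proof -
    have "(\<lambda>n. ?c n *\<^sub>R k) \<longlonglongrightarrow> 0 *\<^sub>R k"
      by (intro tendsto_intros LIMSEQ_Suc[OF lim_1_over_n])
    moreover have "continuous_on UNIV (gauss :: real ^ 'd \<Rightarrow> real)" by (intro continuous_intros)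
    ultimately have "(\<lambda>n. gauss (?c n *\<^sub>R k)) \<longlonglongrightarrow> gauss (0 :: real ^ 'd)"
      by (auto intro: continuous_on_tendsto_compose)
    then show ?thesis by (simp add: gauss_def)
  qed
  show iF: "integrable lborel F"
  proof (rule integrable_monotone_convergence[OF ig])
    show "AE k in lborel. mono (\<lambda>n. gauss (?c n *\<^sub>R k) * F k)"
    proof (intro AE_I2 monoI mult_right_mono F(2))
      fix k :: "real ^ 'd" and m n :: nat assume "m \<le> n"
      then have "?c n * ?c n \<le> ?c m * ?c m"
        by (intro mult_mono) (auto simp: frac_le)
      then have "?c n * ?c n * (k \<bullet> k) \<le> ?c m * ?c m * (k \<bullet> k)"
        by (intro mult_right_mono) auto
      then show "gauss (?c m *\<^sub>R k) \<le> gauss (?c n *\<^sub>R k)"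
        unfolding gauss_def inner_scaleR_left inner_scaleR_right exp_le_cancel_iff
        by (simp only: mult.assoc[symmetric]) (simp only: divide_right_mono neg_le_iff_le zero_le_numeral)
    qed
    show "AE k in lborel. (\<lambda>n. gauss (?c n *\<^sub>R k) * F k) \<longlonglongrightarrow> F k"
      using tendsto_mult_right[OF gl] by (intro AE_I2) simp
    have "(\<integral>k. gauss (?c n *\<^sub>R k) * F k \<partial>lborel) = sqrt (2 * pi) ^ CARD('d) * (\<integral>v. h (0 + ?c n *\<^sub>R v) * gauss v \<partial>lborel)" for n
    proof -
      have "complex_of_real (\<integral>k. gauss (?c n *\<^sub>R k) * F k \<partial>lborel) = complex_of_real (sqrt (2 * pi) ^ CARD('d) * (\<integral>v. h (0 + ?c n *\<^sub>R v) * gauss v \<partial>lborel))"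
        using G[of 0 n] unfolding integral_complex_of_real[symmetric] by simp
      then show ?thesis unfolding of_real_eq_iff .
    qed
    then show "(\<lambda>n. \<integral>k. gauss (?c n *\<^sub>R k) * F k \<partial>lborel) \<longlonglongrightarrow> sqrt (2 * pi) ^ CARD('d) * (sqrt (2 * pi) ^ CARD('d) * h 0)"
      using tendsto_mult_left[OF lim[of 0]] by simp
  qed auto
  have "(\<lambda>n. \<integral>k. cis (k \<bullet> s) * complex_of_real (gauss (?c n *\<^sub>R k) * F k) \<partial>lborel)
      \<longlonglongrightarrow> (\<integral>k. cis (k \<bullet> s) * complex_of_real (F k) \<partial>lborel)"
  proof (rule integral_dominated_convergence[where w=F])
    show "AE k in lborel. (\<lambda>n. cis (k \<bullet> s) * complex_of_real (gauss (?c n *\<^sub>R k) * F k)) \<longlonglongrightarrow> cis (k \<bullet> s) * complex_of_real (F k)"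
    proof (rule AE_I2)
      fix k
      have "(\<lambda>n. cis (k \<bullet> s) * complex_of_real (gauss (?c n *\<^sub>R k) * F k)) \<longlonglongrightarrow> cis (k \<bullet> s) * complex_of_real (1 * F k)"
        by (intro tendsto_intros gl)
      then show "(\<lambda>n. cis (k \<bullet> s) * complex_of_real (gauss (?c n *\<^sub>R k) * F k)) \<longlonglongrightarrow> cis (k \<bullet> s) * complex_of_real (F k)"
        by simp
    qed
    show "AE k in lborel. norm (cis (k \<bullet> s) * complex_of_real (gauss (?c n *\<^sub>R k) * F k)) \<le> F k" for n
      using F(2) by (intro AE_I2) (auto simp: norm_mult mult_left_le_one_le)
  qed (auto intro: iF)
  moreover have "(\<lambda>n. \<integral>k. cis (k \<bullet> s) * complex_of_real (gauss (?c n *\<^sub>R k) * F k) \<partial>lborel)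
      \<longlonglongrightarrow> complex_of_real ((2 * pi) ^ CARD('d) * h s)"
    unfolding G gc[symmetric] by (intro tendsto_intros lim)
  ultimately show "(\<integral>k. cis (k \<bullet> s) * complex_of_real (F k) \<partial>lborel) = complex_of_real ((2 * pi) ^ CARD('d) * h s)"
    by (rule LIMSEQ_unique)
qed

text \<open>Compact support makes the two-variable integrand \<open>f x * f (x - u)\<close>
  integrable by continuity alone, so that Fubini can factorise the transform of the
  autocorrelation.\<close>

lemma
  fixes f :: "real ^ 'd \<Rightarrow> real"
  assumes f: "continuous_on UNIV f" "\<And>x. r \<le> norm x \<Longrightarrow> f x = 0" "\<And>x. \<bar>f x\<bar> \<le> C"
  shows integrable_compact_support: "integrable lborel f"
    and continuous_on_cross_corr: "continuous_on UNIV (cross_corr f f)"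
    and integrable_cross_corr: "integrable lborel (cross_corr f f)"
    and fourier_cross_corr: "fourier_fun (cross_corr f f) k = fourier_fun f k * cnj (fourier_fun f k)"
    and cross_corr_support: "2 * r \<le> norm y \<Longrightarrow> cross_corr f f y = 0"
    and cross_corr_le: "\<bar>cross_corr f f y\<bar> \<le> C * (\<integral>x. \<bar>f x\<bar> \<partial>lborel)"
proof -
  have fm[measurable]: "f \<in> borel_measurable borel"
    using f(1) by (rule borel_measurable_continuous_onI)
  have C0: "0 \<le> C" using f(3)[of 0] by simp
  have "f = (\<lambda>x. indicator (cball 0 r) x *\<^sub>R f x)"
    using f(2) by (auto simp: fun_eq_iff indicator_def)
  then show fi: "integrable lborel f"
    using borel_integrable_compact[of "cball 0 r" f] continuous_on_subset[OF f(1)] by auto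
  have fb: "integrable lborel (\<lambda>x. C * \<bar>f x\<bar>)" using fi by simp
  show "continuous_on UNIV (cross_corr f f)"
  proof (rule continuous_on_sequentiallyI)
    fix u :: "nat \<Rightarrow> real ^ 'd" and a assume u: "u \<longlonglongrightarrow> a"
    show "(\<lambda>n. cross_corr f f (u n)) \<longlonglongrightarrow> cross_corr f f a"
      unfolding cross_corr_def
    proof (rule integral_dominated_convergence[OF _ _ fb])
      show "AE x in lborel. (\<lambda>n. f x * f (x - u n)) \<longlonglongrightarrow> f x * f (x - a)"
      proof (rule AE_I2)
        fix x
        have "(\<lambda>n. x - u n) \<longlonglongrightarrow> x - a" using u by (intro tendsto_intros)
        then have "(\<lambda>n. f (x - u n)) \<longlonglongrightarrow> f (x - a)"
          by (rule continuous_on_tendsto_compose[OF f(1)]) auto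
        then show "(\<lambda>n. f x * f (x - u n)) \<longlonglongrightarrow> f x * f (x - a)" by (intro tendsto_intros)
      qed
      show "AE x in lborel. norm (f x * f (x - u n)) \<le> C * \<bar>f x\<bar>" for n
        using f(3) by (intro AE_I2) (auto simp: abs_mult mult.commute[of C] intro!: mult_left_mono)
    qed auto
  qed
  show "cross_corr f f y = 0" if "2 * r \<le> norm y"
  proof -
    have "f x * f (x - y) = 0" for x
    proof (cases "r \<le> norm x")
      case False
      have "norm y \<le> norm x + norm (x - y)" using norm_triangle_ineq4[of x "x - y"] by simp
      then have "r \<le> norm (x - y)" using False that by simp
      then show ?thesis using f(2) by simp
    qed (simp add: f(2))
    then show ?thesis unfolding cross_corr_def by (simp only: lebesgue_integral_const) simp
  qed
  show "\<bar>cross_corr f f y\<bar> \<le> C * (\<integral>x. \<bar>f x\<bar> \<partial>lborel)"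
  proof -
    have "\<bar>cross_corr f f y\<bar> \<le> (\<integral>x. \<bar>f x * f (x - y)\<bar> \<partial>lborel)"
      unfolding cross_corr_def by (rule integral_abs_bound)
    also have "\<dots> \<le> (\<integral>x. C * \<bar>f x\<bar> \<partial>lborel)"
      using f(3) C0 fb by (intro integral_mono_AE' AE_I2)
       (auto simp: abs_mult mult.commute[of C] intro!: mult_left_mono)
    finally show ?thesis by simp
  qed
  let ?G = "\<lambda>k u x. complex_of_real (f x * f (x - u)) * cis (- (k \<bullet> u))"
  have G: "integrable (lborel \<Otimes>\<^sub>M lborel) (\<lambda>(u, x). ?G k u x)" for k
  proof -
    \<comment> \<open>The integrand vanishes unless norm x < r and norm u < 2 r, so cutting it off
      to a compact product of balls changes nothing and reduces integrability to continuity.\<close>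
    have "(\<lambda>(u, x). ?G k u x) = (\<lambda>p. indicator (cball 0 (2 * r) \<times> cball 0 r) p *\<^sub>R (case p of (u, x) \<Rightarrow> ?G k u x))"
    proof (rule ext, clarify)
      fix u x
      show "?G k u x = indicator (cball 0 (2 * r) \<times> cball 0 r) (u, x) *\<^sub>R ?G k u x"
      proof (cases "norm u \<le> 2 * r \<and> norm x \<le> r")
        case False
        have "f x * f (x - u) = 0"
        proof (cases "r \<le> norm x")
          case nx: False
          have "norm u \<le> norm x + norm (x - u)" using norm_triangle_ineq4[of x "x - u"] by simp
          then have "r \<le> norm (x - u)" using nx False by simp
          then show ?thesis using f(2) by simp
        qed (simp add: f(2))
        then show ?thesis by (simp only: of_real_0 mult_zero_left scaleR_zero_right)
      qed simp
    qed
    moreover have "continuous_on A (\<lambda>p. case p of (u, x) \<Rightarrow> ?G k u x)" for A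
      unfolding case_prod_beta
      by (intro continuous_intros continuous_on_compose2[OF f(1)]) auto
    ultimately show ?thesis
      unfolding lborel_prod using borel_integrable_compact[of "cball 0 (2 * r) \<times> cball 0 r" "\<lambda>(u, x). ?G k u x"]
      by (simp add: compact_Times)
  qed
  have h: "(\<integral>x. ?G k u x \<partial>lborel) = complex_of_real (cross_corr f f u) * cis (- (k \<bullet> u))" for k u
    unfolding cross_corr_def integral_mult_left_zero integral_complex_of_real ..
  show "integrable lborel (cross_corr f f)"
    using integrable_Re[OF lborel_pair.integrable_fst[OF G[of 0]]] by (simp add: cross_corr_def[abs_def] del: of_real_mult)
  have "fourier_fun (cross_corr f f) k = (\<integral>u. (\<integral>x. ?G k u x \<partial>lborel) \<partial>lborel)"
    unfolding fourier_fun_def h ..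
  also have "\<dots> = (\<integral>x. (\<integral>u. ?G k u x \<partial>lborel) \<partial>lborel)"
    by (rule lborel_pair.Fubini_integral[OF G, symmetric])
  also have "\<dots> = (\<integral>x. (complex_of_real (f x) * cis (- (k \<bullet> x))) * cnj (fourier_fun f k) \<partial>lborel)"
  proof (rule Bochner_Integration.integral_cong[OF refl])
    fix x
    \<comment> \<open>The reflection u = x - z splits the character into exp(-i k.x) and the
      conjugate of exp(-i k.z).\<close>
    have "(\<integral>u. ?G k u x \<partial>lborel) = (\<integral>z. ?G k (x + (-1) *\<^sub>R z) x \<partial>lborel)"
      by (subst integral_lborel_affine[where c="-1" and t=x]) auto
    also have "\<dots> = (\<integral>z. (complex_of_real (f x) * cis (- (k \<bullet> x))) * cnj (complex_of_real (f z) * cis (- (k \<bullet> z))) \<partial>lborel)"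
      by (intro Bochner_Integration.integral_cong)
        (auto simp: cis_cnj[symmetric] cis_mult[symmetric] inner_diff_right cis_divide[symmetric] divide_inverse)
    also have "\<dots> = (complex_of_real (f x) * cis (- (k \<bullet> x))) * cnj (fourier_fun f k)"
      unfolding fourier_fun_def integral_mult_right_zero Bochner_Integration.integral_cnj ..
    finally show "(\<integral>u. ?G k u x \<partial>lborel) = (complex_of_real (f x) * cis (- (k \<bullet> x))) * cnj (fourier_fun f k)" .
  qed
  also have "\<dots> = fourier_fun f k * cnj (fourier_fun f k)"
    unfolding integral_mult_left_zero fourier_fun_def[symmetric] ..
  finally show "fourier_fun (cross_corr f f) k = fourier_fun f k * cnj (fourier_fun f k)" .
qed

section \<open>Comparison of spectral measures\<close>

text \<open>A bump whose support and supremum are both governed by \<open>r\<close>. Continuity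
  serves the inversion theorem, and a small support keeps the transform away from 0 on a large
  ball.\<close>

definition tent :: "real \<Rightarrow> 'a::real_normed_vector \<Rightarrow> real" where
  "tent r x = max 0 (r - norm x)"

lemma tent_simps[simp]: "0 \<le> tent r x" "r \<le> norm x \<Longrightarrow> tent r x = 0" "0 \<le> r \<Longrightarrow> \<bar>tent r x\<bar> \<le> r" "0 \<le> r \<Longrightarrow> tent r x \<le> r"
  by (auto simp: tent_def)

lemma continuous_on_tent: "continuous_on A (tent r)"
  unfolding tent_def by (intro continuous_intros)

lemma test_fun_tent:
  fixes t :: "real ^ 'd"
  assumes "0 < r"
  shows "test_fun (\<lambda>x. tent r (x - t))"
  unfolding test_fun_def
proof (intro conjI)
  show "(\<lambda>x. tent r (x - t)) \<in> borel_measurable borel"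
    by (intro borel_measurable_continuous_onI continuous_on_compose2[OF continuous_on_tent] continuous_intros) auto
  show "bounded (range (\<lambda>x. tent r (x - t)))"
    using assms tent_simps(3)[of r] by (auto simp: bounded_iff intro!: exI[of _ r])
  have "{x. tent r (x - t) \<noteq> 0} \<subseteq> cball t r"
    by (auto simp: tent_def dist_norm norm_minus_commute)
  then show "bounded {x. tent r (x - t) \<noteq> 0}" by (rule bounded_subset[OF bounded_cball])
qed

lemma fourier_fun_translate:
  fixes f :: "real ^ 'd \<Rightarrow> real"
  assumes [measurable]: "f \<in> borel_measurable borel"
  shows "fourier_fun (\<lambda>x. f (x - t)) k = cis (- (k \<bullet> t)) * fourier_fun f k"
proof -
  have "fourier_fun (\<lambda>x. f (x - t)) k = (\<integral>x. complex_of_real (f (t + 1 *\<^sub>R x - t)) * cis (- (k \<bullet> (t + 1 *\<^sub>R x))) \<partial>lborel)"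
    unfolding fourier_fun_def by (subst integral_lborel_affine[where c=1 and t=t]) auto
  also have "\<dots> = (\<integral>x. cis (- (k \<bullet> t)) * (complex_of_real (f x) * cis (- (k \<bullet> x))) \<partial>lborel)"
    by (intro Bochner_Integration.integral_cong) (auto simp: inner_add_right cis_mult[symmetric] cis_mult)
  finally show ?thesis unfolding fourier_fun_def integral_mult_right_zero .
qed

lemma cross_corr_translate:
  fixes f g :: "real ^ 'd \<Rightarrow> real"
  assumes [measurable]: "f \<in> borel_measurable borel" "g \<in> borel_measurable borel"
  shows "cross_corr (\<lambda>x. f (x - t)) g y = cross_corr f g (y - t)"
proof -
  have "cross_corr (\<lambda>x. f (x - t)) g y = (\<integral>x. f (t + 1 *\<^sub>R x - t) * g (t + 1 *\<^sub>R x - y) \<partial>lborel)"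
    unfolding cross_corr_def by (subst integral_lborel_affine[where c=1 and t=t]) auto
  also have "\<dots> = cross_corr f g (y - t)"
    unfolding cross_corr_def by (intro Bochner_Integration.integral_cong) (auto simp: algebra_simps)
  finally show ?thesis .
qed

text \<open>On the support |k.x| <= 1 < pi/2, so the cosine is positive there, and the real part of
  the transform is the integral of a nonnegative function that is positive on a ball.\<close>

lemma fourier_tent_nonzero:
  fixes k :: "real ^ 'd"
  assumes r: "0 < r" and k: "norm k * r \<le> 1"
  shows "fourier_fun (tent r) k \<noteq> 0"
proof
  assume "fourier_fun (tent r) k = 0"
  have i: "integrable lborel (tent r :: real ^ 'd \<Rightarrow> real)"
    using r by (intro integrable_compact_support[OF continuous_on_tent, where r=r and C=r]) auto
  then have [measurable]: "(tent r :: real ^ 'd \<Rightarrow> real) \<in> borel_measurable borel" by auto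
  have ic: "integrable lborel (\<lambda>x. complex_of_real (tent r x) * cis (- (k \<bullet> x)))"
    by (rule Bochner_Integration.integrable_bound[OF i]) (auto simp: norm_mult)
  have cpos: "0 < cos (k \<bullet> x)" if "norm x < r" for x
  proof -
    have "\<bar>k \<bullet> x\<bar> \<le> norm k * norm x" by (rule Cauchy_Schwarz_ineq2)
    also have "\<dots> \<le> norm k * r" using that by (intro mult_left_mono) auto
    also have "\<dots> \<le> 1" by fact
    finally show ?thesis using pi_gt3 by (intro cos_gt_zero_pi) auto
  qed
  have nn: "0 \<le> tent r x * cos (k \<bullet> x)" for x
    by (cases "norm x < r") (auto dest: cpos less_imp_le intro!: mult_nonneg_nonneg)
  have "(\<integral>x. tent r x * cos (k \<bullet> x) \<partial>lborel) = Re (fourier_fun (tent r) k)"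
    unfolding fourier_fun_def integral_Re[OF ic, symmetric] by simp
  then have "(\<integral>x. tent r x * cos (k \<bullet> x) \<partial>lborel) = 0"
    using \<open>fourier_fun (tent r) k = 0\<close> by simp
  moreover have "integrable lborel (\<lambda>x. tent r x * cos (k \<bullet> x))"
    using integrable_Re[OF ic] by simp
  ultimately have "AE x in lborel. tent r x * cos (k \<bullet> x) = 0"
    using nn by (subst integral_nonneg_eq_0_iff_AE[symmetric]) auto
  then have "AE x in lborel. x \<notin> ball (0 :: real ^ 'd) r"
  proof eventually_elim
    case (elim x)
    then show ?case using cpos[of x] by (auto simp: tent_def)
  qed
  then have "emeasure lborel (ball (0 :: real ^ 'd) r) = 0"
    by (subst (asm) AE_iff_measurable[OF _ refl]) (auto simp: ball_def)
  moreover have "0 < emeasure lborel (ball (0 :: real ^ 'd) r)"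
    using r emeasure_lborel_ball_finite[of "0 :: real ^ 'd" r]
    by (simp add: emeasure_ball unit_ball_vol_pos)
  ultimately show False by simp
qed

text \<open>By \<open>inv\<close>, the function \<open>c * h\<close> is the inverse transform of
  \<open>w\<close>. Fubini then shows that weighting the transform of \<open>D\<close> by
  \<open>w\<close> corresponds to integrating translates of \<open>h\<close> against
  \<open>D\<close>.\<close>

lemma fourier_weighted_transform:
  fixes D :: "(real ^ 'd) measure" and h w F :: "real ^ 'd \<Rightarrow> real"
  assumes D: "finite_measure D" "sets D = sets borel"
    and w: "integrable lborel w" "\<And>k. 0 \<le> w k"
    and inv: "\<And>s. (\<integral>k. cis (k \<bullet> s) * complex_of_real (w k) \<partial>lborel) = complex_of_real (c * h s)"
    and F: "\<And>k. fourier_measure D k = complex_of_real (F k)" "\<And>k. 0 \<le> F k"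
  shows "finite_measure (density lborel (\<lambda>k. ennreal (w k * F k)))"
    and "fourier_measure (density lborel (\<lambda>k. ennreal (w k * F k))) t = complex_of_real (c * (\<integral>y. h (y - t) \<partial>D))"
proof -
  interpret D: finite_measure D by fact
  interpret pair_sigma_finite D lborel ..
  note [measurable_cong] = D(2)
  have [measurable]: "w \<in> borel_measurable borel" using w(1) by auto
  have Feq: "F = (\<lambda>k. Re (fourier_measure D k))" by (simp add: F)
  have [measurable]: "F \<in> borel_measurable borel"
    unfolding Feq by (intro borel_measurable_continuous_onI continuous_intros continuous_on_fourier_measure D)
  have Fb: "F k \<le> measure D (space D)" for k
  proof -
    have "F k = norm (fourier_measure D k)" using F by simp
    also have "\<dots> \<le> (\<integral>x. norm (cis (- (k \<bullet> x))) \<partial>D)"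
      unfolding fourier_measure_def by (rule integral_norm_bound)
    finally show ?thesis by simp
  qed
  have i: "integrable lborel (\<lambda>k. w k * F k)"
    by (rule Bochner_Integration.integrable_bound[OF integrable_mult_left[OF w(1), of "measure D (space D)"]])
      (use F(2) w(2) Fb in \<open>auto simp: abs_mult intro!: mult_left_mono\<close>)
  show "finite_measure (density lborel (\<lambda>k. ennreal (w k * F k)))"
    using w(2) F(2) by (intro finite_measure_density_lborel i) auto
  let ?G = "\<lambda>y k. cis (k \<bullet> (y - t)) * complex_of_real (w k)"
  have G: "integrable (D \<Otimes>\<^sub>M lborel) (\<lambda>(y, k). ?G y k)"
  proof (rule integrableI_bounded)
    have "(\<integral>\<^sup>+x. ennreal (norm (case x of (y, k) \<Rightarrow> ?G y k)) \<partial>(D \<Otimes>\<^sub>M lborel)) = (\<integral>\<^sup>+y. \<integral>\<^sup>+k. ennreal (w k) \<partial>lborel \<partial>D)"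
      using w(2) by (subst lborel.nn_integral_fst[symmetric]) (auto simp: norm_mult)
    also have "\<dots> < \<infinity>"
      using w by (simp add: nn_integral_eq_integral ennreal_mult_eq_top_iff less_top[symmetric])
    finally show "(\<integral>\<^sup>+x. ennreal (norm (case x of (y, k) \<Rightarrow> ?G y k)) \<partial>(D \<Otimes>\<^sub>M lborel)) < \<infinity>" .
  qed measurable
  \<comment> \<open>The opposite sign in the exponent does no harm: \<open>F\<close> is real, so the
    transform of \<open>D\<close> equals its own conjugate.\<close>
  have cF: "complex_of_real (F k) = (\<integral>y. cis (k \<bullet> y) \<partial>D)" for k
  proof -
    have "complex_of_real (F k) = cnj (fourier_measure D k)" by (simp add: F)
    also have "\<dots> = (\<integral>y. cis (k \<bullet> y) \<partial>D)"
      unfolding fourier_measure_def Bochner_Integration.integral_cnj[symmetric] by (simp only: cis_cnj minus_minus)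
    finally show ?thesis .
  qed
  have "fourier_measure (density lborel (\<lambda>k. ennreal (w k * F k))) t = fourier_fun (\<lambda>k. w k * F k) t"
    using w(2) F(2) by (intro fourier_measure_density i) auto
  also have "\<dots> = (\<integral>k. (\<integral>y. ?G y k \<partial>D) \<partial>lborel)"
    unfolding fourier_fun_def
  proof (rule Bochner_Integration.integral_cong[OF refl])
    fix k
    have "(\<integral>y. ?G y k \<partial>D) = (\<integral>y. (complex_of_real (w k) * cis (- (t \<bullet> k))) * cis (k \<bullet> y) \<partial>D)"
      by (intro Bochner_Integration.integral_cong) (auto simp: inner_diff_right cis_mult inner_commute)
    then show "complex_of_real (w k * F k) * cis (- (t \<bullet> k)) = (\<integral>y. ?G y k \<partial>D)"
      unfolding integral_mult_right_zero of_real_mult cF by (simp only: mult_ac)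
  qed
  also have "\<dots> = (\<integral>y. (\<integral>k. ?G y k \<partial>lborel) \<partial>D)"
    by (rule Fubini_integral[OF G])
  also have "\<dots> = complex_of_real (c * (\<integral>y. h (y - t) \<partial>D))"
    unfolding inv integral_complex_of_real integral_mult_right_zero ..
  finally show "fourier_measure (density lborel (\<lambda>k. ennreal (w k * F k))) t = complex_of_real (c * (\<integral>y. h (y - t) \<partial>D))" .
qed

text \<open>\<open>main\<close> is the difference of the two Bartlett identities for a tent and its
  translate by \<open>t\<close>, and this \<open>t\<close> becomes the Fourier variable. After
  uniqueness has been applied to the weighted measures, the weight is divided out on
  \<open>B\<close>.\<close>

lemma spectral_comparison:
  fixes \<beta>K \<beta>L DK DL :: "(real ^ 'd) measure" and FK FL :: "real ^ 'd \<Rightarrow> real"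
  assumes \<beta>: "sets \<beta>K = sets borel" "sets \<beta>L = sets borel"
    and DK: "finite_measure DK" "sets DK = sets borel"
    and DL: "finite_measure DL" "sets DL = sets borel"
    and FK: "\<And>k. fourier_measure DK k = complex_of_real (FK k)" "\<And>k. 0 \<le> FK k"
    and FL: "\<And>k. fourier_measure DL k = complex_of_real (FL k)" "\<And>k. 0 \<le> FL k"
    and iK: "\<And>f g. test_fun f \<Longrightarrow> test_fun g \<Longrightarrow> integrable \<beta>K (\<lambda>k. fourier_fun f k * cnj (fourier_fun g k))"
    and iL: "\<And>f g. test_fun f \<Longrightarrow> test_fun g \<Longrightarrow> integrable \<beta>L (\<lambda>k. fourier_fun f k * cnj (fourier_fun g k))"
    and main: "\<And>r t. 0 < r \<Longrightarrow>
        (\<integral>k. fourier_fun (\<lambda>x. tent r (x - t)) k * cnj (fourier_fun (tent r) k) \<partial>\<beta>K)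
      - (\<integral>k. fourier_fun (\<lambda>x. tent r (x - t)) k * cnj (fourier_fun (tent r) k) \<partial>\<beta>L)
      = complex_of_real ((2 * pi) ^ CARD('d) * ((\<integral>y. cross_corr (\<lambda>x. tent r (x - t)) (tent r) y \<partial>DK)
          - (\<integral>y. cross_corr (\<lambda>x. tent r (x - t)) (tent r) y \<partial>DL)))"
    and B: "B \<in> sets borel" "bounded B"
  shows "emeasure \<beta>K B + (\<integral>\<^sup>+k\<in>B. ennreal (FL k) \<partial>lborel) = emeasure \<beta>L B + (\<integral>\<^sup>+k\<in>B. ennreal (FK k) \<partial>lborel)"
proof -
  note [measurable_cong] = \<beta>
  note [measurable] = B(1)
  obtain R where R: "0 < R" "\<And>k. k \<in> B \<Longrightarrow> norm k \<le> R"
    using B(2) unfolding bounded_pos by auto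
  \<comment> \<open>With this radius norm k * r <= 1 on \<open>B\<close>, so the transform of the
    tent has no zero there.\<close>
  define r where "r = 1 / R"
  have r: "0 < r" using R(1) by (simp add: r_def)
  let ?f = "tent r :: real ^ 'd \<Rightarrow> real"
  have f: "continuous_on UNIV ?f" "\<And>x. r \<le> norm x \<Longrightarrow> ?f x = 0" "\<And>x. \<bar>?f x\<bar> \<le> r"
    using r continuous_on_tent by auto
  have [measurable]: "?f \<in> borel_measurable borel"
    using f(1) by (rule borel_measurable_continuous_onI)
  define h where "h = cross_corr ?f ?f"
  define w where "w k = (cmod (fourier_fun ?f k))\<^sup>2" for k
  have fi: "integrable lborel ?f" using integrable_compact_support[OF f] .
  have w0: "0 \<le> w k" for k by (simp add: w_def)
  have wpos: "0 < w k" if "k \<in> B" for k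
  proof -
    have "norm k * r \<le> 1" using R that by (simp add: r_def field_simps)
    then show ?thesis using fourier_tent_nonzero[OF r] by (simp add: w_def)
  qed
  have ww: "fourier_fun ?f k * cnj (fourier_fun ?f k) = complex_of_real (w k)" for k
    unfolding w_def by (rule complex_norm_square[symmetric])
  have h: "continuous_on UNIV h" "\<And>x. 0 \<le> h x" "\<And>x. h x \<le> r * (\<integral>x. \<bar>?f x\<bar> \<partial>lborel)" "integrable lborel h"
    using continuous_on_cross_corr[OF f] cross_corr_le[OF f] integrable_cross_corr[OF f] 
    by (auto simp: h_def cross_corr_def abs_le_iff intro!: integral_nonneg_AE)
  have hF: "fourier_fun h k = complex_of_real (w k)" for k
    using fourier_cross_corr[OF f, where k=k] ww[of k] by (simp add: h_def)
  note inv = fourier_inversion[OF h hF w0]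
  have [measurable]: "w \<in> borel_measurable borel" using inv(1) by auto
  note wK = fourier_weighted_transform[OF DK inv(1) w0 inv(2) FK]
  note wL = fourier_weighted_transform[OF DL inv(1) w0 inv(2) FL]
  have Feq: "FK = (\<lambda>k. Re (fourier_measure DK k))" "FL = (\<lambda>k. Re (fourier_measure DL k))" by (simp_all add: FK FL)
  have FKm[measurable]: "FK \<in> borel_measurable borel"
    unfolding Feq by (intro borel_measurable_continuous_onI continuous_intros continuous_on_fourier_measure DK)
  have FLm[measurable]: "FL \<in> borel_measurable borel"
    unfolding Feq by (intro borel_measurable_continuous_onI continuous_intros continuous_on_fourier_measure DL)
  \<comment> \<open>The translation contributes just the character cis(-(t.k)), so the Bartlett
    integral for a translate and the tent itself is the Fourier transform at \<open>t\<close> of the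
    weighted spectral measure.\<close>
  have tf: "fourier_fun (\<lambda>x. ?f (x - t)) k * cnj (fourier_fun ?f k) = w k *\<^sub>R cis (- (t \<bullet> k))" for t k
    by (simp add: fourier_fun_translate ww mult.assoc scaleR_conv_of_real inner_commute mult.commute)
  have tc: "cross_corr (\<lambda>x. ?f (x - t)) ?f y = h (y - t)" for t y
    unfolding h_def by (rule cross_corr_translate) measurable
  have test: "test_fun ?f" using test_fun_tent[OF r, of 0] by simp
  \<comment> \<open>With both test functions equal to the tent, the integrability demanded of a
    spectral measure says exactly that the weighted measure is finite.\<close>
  have spec: "finite_measure (density \<beta> (\<lambda>k. ennreal (w k)))"
     "fourier_measure (density \<beta> (\<lambda>k. ennreal (w k))) t = (\<integral>k. fourier_fun (\<lambda>x. ?f (x - t)) k * cnj (fourier_fun ?f k) \<partial>\<beta>)"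
    if b: "sets \<beta> = sets borel" and i: "integrable \<beta> (\<lambda>k. fourier_fun ?f k * cnj (fourier_fun ?f k))" for \<beta> t
  proof -
    note [measurable_cong] = b
    have "integrable \<beta> w" using integrable_Re[OF i] by (simp add: ww)
    then show "finite_measure (density \<beta> (\<lambda>k. ennreal (w k)))"
      using w0 by (intro finite_measureI) (auto simp: emeasure_density nn_integral_eq_integral nn_set_integral_space)
    show "fourier_measure (density \<beta> (\<lambda>k. ennreal (w k))) t = (\<integral>k. fourier_fun (\<lambda>x. ?f (x - t)) k * cnj (fourier_fun ?f k) \<partial>\<beta>)"
      unfolding fourier_measure_def tf using w0 by (subst integral_density) auto
  qed
  note sK = spec[OF \<beta>(1) iK[OF test test]] and sL = spec[OF \<beta>(2) iL[OF test test]]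
  let ?\<mu>K = "density \<beta>K (\<lambda>k. ennreal (w k))" and ?\<mu>L = "density \<beta>L (\<lambda>k. ennreal (w k))"
  let ?\<rho>K = "density lborel (\<lambda>k. ennreal (w k * FK k))" and ?\<rho>L = "density lborel (\<lambda>k. ennreal (w k * FL k))"
  have s: "sets ?\<rho>L = sets ?\<mu>K" "sets ?\<rho>K = sets ?\<mu>L" using \<beta> by simp_all
  have "add_measure ?\<mu>K ?\<rho>L = add_measure ?\<mu>L ?\<rho>K"
  proof (rule fourier_measure_inject)
    show "finite_measure (add_measure ?\<mu>K ?\<rho>L)" "finite_measure (add_measure ?\<mu>L ?\<rho>K)"
      by (intro finite_measure_add_measure s sK sL wK wL)+
    fix t :: "real ^ 'd"
    have e: "fourier_measure (add_measure P Q) t = fourier_measure P t + fourier_measure Q t"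
      if "finite_measure P" "finite_measure Q" "sets P = sets borel" "sets Q = sets borel" for P Q :: "(real ^ 'd) measure"
      unfolding fourier_measure_def using that
      by (intro complex_integral_add_measure integrable_cis) auto
    have "fourier_measure ?\<mu>K t - fourier_measure ?\<mu>L t = fourier_measure ?\<rho>K t - fourier_measure ?\<rho>L t"
      unfolding sK(2) sL(2) wK(2) wL(2) main[OF r] tc by (simp add: right_diff_distrib)
    then show "fourier_measure (add_measure ?\<mu>K ?\<rho>L) t = fourier_measure (add_measure ?\<mu>L ?\<rho>K) t"
      using \<beta> sK(1) sL(1) wK(1) wL(1) by (simp add: e algebra_simps)
  qed (use \<beta> in auto)
  \<comment> \<open>Integrating \<open>1 / w\<close> over \<open>B\<close> undoes the weight:
    \<open>w\<close> is positive there, and off \<open>B\<close> the indicator suppresses the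
    integrand.\<close>
  then have "(\<integral>\<^sup>+k\<in>B. ennreal (1 / w k) \<partial>add_measure ?\<mu>K ?\<rho>L) = (\<integral>\<^sup>+k\<in>B. ennreal (1 / w k) \<partial>add_measure ?\<mu>L ?\<rho>K)"
    by simp
  moreover have "(\<integral>\<^sup>+k\<in>B. ennreal (1 / w k) \<partial>density \<beta> (\<lambda>k. ennreal (w k))) = emeasure \<beta> B" if b: "sets \<beta> = sets borel" for \<beta>
  proof -
    note [measurable_cong] = b
    have "(\<integral>\<^sup>+k\<in>B. ennreal (1 / w k) \<partial>density \<beta> (\<lambda>k. ennreal (w k))) = (\<integral>\<^sup>+k. ennreal (w k) * (ennreal (1 / w k) * indicator B k) \<partial>\<beta>)"
      by (intro nn_integral_density) measurable
    also have "\<dots> = (\<integral>\<^sup>+k. indicator B k \<partial>\<beta>)"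
      using wpos w0 by (intro nn_integral_cong) (auto simp: indicator_def ennreal_mult[symmetric] less_imp_neq[symmetric])
    also have "\<dots> = emeasure \<beta> B" using B(1) b by simp
    finally show ?thesis .
  qed
  moreover have "(\<integral>\<^sup>+k\<in>B. ennreal (1 / w k) \<partial>density lborel (\<lambda>k. ennreal (w k * F k))) = (\<integral>\<^sup>+k\<in>B. ennreal (F k) \<partial>lborel)"
    if [measurable]: "F \<in> borel_measurable borel" and F: "\<And>k. 0 \<le> F k" for F
  proof -
    have "(\<integral>\<^sup>+k\<in>B. ennreal (1 / w k) \<partial>density lborel (\<lambda>k. ennreal (w k * F k))) = (\<integral>\<^sup>+k. ennreal (w k * F k) * (ennreal (1 / w k) * indicator B k) \<partial>lborel)"
      by (intro nn_integral_density) measurable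
    also have "\<dots> = (\<integral>\<^sup>+k\<in>B. ennreal (F k) \<partial>lborel)"
      using wpos w0 F by (intro nn_integral_cong) (auto simp: indicator_def ennreal_mult[symmetric] less_imp_neq[symmetric])
    finally show ?thesis .
  qed
  moreover have "(\<integral>\<^sup>+k\<in>B. ennreal (1 / w k) \<partial>add_measure P Q) = (\<integral>\<^sup>+k\<in>B. ennreal (1 / w k) \<partial>P) + (\<integral>\<^sup>+k\<in>B. ennreal (1 / w k) \<partial>Q)"
    if "sets P = sets borel" "sets Q = sets borel" for P Q
    using that B(1) by (intro nn_integral_add_measure) (auto simp: measurable_cong_sets[OF that(1) refl])
  ultimately show ?thesis using \<beta> FK(2) FL(2) FKm FLm by simp
qed

section \<open>Random measures as kernels\<close>

lemma random_measureD:
  assumes "random_measure N \<Phi>" "\<omega> \<in> space N"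
  shows "sets (\<Phi> \<omega>) = sets borel" "space (\<Phi> \<omega>) = UNIV"
    and "B \<in> sets borel \<Longrightarrow> bounded B \<Longrightarrow> emeasure (\<Phi> \<omega>) B < \<infinity>"
proof -
  show s: "sets (\<Phi> \<omega>) = sets borel" using assms by (auto simp: random_measure_def)
  show "space (\<Phi> \<omega>) = UNIV" using sets_eq_imp_space_eq[OF s] by simp
qed (use assms in \<open>auto simp: random_measure_def\<close>)

lemma random_measure_emeasure_measurable:
  "random_measure N \<Phi> \<Longrightarrow> B \<in> sets borel \<Longrightarrow> (\<lambda>\<omega>. emeasure (\<Phi> \<omega>) B) \<in> borel_measurable N"
  unfolding random_measure_def by blast

lemma sigma_finite_measure_locally_finite:
  fixes P :: "'a::euclidean_space measure"
  assumes "sets P = sets borel" and "\<And>n::nat. emeasure P (cball 0 (real n)) \<noteq> \<infinity>"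
  shows "sigma_finite_measure P"
proof (rule sigma_finite_measure.intro)
  have "(\<Union>n::nat. cball 0 (real n)) = (UNIV :: 'a set)"
    using real_arch_simple by (auto simp: set_eq_iff)
  then show "\<exists>A. countable A \<and> A \<subseteq> sets P \<and> \<Union>A = space P \<and> (\<forall>a\<in>A. emeasure P a \<noteq> \<infinity>)"
    using assms sets_eq_imp_space_eq[OF assms(1)]
    by (intro exI[of _ "range (\<lambda>n::nat. cball 0 (real n))"]) auto
qed

lemma random_measure_sigma_finite:
  assumes "random_measure N \<Phi>" "\<omega> \<in> space N"
  shows "sigma_finite_measure (\<Phi> \<omega>)"
  using random_measureD[OF assms] by (intro sigma_finite_measure_locally_finite) (auto simp: less_top)

text \<open>\<open>\<Phi> \<omega>\<close> may be an infinite measure, whereas integrals against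
  subprobability kernels are known to depend measurably on the parameter. Cutting space into the
  bounded shells \<open>A j\<close> and normalising each piece writes the integral as a series over
  such kernels.\<close>

lemma random_measure_nn_integral_measurable:
  fixes \<Phi> :: "'w \<Rightarrow> (real ^ 'd) measure"
  assumes rm: "random_measure N \<Phi>"
    and f[measurable]: "(\<lambda>(\<omega>, x). f \<omega> x) \<in> borel_measurable (N \<Otimes>\<^sub>M borel)"
  shows "(\<lambda>\<omega>. \<integral>\<^sup>+x. f \<omega> x \<partial>\<Phi> \<omega>) \<in> borel_measurable N"
proof -
  define A where "A j = {x :: real ^ 'd. real j \<le> norm x \<and> norm x < real (Suc j)}" for j :: nat
  have [measurable]: "A j \<in> sets borel" for j unfolding A_def by measurable
  have bA: "bounded (A j)" for j
    by (rule bounded_subset[of "cball 0 (real (Suc j))"]) (auto simp: A_def)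
  have A1: "(\<Sum>j. indicator (A j) x :: ennreal) = 1" for x
  proof -
    have "indicator (A j) x = (if j = nat \<lfloor>norm x\<rfloor> then 1 else 0 :: ennreal)" for j
      by (auto simp: A_def indicator_def floor_eq_iff le_nat_iff nat_eq_iff) 
        (linarith | (simp add: le_floor_iff floor_less_iff; linarith))+
    then show ?thesis by (simp add: sums_unique[OF sums_single, symmetric])
  qed
  \<comment> \<open>The summand 1 keeps the normalising divisor positive on shells without
    mass.\<close>
  define m where "m j \<omega> = 1 + emeasure (\<Phi> \<omega>) (A j)" for j \<omega>
  have [measurable]: "m j \<in> borel_measurable N" for j
    unfolding m_def by (intro borel_measurable_add random_measure_emeasure_measurable[OF rm] borel_measurable_const) measurable
  define Q where "Q j \<omega> = density (\<Phi> \<omega>) (\<lambda>x. indicator (A j) x / m j \<omega>)" for j \<omega>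
  have m: "m j \<omega> \<noteq> 0" "m j \<omega> \<noteq> \<top>" if "\<omega> \<in> space N" for j \<omega>
    using random_measureD(3)[OF rm that _ bA, of j] by (auto simp: m_def)
  have eQ: "emeasure (Q j \<omega>) B = emeasure (\<Phi> \<omega>) (A j \<inter> B) / m j \<omega>"
    if \<omega>: "\<omega> \<in> space N" and [measurable]: "B \<in> sets borel" for j \<omega> B
  proof -
    note [measurable_cong] = random_measureD(1)[OF rm \<omega>]
    have "emeasure (Q j \<omega>) B = (\<integral>\<^sup>+x. indicator (A j \<inter> B) x / m j \<omega> \<partial>\<Phi> \<omega>)"
      unfolding Q_def by (subst emeasure_density) (auto intro!: nn_integral_cong simp: indicator_def)
    also have "\<dots> = emeasure (\<Phi> \<omega>) (A j \<inter> B) / m j \<omega>"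
      by (subst nn_integral_divide) auto
    finally show ?thesis .
  qed
  have Q: "Q j \<in> measurable N (subprob_algebra borel)" for j
  proof (rule measurable_subprob_algebra)
    fix \<omega> assume \<omega>: "\<omega> \<in> space N"
    show "sets (Q j \<omega>) = sets borel" using random_measureD[OF rm \<omega>] by (simp add: Q_def)
    have "emeasure (Q j \<omega>) UNIV \<le> m j \<omega> / m j \<omega>"
      using eQ[OF \<omega>, of UNIV j] by (auto simp: m_def intro!: divide_right_mono_ennreal)
    also have "\<dots> = 1" using m[OF \<omega>] by (simp add: ennreal_divide_self less_top)
    finally show "subprob_space (Q j \<omega>)"
      using random_measureD[OF rm \<omega>] by (intro subprob_spaceI) (auto simp: Q_def)
  next
    fix B :: "(real ^ 'd) set" assume [measurable]: "B \<in> sets borel"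
    have "(\<lambda>\<omega>. emeasure (\<Phi> \<omega>) (A j \<inter> B) / m j \<omega>) \<in> borel_measurable N"
      by (intro borel_measurable_divide_ennreal random_measure_emeasure_measurable[OF rm]) measurable
    then show "(\<lambda>\<omega>. emeasure (Q j \<omega>) B) \<in> borel_measurable N"
      by (subst measurable_cong[OF eQ]) auto
  qed
  have "(\<integral>\<^sup>+x. f \<omega> x \<partial>\<Phi> \<omega>) = (\<Sum>j. m j \<omega> * (\<integral>\<^sup>+x. f \<omega> x \<partial>Q j \<omega>))" if \<omega>: "\<omega> \<in> space N" for \<omega>
  proof -
    note [measurable_cong] = random_measureD(1)[OF rm \<omega>]
    have [measurable]: "f \<omega> \<in> borel_measurable borel"
      using measurable_compose[OF measurable_Pair1'[OF \<omega>] f] by simp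
    have "(\<integral>\<^sup>+x. f \<omega> x \<partial>\<Phi> \<omega>) = (\<integral>\<^sup>+x. (\<Sum>j. indicator (A j) x * f \<omega> x) \<partial>\<Phi> \<omega>)"
      by (simp add: A1)
    also have "\<dots> = (\<Sum>j. \<integral>\<^sup>+x. indicator (A j) x * f \<omega> x \<partial>\<Phi> \<omega>)"
      by (rule nn_integral_suminf) measurable
    also have "\<dots> = (\<Sum>j. m j \<omega> * (\<integral>\<^sup>+x. f \<omega> x \<partial>Q j \<omega>))"
    proof (rule suminf_cong)
      fix j
      have "m j \<omega> * (\<integral>\<^sup>+x. f \<omega> x \<partial>Q j \<omega>) = m j \<omega> * (\<integral>\<^sup>+x. indicator (A j) x / m j \<omega> * f \<omega> x \<partial>\<Phi> \<omega>)"
        unfolding Q_def by (subst nn_integral_density) auto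
      also have "\<dots> = (\<integral>\<^sup>+x. m j \<omega> * (indicator (A j) x / m j \<omega> * f \<omega> x) \<partial>\<Phi> \<omega>)"
        by (rule nn_integral_cmult[symmetric]) measurable
      also have "\<dots> = (\<integral>\<^sup>+x. indicator (A j) x * f \<omega> x \<partial>\<Phi> \<omega>)"
        using m[OF \<omega>] by (intro nn_integral_cong)
          (auto simp: indicator_def mult.assoc[symmetric] ennreal_times_divide ennreal_divide_self less_top)
      finally show "(\<integral>\<^sup>+x. indicator (A j) x * f \<omega> x \<partial>\<Phi> \<omega>) = m j \<omega> * (\<integral>\<^sup>+x. f \<omega> x \<partial>Q j \<omega>)" by simp
    qed
    finally show ?thesis .
  qed
  moreover have "(\<lambda>\<omega>. \<Sum>j. m j \<omega> * (\<integral>\<^sup>+x. f \<omega> x \<partial>Q j \<omega>)) \<in> borel_measurable N"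
    using nn_integral_measurable_subprob_algebra2[OF f Q] by measurable
  ultimately show ?thesis by (subst measurable_cong) auto
qed

text \<open>A coordinate that \<Phi> ignores may be adjoined to the base space, so integrals with an
  extra variable are covered by the measurability lemma above.\<close>

lemma random_measure_fst:
  fixes \<Phi> :: "'w \<Rightarrow> (real ^ 'd) measure"
  assumes "random_measure M \<Phi>"
  shows "random_measure (M \<Otimes>\<^sub>M N) (\<lambda>p. \<Phi> (fst p))"
  unfolding random_measure_def
proof (intro conjI ballI impI)
  fix p and B :: "(real ^ 'd) set" assume p: "p \<in> space (M \<Otimes>\<^sub>M N)"
  then have "fst p \<in> space M" by (auto simp: space_pair_measure)
  note r = random_measureD[OF assms this]
  show "sets (\<Phi> (fst p)) = sets borel" by fact
  show "emeasure (\<Phi> (fst p)) B < \<infinity>" if "B \<in> sets borel" "bounded B"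
    using r(3)[OF that] .
next
  fix B :: "(real ^ 'd) set" assume "B \<in> sets borel"
  then have "(\<lambda>\<omega>. emeasure (\<Phi> \<omega>) B) \<in> borel_measurable M" by (rule random_measure_emeasure_measurable[OF assms])
  then show "(\<lambda>p. emeasure (\<Phi> (fst p)) B) \<in> borel_measurable (M \<Otimes>\<^sub>M N)"
    by (rule measurable_compose[OF measurable_fst])
qed

section \<open>Palm calculus\<close>

locale stationary_random_measure = prob_space M
  for M :: "'w measure" and \<theta> :: "real ^ 'd \<Rightarrow> 'w \<Rightarrow> 'w" and \<Phi> :: "'w \<Rightarrow> (real ^ 'd) measure" +
  assumes flow: "stationary_flow M \<theta>"
    and rm: "random_measure M \<Phi>"
    and inv: "invariant_measure M \<theta> \<Phi>"
    and intensity_pos: "0 < intensity M \<Phi>"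
    and intensity_finite: "intensity M \<Phi> < \<infinity>"
begin

abbreviation P0 :: "'w measure" where
  "P0 \<equiv> palm M \<theta> \<Phi>"

abbreviation \<gamma> :: ennreal where
  "\<gamma> \<equiv> intensity M \<Phi>"

abbreviation inv_kernel :: "('w \<Rightarrow> real ^ 'd \<Rightarrow> (real ^ 'd) measure) \<Rightarrow> bool" where
  "inv_kernel \<equiv> invariant_kernel M \<theta>"

abbreviation square_integrable :: "('w \<Rightarrow> (real ^ 'd) measure) \<Rightarrow> bool" where
  "square_integrable \<equiv> locally_square_integrable M"

abbreviation finite_atoms :: bool where
  "finite_atoms \<equiv> (\<integral>\<^sup>+\<omega>. emeasure (\<Phi> \<omega>) {0} \<partial>P0) < \<infinity>"

abbreviation \<Psi> :: "('w \<Rightarrow> real ^ 'd \<Rightarrow> (real ^ 'd) measure) \<Rightarrow> 'w \<Rightarrow> (real ^ 'd) measure" where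
  "\<Psi> K \<equiv> kernel_measure K \<Phi>"

abbreviation pair0 :: "('w \<Rightarrow> real ^ 'd \<Rightarrow> (real ^ 'd) measure) \<Rightarrow> 'w \<Rightarrow> ((real ^ 'd) \<times> (real ^ 'd)) measure" where
  "pair0 K \<omega> \<equiv> K \<omega> 0 \<Otimes>\<^sub>M K \<omega> 0"

abbreviation displacement :: "('w \<Rightarrow> real ^ 'd \<Rightarrow> (real ^ 'd) measure) \<Rightarrow> 'w \<Rightarrow> (real ^ 'd) measure" where
  "displacement K \<omega> \<equiv> distr (pair0 K \<omega>) borel (\<lambda>p. snd p - fst p)"

lemma flow_measurable[measurable (raw)]:
  assumes [measurable]: "f \<in> measurable N M" "g \<in> borel_measurable N"
  shows "(\<lambda>y. \<theta> (g y) (f y)) \<in> measurable N M"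
proof -
  have "(\<lambda>y. (f y, g y)) \<in> measurable N (M \<Otimes>\<^sub>M borel)" by measurable
  moreover have "(\<lambda>(\<omega>, x). \<theta> x \<omega>) \<in> measurable (M \<Otimes>\<^sub>M borel) M"
    using flow unfolding stationary_flow_def by (rule conjunct1)
  ultimately show ?thesis by (auto dest: measurable_compose)
qed

lemma flow_space: "\<omega> \<in> space M \<Longrightarrow> \<theta> x \<omega> \<in> space M"
  using measurable_space[OF flow_measurable[OF measurable_ident measurable_const, of x]] by simp

lemma flow_add: "\<omega> \<in> space M \<Longrightarrow> \<theta> x (\<theta> y \<omega>) = \<theta> (x + y) \<omega>"
  and flow_0: "\<omega> \<in> space M \<Longrightarrow> \<theta> 0 \<omega> = \<omega>"
  using flow by (auto simp: stationary_flow_def)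

text \<open>Stationarity is assumed for images under the flow; the preimage under
  \<open>\<theta> s\<close> is the image under \<open>\<theta> (- s)\<close>.\<close>

lemma distr_flow: "distr M M (\<theta> s) = M"
proof (rule measure_eqI)
  have m: "\<theta> s \<in> measurable M M" by measurable
  fix A assume "A \<in> sets (distr M M (\<theta> s))"
  then have A: "A \<in> sets M" by simp
  have "\<theta> s -` A \<inter> space M = \<theta> (- s) ` A"
  proof (intro equalityI subsetI)
    fix \<omega> assume "\<omega> \<in> \<theta> s -` A \<inter> space M"
    then show "\<omega> \<in> \<theta> (- s) ` A"
      by (intro image_eqI[of _ _ "\<theta> s \<omega>"]) (auto simp: flow_add flow_0)
  next
    fix \<omega> assume "\<omega> \<in> \<theta> (- s) ` A"
    then show "\<omega> \<in> \<theta> s -` A \<inter> space M"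
      using sets.sets_into_space[OF A] by (auto simp: flow_add flow_0 flow_space subset_eq)
  qed
  then show "emeasure (distr M M (\<theta> s)) A = emeasure M A"
    using flow A by (simp add: emeasure_distr[OF m] stationary_flow_def)
qed simp

lemma \<Phi>_shift:
  assumes "\<omega> \<in> space M"
  shows "\<Phi> (\<theta> s \<omega>) = distr (\<Phi> \<omega>) borel (\<lambda>y. y - s)"
proof (rule measure_eqI)
  note r = random_measureD[OF rm assms]
  show "sets (\<Phi> (\<theta> s \<omega>)) = sets (distr (\<Phi> \<omega>) borel (\<lambda>y. y - s))"
    using random_measureD(1)[OF rm flow_space[OF assms]] by simp
  fix B assume "B \<in> sets (\<Phi> (\<theta> s \<omega>))"
  then have B: "B \<in> sets borel" using random_measureD(1)[OF rm flow_space[OF assms]] by simp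
  have "(\<lambda>y. y - s) -` B = (\<lambda>y. y + s) ` B" by (auto intro: image_eqI[of _ _ "_ - s"])
  moreover have "(\<lambda>y. y - s) \<in> measurable (\<Phi> \<omega>) borel"
    by (simp add: measurable_cong_sets[OF r(1) refl])
  ultimately show "emeasure (\<Phi> (\<theta> s \<omega>)) B = emeasure (distr (\<Phi> \<omega>) borel (\<lambda>y. y - s)) B"
    using inv assms B r by (simp add: emeasure_distr invariant_measure_def)
qed

lemma \<Phi>_atom_shift: "\<omega> \<in> space M \<Longrightarrow> emeasure (\<Phi> (\<theta> x \<omega>)) {0} = emeasure (\<Phi> \<omega>) {x}"
  using inv by (auto simp: invariant_measure_def dest!: bspec[of _ _ \<omega>] spec[of _ x] bspec[of _ _ "{0}"])

text \<open>Replace \<omega> by \<open>\<theta> s \<omega>\<close>, which preserves the law. The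
  points of \<Phi> move by \<open>- s\<close>, but the configuration
  \<open>\<theta> x \<omega>\<close> seen from a point does not change, so \<open>s\<close> survives
  only in the explicit location.\<close>

lemma campbell_shift:
  assumes [measurable]: "(\<lambda>(\<omega>, x). H \<omega> x) \<in> borel_measurable (M \<Otimes>\<^sub>M borel)"
  shows "(\<integral>\<^sup>+\<omega>. (\<integral>\<^sup>+x. H (\<theta> x \<omega>) x \<partial>\<Phi> \<omega>) \<partial>M) = (\<integral>\<^sup>+\<omega>. (\<integral>\<^sup>+x. H (\<theta> x \<omega>) (x - s) \<partial>\<Phi> \<omega>) \<partial>M)"
proof -
  let ?g = "\<lambda>\<omega>. \<integral>\<^sup>+x. H (\<theta> x \<omega>) x \<partial>\<Phi> \<omega>"
  have m: "?g \<in> borel_measurable M"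
    by (rule random_measure_nn_integral_measurable[OF rm]) measurable
  have "(\<integral>\<^sup>+\<omega>. ?g \<omega> \<partial>M) = (\<integral>\<^sup>+\<omega>. ?g \<omega> \<partial>distr M M (\<theta> s))" by (simp add: distr_flow)
  also have "\<dots> = (\<integral>\<^sup>+\<omega>. ?g (\<theta> s \<omega>) \<partial>M)" using m by (intro nn_integral_distr) measurable
  also have "\<dots> = (\<integral>\<^sup>+\<omega>. (\<integral>\<^sup>+x. H (\<theta> x \<omega>) (x - s) \<partial>\<Phi> \<omega>) \<partial>M)"
  proof (rule nn_integral_cong)
    fix \<omega> assume \<omega>[measurable]: "\<omega> \<in> space M"
    note [measurable_cong] = random_measureD(1)[OF rm \<omega>]
    note [measurable] = flow_space[OF \<omega>]
    have "?g (\<theta> s \<omega>) = (\<integral>\<^sup>+x. H (\<theta> (x - s) (\<theta> s \<omega>)) (x - s) \<partial>\<Phi> \<omega>)"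
      unfolding \<Phi>_shift[OF \<omega>] by (rule nn_integral_distr) measurable
    then show "?g (\<theta> s \<omega>) = (\<integral>\<^sup>+x. H (\<theta> x \<omega>) (x - s) \<partial>\<Phi> \<omega>)"
      using \<omega> by (simp add: flow_add)
  qed
  finally show ?thesis .
qed

text \<open>Fubini is used twice: pathwise between \<open>\<Phi> \<omega>\<close> and Lebesgue
  measure, where local finiteness supplies sigma-finiteness, and then between the law and Lebesgue
  measure.\<close>

lemma campbell_swap:
  fixes J :: "'w \<Rightarrow> real ^ 'd \<Rightarrow> real ^ 'd \<Rightarrow> ennreal"
  assumes J: "(\<lambda>p. J (fst (fst p)) (snd (fst p)) (snd p)) \<in> borel_measurable ((M \<Otimes>\<^sub>M borel) \<Otimes>\<^sub>M borel)"
  shows "(\<integral>\<^sup>+\<omega>. (\<integral>\<^sup>+x. (\<integral>\<^sup>+s. J \<omega> s x \<partial>lborel) \<partial>\<Phi> \<omega>) \<partial>M) = (\<integral>\<^sup>+s. (\<integral>\<^sup>+\<omega>. (\<integral>\<^sup>+x. J \<omega> s x \<partial>\<Phi> \<omega>) \<partial>M) \<partial>lborel)"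
proof -
  interpret L: pair_sigma_finite M "lborel :: (real ^ 'd) measure" ..
  have "(\<integral>\<^sup>+\<omega>. (\<integral>\<^sup>+x. (\<integral>\<^sup>+s. J \<omega> s x \<partial>lborel) \<partial>\<Phi> \<omega>) \<partial>M) = (\<integral>\<^sup>+\<omega>. (\<integral>\<^sup>+s. (\<integral>\<^sup>+x. J \<omega> s x \<partial>\<Phi> \<omega>) \<partial>lborel) \<partial>M)"
  proof (rule nn_integral_cong)
    fix \<omega> assume \<omega>[measurable]: "\<omega> \<in> space M"
    note [measurable_cong] = random_measureD(1)[OF rm \<omega>]
    interpret P: pair_sigma_finite "\<Phi> \<omega>" "lborel :: (real ^ 'd) measure"
      by (intro pair_sigma_finite.intro random_measure_sigma_finite[OF rm \<omega>]) unfold_locales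
    have "(\<lambda>q. ((\<omega>, snd q), fst q)) \<in> measurable (\<Phi> \<omega> \<Otimes>\<^sub>M lborel) ((M \<Otimes>\<^sub>M borel) \<Otimes>\<^sub>M borel)"
      by measurable
    from measurable_compose[OF this J]
    have "(\<lambda>(x, s). J \<omega> s x) \<in> borel_measurable (\<Phi> \<omega> \<Otimes>\<^sub>M lborel)" by (simp add: case_prod_beta)
    from P.Fubini'[OF this]
    show "(\<integral>\<^sup>+x. (\<integral>\<^sup>+s. J \<omega> s x \<partial>lborel) \<partial>\<Phi> \<omega>) = (\<integral>\<^sup>+s. (\<integral>\<^sup>+x. J \<omega> s x \<partial>\<Phi> \<omega>) \<partial>lborel)"
      by simp
  qed
  also have "\<dots> = (\<integral>\<^sup>+s. (\<integral>\<^sup>+\<omega>. (\<integral>\<^sup>+x. J \<omega> s x \<partial>\<Phi> \<omega>) \<partial>M) \<partial>lborel)"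
  proof (rule L.Fubini'[symmetric])
    have "(\<lambda>p. \<integral>\<^sup>+x. J (fst p) (snd p) x \<partial>\<Phi> (fst p)) \<in> borel_measurable (M \<Otimes>\<^sub>M borel)"
      using J by (intro random_measure_nn_integral_measurable[OF random_measure_fst[OF rm]]) (simp add: case_prod_beta)
    then show "(\<lambda>(\<omega>, s). \<integral>\<^sup>+x. J \<omega> s x \<partial>\<Phi> \<omega>) \<in> borel_measurable (M \<Otimes>\<^sub>M lborel)"
      by (simp add: case_prod_beta)
  qed
  finally show ?thesis .
qed

text \<open>The series can be interchanged with both integrals, so the defining set function is
  countably additive and \<open>measure_of\<close> evaluates to it.\<close>

lemma emeasure_palm:
  assumes A: "A \<in> sets M"
  shows "emeasure P0 A = (\<integral>\<^sup>+\<omega>. (\<integral>\<^sup>+x\<in>unit_cube. indicator A (\<theta> x \<omega>) \<partial>\<Phi> \<omega>) \<partial>M) / \<gamma>"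
  unfolding palm_def
proof (rule emeasure_measure_of_sigma[OF _ _ _ A])
  let ?\<mu> = "\<lambda>A. (\<integral>\<^sup>+\<omega>. (\<integral>\<^sup>+x\<in>unit_cube. indicator A (\<theta> x \<omega>) \<partial>\<Phi> \<omega>) \<partial>M) / \<gamma>"
  show "sigma_algebra (space M) (sets M)" ..
  show "positive (sets M) ?\<mu>" by (simp add: positive_def)
  show "countably_additive (sets M) ?\<mu>"
  proof (rule countably_additiveI)
    fix A :: "nat \<Rightarrow> _" assume A: "range A \<subseteq> sets M" "disjoint_family A"
    have [measurable]: "A i \<in> sets M" for i using A by auto
    have "(\<integral>\<^sup>+\<omega>. (\<integral>\<^sup>+x\<in>unit_cube. indicator (\<Union>i. A i) (\<theta> x \<omega>) \<partial>\<Phi> \<omega>) \<partial>M)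
      = (\<integral>\<^sup>+\<omega>. (\<Sum>i. \<integral>\<^sup>+x\<in>unit_cube. indicator (A i) (\<theta> x \<omega>) \<partial>\<Phi> \<omega>) \<partial>M)"
    proof (rule nn_integral_cong)
      fix \<omega> assume \<omega>[measurable]: "\<omega> \<in> space M"
      note [measurable_cong] = random_measureD(1)[OF rm \<omega>]
      have "(\<integral>\<^sup>+x\<in>unit_cube. indicator (\<Union>i. A i) (\<theta> x \<omega>) \<partial>\<Phi> \<omega>)
        = (\<integral>\<^sup>+x. (\<Sum>i. indicator (A i) (\<theta> x \<omega>) * indicator unit_cube x) \<partial>\<Phi> \<omega>)"
        using suminf_indicator[OF A(2)] by (intro nn_integral_cong) simp
      also have "\<dots> = (\<Sum>i. \<integral>\<^sup>+x\<in>unit_cube. indicator (A i) (\<theta> x \<omega>) \<partial>\<Phi> \<omega>)"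
        by (rule nn_integral_suminf) measurable
      finally show "(\<integral>\<^sup>+x\<in>unit_cube. indicator (\<Union>i. A i) (\<theta> x \<omega>) \<partial>\<Phi> \<omega>)
        = (\<Sum>i. \<integral>\<^sup>+x\<in>unit_cube. indicator (A i) (\<theta> x \<omega>) \<partial>\<Phi> \<omega>)" .
    qed
    also have "\<dots> = (\<Sum>i. \<integral>\<^sup>+\<omega>. (\<integral>\<^sup>+x\<in>unit_cube. indicator (A i) (\<theta> x \<omega>) \<partial>\<Phi> \<omega>) \<partial>M)"
      by (intro nn_integral_suminf random_measure_nn_integral_measurable[OF rm]) measurable
    finally show "(\<Sum>i. ?\<mu> (A i)) = ?\<mu> (\<Union>i. A i)" by simp
  qed
qed

lemma sets_palm[simp, measurable_cong]: "sets P0 = sets M"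
  and space_palm[simp]: "space P0 = space M"
  by (auto simp: palm_def sets.sets_measure_of_eq sets.space_measure_of_eq)

text \<open>Keeping \<gamma> on the left clears the normalisation of the Palm measure, which is
  legitimate as \<gamma> is positive and finite.\<close>

lemma nn_integral_palm:
  assumes "F \<in> borel_measurable M"
  shows "\<gamma> * (\<integral>\<^sup>+\<omega>. F \<omega> \<partial>P0) = (\<integral>\<^sup>+\<omega>. (\<integral>\<^sup>+x\<in>unit_cube. F (\<theta> x \<omega>) \<partial>\<Phi> \<omega>) \<partial>M)"
proof -
  let ?C = "\<lambda>F. \<integral>\<^sup>+\<omega>. (\<integral>\<^sup>+x\<in>unit_cube. F (\<theta> x \<omega>) \<partial>\<Phi> \<omega>) \<partial>M"
  have m: "(\<lambda>\<omega>. \<integral>\<^sup>+x\<in>unit_cube. F (\<theta> x \<omega>) \<partial>\<Phi> \<omega>) \<in> borel_measurable M"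
    if [measurable]: "F \<in> borel_measurable M" for F
    by (rule random_measure_nn_integral_measurable[OF rm]) measurable
  have m': "(\<lambda>x. F (\<theta> x \<omega>) * indicator unit_cube x) \<in> borel_measurable (\<Phi> \<omega>)"
    if [measurable]: "F \<in> borel_measurable M" and \<omega>[measurable]: "\<omega> \<in> space M" for F :: "'w \<Rightarrow> ennreal" and \<omega>
  proof -
    note [measurable_cong] = random_measureD(1)[OF rm \<omega>]
    show ?thesis by measurable
  qed
  have mp: "measurable P0 = (measurable M :: _ \<Rightarrow> ('w \<Rightarrow> ennreal) set)"
    by (auto simp: fun_eq_iff measurable_def)
  show ?thesis using assms
  proof (induction rule: borel_measurable_induct)
    case (cong f g)
    then have "(\<integral>\<^sup>+\<omega>. f \<omega> \<partial>P0) = (\<integral>\<^sup>+\<omega>. g \<omega> \<partial>P0)"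
      by (intro nn_integral_cong) simp
    moreover have "?C f = ?C g"
      using cong by (intro nn_integral_cong) (simp add: flow_space)
    ultimately show ?case using cong by simp
  next
    case (set A)
    then show ?case
      using intensity_pos intensity_finite
      by (simp add: emeasure_palm ennreal_times_divide mult.commute[of "\<gamma>"] mult_divide_eq_ennreal del: ennreal_suminf_divide)
  next
    case (mult u c)
    have "?C (\<lambda>x. c * u x) = c * ?C u"
      by (subst nn_integral_cmult[OF m[OF mult(2)], symmetric])
       (intro nn_integral_cong, simp add: nn_integral_cmult[OF m'[OF mult(2)], symmetric] mult.assoc)
    then show ?case using mult by (simp add: nn_integral_cmult mp mult.left_commute)
  next
    case (add u v)
    have "?C (\<lambda>x. u x + v x) = ?C u + ?C v"
      using add by (subst nn_integral_add[OF m m, symmetric]; (intro nn_integral_cong)?)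
       (auto simp: nn_integral_add[OF m' m', symmetric] distrib_right)
    then show ?case using add by (subst nn_integral_add) (auto simp: mp distrib_left add.commute)
  next
    case (seq U)
    have e: "(\<Squnion> range U) x = (SUP i. U i x)" for x by (simp add: image_comp)
    have "(\<integral>\<^sup>+\<omega>. (SUP i. U i \<omega>) \<partial>P0) = (SUP i. \<integral>\<^sup>+\<omega>. U i \<omega> \<partial>P0)"
      using seq by (intro nn_integral_monotone_convergence_SUP) (auto simp: mp)
    moreover have "?C (\<lambda>x. SUP i. U i x) = (SUP i. ?C (U i))"
    proof -
      have i: "incseq (\<lambda>i x. U i (\<theta> x \<omega>) * indicator unit_cube x)" for \<omega>
        using seq(3) by (auto simp: incseq_def le_fun_def intro!: mult_right_mono)
      have "?C (\<lambda>x. SUP i. U i x) = (\<integral>\<^sup>+\<omega>. (SUP i. (\<integral>\<^sup>+x\<in>unit_cube. U i (\<theta> x \<omega>) \<partial>\<Phi> \<omega>)) \<partial>M)"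
        using seq(1) i by (intro nn_integral_cong, subst nn_integral_monotone_convergence_SUP[symmetric])
          (auto simp: SUP_mult_right_ennreal m')
      also have "\<dots> = (SUP i. ?C (U i))"
        using seq(1,3) by (intro nn_integral_monotone_convergence_SUP m)
          (auto simp: incseq_def le_fun_def intro!: nn_integral_mono mult_right_mono)
      finally show ?thesis .
    qed
    ultimately show ?case using seq(5) unfolding e by (simp add: SUP_mult_left_ennreal)
  qed
qed

lemma emeasure_palm_space: "emeasure P0 (space M) = 1"
proof -
  have "(\<integral>\<^sup>+\<omega>. (\<integral>\<^sup>+x\<in>unit_cube. indicator (space M) (\<theta> x \<omega>) \<partial>\<Phi> \<omega>) \<partial>M) = \<gamma>"
    unfolding intensity_def
  proof (rule nn_integral_cong)
    fix \<omega> assume \<omega>: "\<omega> \<in> space M"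
    then show "(\<integral>\<^sup>+x\<in>unit_cube. indicator (space M) (\<theta> x \<omega>) \<partial>\<Phi> \<omega>) = emeasure (\<Phi> \<omega>) unit_cube"
      using random_measureD[OF rm \<omega>] by (simp add: flow_space)
  qed
  then show ?thesis
    using intensity_pos intensity_finite by (simp add: emeasure_palm ennreal_divide_self)
qed

lemma finite_measure_palm: "finite_measure P0"
  by (rule finite_measureI) (simp add: emeasure_palm_space)

lemma emeasure_lborel_unit_cube: "emeasure lborel (unit_cube :: (real ^ 'd) set) = 1"
  by (subst emeasure_lborel_cbox_eq) (auto simp: Basis_vec_def inner_axis intro!: prod.neutral)

text \<open>Averaging over a shift \<open>s\<close> in a cube of volume one introduces Lebesgue
  measure. With t = x + s the cube constraint passes from \<open>s\<close> to \<open>x\<close>,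
  where it is the cube in the definition of the Palm measure.\<close>

lemma refined_campbell:
  assumes G[measurable]: "(\<lambda>(\<omega>, x). G \<omega> x) \<in> borel_measurable (M \<Otimes>\<^sub>M borel)"
  shows "(\<integral>\<^sup>+\<omega>. (\<integral>\<^sup>+x. G (\<theta> x \<omega>) x \<partial>\<Phi> \<omega>) \<partial>M) = \<gamma> * (\<integral>\<^sup>+\<omega>. (\<integral>\<^sup>+t. G \<omega> t \<partial>lborel) \<partial>P0)"
proof -
  let ?c = "unit_cube :: (real ^ 'd) set"
  interpret palm: finite_measure "P0" by (rule finite_measure_palm)
  interpret P: pair_sigma_finite "P0" "lborel :: (real ^ 'd) measure" ..
  have "(\<integral>\<^sup>+\<omega>. (\<integral>\<^sup>+x. G (\<theta> x \<omega>) x \<partial>\<Phi> \<omega>) \<partial>M) = (\<integral>\<^sup>+s. indicator ?c s * (\<integral>\<^sup>+\<omega>. (\<integral>\<^sup>+x. G (\<theta> x \<omega>) x \<partial>\<Phi> \<omega>) \<partial>M) \<partial>lborel)"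
    by (subst nn_integral_multc) (auto simp: emeasure_lborel_unit_cube)
  also have "\<dots> = (\<integral>\<^sup>+s. (\<integral>\<^sup>+\<omega>. (\<integral>\<^sup>+x. indicator ?c s * G (\<theta> x \<omega>) (x + s) \<partial>\<Phi> \<omega>) \<partial>M) \<partial>lborel)"
  proof (rule nn_integral_cong)
    fix s :: "real ^ 'd"
    have "(\<integral>\<^sup>+\<omega>. (\<integral>\<^sup>+x. indicator ?c s * G (\<theta> x \<omega>) x \<partial>\<Phi> \<omega>) \<partial>M)
       = (\<integral>\<^sup>+\<omega>. (\<integral>\<^sup>+x. indicator ?c s * G (\<theta> x \<omega>) (x - (- s)) \<partial>\<Phi> \<omega>) \<partial>M)"
      by (rule campbell_shift) measurable
    then show "indicator ?c s * (\<integral>\<^sup>+\<omega>. (\<integral>\<^sup>+x. G (\<theta> x \<omega>) x \<partial>\<Phi> \<omega>) \<partial>M) = (\<integral>\<^sup>+\<omega>. (\<integral>\<^sup>+x. indicator ?c s * G (\<theta> x \<omega>) (x + s) \<partial>\<Phi> \<omega>) \<partial>M)"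
      by (cases "s \<in> ?c") auto
  qed
  also have "\<dots> = (\<integral>\<^sup>+\<omega>. (\<integral>\<^sup>+x. (\<integral>\<^sup>+s. indicator ?c s * G (\<theta> x \<omega>) (x + s) \<partial>lborel) \<partial>\<Phi> \<omega>) \<partial>M)"
    by (rule campbell_swap[symmetric]) measurable
  also have "\<dots> = (\<integral>\<^sup>+\<omega>. (\<integral>\<^sup>+x. (\<integral>\<^sup>+t. indicator ?c (t - x) * G (\<theta> x \<omega>) t \<partial>lborel) \<partial>\<Phi> \<omega>) \<partial>M)"
  proof (rule nn_integral_cong, rule nn_integral_cong)
    fix \<omega> and x :: "real ^ 'd" assume [measurable]: "\<omega> \<in> space M"
    show "(\<integral>\<^sup>+s. indicator ?c s * G (\<theta> x \<omega>) (x + s) \<partial>lborel) = (\<integral>\<^sup>+t. indicator ?c (t - x) * G (\<theta> x \<omega>) t \<partial>lborel)"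
      by (subst (2) lborel_distr_plus[of x, symmetric], subst nn_integral_distr) auto
  qed
  also have "\<dots> = (\<integral>\<^sup>+t. (\<integral>\<^sup>+\<omega>. (\<integral>\<^sup>+x. indicator ?c (t - x) * G (\<theta> x \<omega>) t \<partial>\<Phi> \<omega>) \<partial>M) \<partial>lborel)"
    by (rule campbell_swap) measurable
  also have "\<dots> = (\<integral>\<^sup>+t. (\<integral>\<^sup>+\<omega>. (\<integral>\<^sup>+x\<in>?c. G (\<theta> x \<omega>) t \<partial>\<Phi> \<omega>) \<partial>M) \<partial>lborel)"
  proof (rule nn_integral_cong)
    fix t :: "real ^ 'd"
    \<comment> \<open>Shifting by \<open>1 - t\<close> turns \<open>t - x\<close> into
      \<open>1 - x\<close>, and the unit cube is symmetric under this reflection.\<close>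
    have "(\<integral>\<^sup>+\<omega>. (\<integral>\<^sup>+x. indicator ?c (t - x) * G (\<theta> x \<omega>) t \<partial>\<Phi> \<omega>) \<partial>M)
      = (\<integral>\<^sup>+\<omega>. (\<integral>\<^sup>+x. indicator ?c (t - (x - (1 - t))) * G (\<theta> x \<omega>) t \<partial>\<Phi> \<omega>) \<partial>M)"
      by (rule campbell_shift) measurable
    moreover have "indicator ?c (t - (x - (1 - t))) = (indicator ?c x :: ennreal)" for x
      by (auto simp: indicator_def mem_box_cart)
    ultimately show "(\<integral>\<^sup>+\<omega>. (\<integral>\<^sup>+x. indicator ?c (t - x) * G (\<theta> x \<omega>) t \<partial>\<Phi> \<omega>) \<partial>M) = (\<integral>\<^sup>+\<omega>. (\<integral>\<^sup>+x\<in>?c. G (\<theta> x \<omega>) t \<partial>\<Phi> \<omega>) \<partial>M)"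
      by (simp add: mult.commute)
  qed
  also have "\<dots> = (\<integral>\<^sup>+t. \<gamma> * (\<integral>\<^sup>+\<omega>. G \<omega> t \<partial>P0) \<partial>lborel)"
    by (intro nn_integral_cong nn_integral_palm[symmetric]) measurable
  also have "\<dots> = \<gamma> * (\<integral>\<^sup>+t. (\<integral>\<^sup>+\<omega>. G \<omega> t \<partial>P0) \<partial>lborel)"
    by (rule nn_integral_cmult) measurable
  also have "(\<integral>\<^sup>+t. (\<integral>\<^sup>+\<omega>. G \<omega> t \<partial>P0) \<partial>lborel) = (\<integral>\<^sup>+\<omega>. (\<integral>\<^sup>+t. G \<omega> t \<partial>lborel) \<partial>P0)"
    by (rule P.Fubini') measurable
  finally show ?thesis .
qed

end

section \<open>Second moments of transported measures\<close>

text \<open>An enumeration may repeat points, so each point is charged to its least index; the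
  series of indicators then reduces to that single term.\<close>

lemma nn_integral_countable_support:
  fixes P :: "'a::{second_countable_topology, t2_space} measure" and x :: "nat \<Rightarrow> 'a"
  assumes P: "sets P = sets borel" and null: "emeasure P (- range x) = 0"
    and f: "f \<in> borel_measurable borel"
  shows "(\<integral>\<^sup>+y. f y \<partial>P) = (\<Sum>n. (if \<exists>m<n. x m = x n then 0 else emeasure P {x n}) * f (x n))"
proof -
  note [measurable_cong] = P
  note [measurable] = f
  have sp: "space P = UNIV" using sets_eq_imp_space_eq[OF P] by simp
  have r: "range x \<in> sets borel"
    by (auto intro: sets.countable)
  define c where "c n \<longleftrightarrow> (\<exists>m<n. x m = x n)" for n
  let ?t = "\<lambda>n y. (if c n then 0 else f (x n)) * indicator {x n} y"
  have "(\<integral>\<^sup>+y. f y \<partial>P) = (\<integral>\<^sup>+y. (\<Sum>n. ?t n y) \<partial>P)"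
  proof (rule nn_integral_cong_AE)
    have "AE y in P. y \<in> range x"
      using null r P sp by (intro AE_I[where N="- range x"]) auto
    then show "AE y in P. f y = (\<Sum>n. ?t n y)"
    proof eventually_elim
      case (elim y)
      define n0 where "n0 = (LEAST n. x n = y)"
      obtain k where k: "x k = y" using elim by blast
      have n0: "x n0 = y" unfolding n0_def by (rule LeastI[of _ k]) (rule k)
      have first: "x m \<noteq> y" if "m < n0" for m using not_less_Least[OF that[unfolded n0_def]] .
      have uniq: "n = n0" if "x n = y" "\<not> c n" for n
      proof (rule antisym)
        show "n0 \<le> n" unfolding n0_def by (rule Least_le) (rule that(1))
        show "n \<le> n0" using that n0 unfolding c_def by (metis not_le)
      qed
      have nc: "\<not> c n0" using first n0 unfolding c_def by metis
      have "?t n y = (if n = n0 then f y else 0)" for n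
      proof (cases "n = n0")
        case True
        show ?thesis unfolding True using nc n0 by simp
      next
        case False
        then have "x n \<noteq> y \<or> c n" using uniq by blast
        then show ?thesis using False by (elim disjE) simp_all
      qed
      then show ?case by (simp add: sums_unique[OF sums_single, symmetric])
    qed
  qed
  also have "\<dots> = (\<Sum>n. \<integral>\<^sup>+y. ?t n y \<partial>P)"
    by (rule nn_integral_suminf) measurable
  also have "\<dots> = (\<Sum>n. (if \<exists>m<n. x m = x n then 0 else emeasure P {x n}) * f (x n))"
    unfolding c_def[symmetric] using P by (intro suminf_cong) (auto simp: nn_integral_cmult mult.commute)
  finally show ?thesis .
qed

text \<open>The discrete representation and the sequence \<open>x\<close> need not be related. But
  any represented point of positive weight is an atom, hence listed by \<open>x\<close>, and no mass
  is left outside.\<close>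

lemma purely_discrete_null:
  fixes \<Phi> :: "'w \<Rightarrow> (real ^ 'd) measure" and x :: "nat \<Rightarrow> real ^ 'd"
  assumes "purely_discrete M \<Phi>" and \<omega>: "\<omega> \<in> space M"
    and atoms: "\<And>y. emeasure (\<Phi> \<omega>) {y} > 0 \<Longrightarrow> \<exists>n. x n = y"
  shows "emeasure (\<Phi> \<omega>) (- range x) = 0"
proof -
  obtain Y X where YX: "\<And>B. B \<in> sets borel \<Longrightarrow> emeasure (\<Phi> \<omega>) B = (\<Sum>n. ennreal (Y n \<omega>) * indicator B (X n \<omega> :: real ^ 'd))"
    using assms(1) \<omega> unfolding purely_discrete_def by blast
  have r: "range x \<in> sets borel" by (auto intro: sets.countable)
  have z: "ennreal (Y n \<omega>) * indicator (- range x) (X n \<omega>) = 0" for n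
  proof (cases "ennreal (Y n \<omega>) = 0")
    case False
    have "ennreal (Y n \<omega>) * indicator {X n \<omega>} (X n \<omega>) \<le> (\<Sum>n'. ennreal (Y n' \<omega>) * indicator {X n \<omega>} (X n' \<omega>))"
      using sum_le_suminf[of "\<lambda>n'. ennreal (Y n' \<omega>) * indicator {X n \<omega>} (X n' \<omega>)" "{n}"] by simp
    then have "emeasure (\<Phi> \<omega>) {X n \<omega>} > 0"
      using False by (simp add: YX zero_less_iff_neq_zero) (metis le_zero_eq)
    then obtain k where "X n \<omega> = x k" using atoms by metis
    then show ?thesis by simp
  qed simp
  have "emeasure (\<Phi> \<omega>) (- range x) = (\<Sum>n. ennreal (Y n \<omega>) * indicator (- range x) (X n \<omega>))"
    using r by (intro YX) auto
  then show ?thesis unfolding z by simp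
qed

text \<open>As \<open>c\<close> is measurable with respect to \<open>F\<close>, the function
  \<open>g\<close> may be replaced by its conditional expectation, and the identity with
  \<open>l\<close> matters only where \<open>c\<close> is positive. This is why it suffices to have
  the product condition on the event of two distinct atoms.\<close>

lemma nn_integral_cond_exp_weighted:
  assumes "sigma_finite_subalgebra M F"
    and [measurable]: "c \<in> borel_measurable F" "g \<in> borel_measurable M"
    and g: "\<And>\<omega>. \<omega> \<in> space M \<Longrightarrow> 0 \<le> g \<omega>" "\<And>\<omega>. \<omega> \<in> space M \<Longrightarrow> g \<omega> \<le> 1"
    and eq: "AE \<omega> in M. c \<omega> > 0 \<longrightarrow> real_cond_exp M F g \<omega> = l \<omega>"
  shows "(\<integral>\<^sup>+\<omega>. c \<omega> * ennreal (g \<omega>) \<partial>M) = (\<integral>\<^sup>+\<omega>. c \<omega> * ennreal (l \<omega>) \<partial>M)"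
proof -
  interpret sigma_finite_subalgebra M F by fact
  let ?n = "nn_cond_exp M F"
  \<comment> \<open>\<open>real_cond_exp\<close> is a difference of two \<open>enn2real\<close>
    values. The bounds 0 <= g <= 1 make the first conditional expectation finite and the second
    zero, so it agrees with the nonnegative version.\<close>
  have "AE \<omega> in M. ?n (\<lambda>\<omega>. ennreal (g \<omega>)) \<omega> \<le> ?n (\<lambda>_. 1) \<omega>"
    using g by (intro nn_cond_exp_mono) (auto simp: ennreal_le_1)
  moreover have "AE \<omega> in M. 1 = ?n (\<lambda>_. 1) \<omega>" by (rule nn_cond_exp_F_meas) simp
  moreover have "AE \<omega> in M. ?n (\<lambda>\<omega>. ennreal (- g \<omega>)) \<omega> \<le> ?n (\<lambda>_. 0) \<omega>"
    using g by (intro nn_cond_exp_mono) (auto simp: ennreal_neg)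
  moreover have "AE \<omega> in M. 0 = ?n (\<lambda>_. 0) \<omega>" by (rule nn_cond_exp_F_meas) simp
  ultimately have "AE \<omega> in M. c \<omega> * ?n (\<lambda>\<omega>. ennreal (g \<omega>)) \<omega> = c \<omega> * ennreal (l \<omega>)"
    using eq
  proof eventually_elim
    case (elim \<omega>)
    have "?n (\<lambda>\<omega>. ennreal (g \<omega>)) \<omega> < \<top>"
      using elim(1,2) by (metis ennreal_one_less_top order.strict_trans1)
    then have "ennreal (real_cond_exp M F g \<omega>) = ?n (\<lambda>\<omega>. ennreal (g \<omega>)) \<omega>"
      using elim(3,4) by (simp add: real_cond_exp_def)
    then show ?case using elim(5) by (cases "c \<omega> = 0") (auto simp: zero_less_iff_neq_zero)
  qed
  then have "(\<integral>\<^sup>+\<omega>. c \<omega> * ?n (\<lambda>\<omega>. ennreal (g \<omega>)) \<omega> \<partial>M) = (\<integral>\<^sup>+\<omega>. c \<omega> * ennreal (l \<omega>) \<partial>M)"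
    by (rule nn_integral_cong_AE)
  then show ?thesis by (simp add: nn_cond_exp_intg)
qed

lemma suminf_split_diagonal:
  fixes a :: "nat \<Rightarrow> nat \<Rightarrow> ennreal"
  shows "(\<Sum>m. \<Sum>n. a m n) = (\<Sum>m. a m m) + (\<Sum>m. \<Sum>n. if m = n then 0 else a m n)"
proof -
  have "(\<Sum>n. a m n) = a m m + (\<Sum>n. if m = n then 0 else a m n)" for m
  proof -
    have "(\<Sum>n. a m n) = (\<Sum>n. (if n = m then a m n else 0) + (if m = n then 0 else a m n))"
      by (intro suminf_cong) auto
    also have "\<dots> = (\<Sum>n. if n = m then a m n else 0) + (\<Sum>n. if m = n then 0 else a m n)"
      by (rule suminf_add[symmetric]) auto
    also have "(\<Sum>n. if n = m then a m n else 0) = a m m"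
      by (rule sums_unique[OF sums_single, symmetric])
    finally show ?thesis .
  qed
  then show ?thesis by (simp add: suminf_add[symmetric])
qed

lemma nn_integral_indicator_translate:
  fixes A :: "'a::euclidean_space set"
  assumes [measurable]: "A \<in> sets borel"
  shows "(\<integral>\<^sup>+t. indicator A (y + t) \<partial>lborel) = emeasure lborel A"
proof -
  have "(\<integral>\<^sup>+t. indicator A (y + t) \<partial>lborel) = (\<integral>\<^sup>+t. indicator A t \<partial>distr lborel borel ((+) y))"
    by (rule nn_integral_distr[symmetric]) measurable
  then show ?thesis by (simp add: lborel_distr_plus)
qed

lemma displacement_set_measurable:
  fixes A B :: "(real ^ 'd) set"
  assumes [measurable]: "A \<in> sets borel" "B \<in> sets borel"
  shows "{(x, y). x \<in> A \<and> y - x \<in> B} \<in> sets (borel \<Otimes>\<^sub>M borel)"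
proof -
  have "{(x, y). x \<in> A \<and> y - x \<in> B} = {p \<in> space (borel \<Otimes>\<^sub>M borel). fst p \<in> A \<and> snd p - fst p \<in> B}"
    by (auto simp: space_pair_measure)
  then show ?thesis by simp
qed

section \<open>Transported measures: intensity and displacement law\<close>

context stationary_random_measure
begin

lemma kernel_measurable:
  assumes "inv_kernel K" and [measurable]: "f \<in> measurable N M" "g \<in> borel_measurable N"
  shows "(\<lambda>y. K (f y) (g y)) \<in> measurable N (prob_algebra borel)"
proof -
  have "(\<lambda>y. (f y, g y)) \<in> measurable N (M \<Otimes>\<^sub>M borel)" by measurable
  moreover have "(\<lambda>(\<omega>, x). K \<omega> x) \<in> measurable (M \<Otimes>\<^sub>M borel) (prob_algebra borel)"
    using assms(1) unfolding invariant_kernel_def by (rule conjunct1)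
  ultimately show ?thesis by (auto dest: measurable_compose)
qed

lemma kernel_space:
  assumes "inv_kernel K" "\<omega> \<in> space M"
  shows "prob_space (K \<omega> x)" "sets (K \<omega> x) = sets borel" "space (K \<omega> x) = UNIV"
proof -
  show "prob_space (K \<omega> x)" and s: "sets (K \<omega> x) = sets borel"
    using measurable_space[OF invariant_kernel_section[OF assms], of x] by (auto simp: space_prob_algebra)
  show "space (K \<omega> x) = UNIV" using sets_eq_imp_space_eq[OF s] by simp
qed

lemma kernel_pair_measurable:
  assumes K: "inv_kernel K" and f: "f \<in> measurable N M" "g \<in> borel_measurable N" "h \<in> borel_measurable N"
  shows "(\<lambda>y. K (f y) (g y) \<Otimes>\<^sub>M K (f y) (h y)) \<in> measurable N (subprob_algebra (borel \<Otimes>\<^sub>M borel))"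
  by (intro measurable_prob_algebraD measurable_pair_prob kernel_measurable[OF K] f)

lemma kernel_pair_emeasure_measurable:
  assumes K: "inv_kernel K" and f: "f \<in> measurable N M" "g \<in> borel_measurable N" "h \<in> borel_measurable N"
    and C: "C \<in> sets (borel \<Otimes>\<^sub>M borel)"
  shows "(\<lambda>y. emeasure (K (f y) (g y) \<Otimes>\<^sub>M K (f y) (h y)) C) \<in> borel_measurable N"
  by (rule measurable_compose[OF kernel_pair_measurable[OF K f] measurable_emeasure_subprob_algebra[OF C]])

lemma kernel_shift:
  assumes K: "inv_kernel K" and \<omega>: "\<omega> \<in> space M"
  shows "K \<omega> x = distr (K (\<theta> x \<omega>) 0) borel (\<lambda>y. y + x)"
proof (rule measure_eqI)
  note k = kernel_space[OF K \<omega>, of x] and k0 = kernel_space[OF K flow_space[OF \<omega>, of x], of 0]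
  show "sets (K \<omega> x) = sets (distr (K (\<theta> x \<omega>) 0) borel (\<lambda>y. y + x))" using k by simp
  fix B assume "B \<in> sets (K \<omega> x)"
  then have B[measurable]: "B \<in> sets borel" using k by simp
  have m: "(\<lambda>y. y + x) \<in> borel_measurable (K (\<theta> x \<omega>) 0)"
    unfolding measurable_cong_sets[OF k0(2) refl] by measurable
  have "(\<lambda>y. y + x) -` B \<in> sets borel"
    using measurable_sets[OF m B] k0 by simp
  then have "emeasure (K \<omega> x) ((\<lambda>y. y + x) ` ((\<lambda>y. y + x) -` B)) = emeasure (K (\<theta> x \<omega>) 0) ((\<lambda>y. y + x) -` B)"
    using K \<omega> unfolding invariant_kernel_def by blast
  moreover have "(\<lambda>y. y + x) ` ((\<lambda>y. y + x) -` B) = B"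
    by (auto intro: image_eqI[of _ _ "_ - x"])
  ultimately show "emeasure (K \<omega> x) B = emeasure (distr (K (\<theta> x \<omega>) 0) borel (\<lambda>y. y + x)) B"
    using m B k0 by (simp add: emeasure_distr)
qed

text \<open>Refined Campbell replaces the points of \<Phi> by a Lebesgue variable \<open>t\<close>.
  Translation invariance then absorbs the random displacement, so transport preserves the
  intensity.\<close>

lemma kernel_measure_intensity:
  assumes K: "inv_kernel K" and B[measurable]: "B \<in> sets borel"
  shows "(\<integral>\<^sup>+\<omega>. emeasure (\<Psi> K \<omega>) B \<partial>M) = \<gamma> * emeasure lborel B"
proof -
  interpret palm: finite_measure "P0" by (rule finite_measure_palm)
  let ?G = "\<lambda>\<omega> x. \<integral>\<^sup>+y. indicator B (y + x) \<partial>K \<omega> 0 :: ennreal"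
  have "(\<lambda>p. ?G (fst p) (snd p)) \<in> borel_measurable (M \<Otimes>\<^sub>M borel)"
  proof (rule nn_integral_measurable_subprob_algebra2)
    show "(\<lambda>p. K (fst p) 0) \<in> measurable (M \<Otimes>\<^sub>M borel) (subprob_algebra borel)"
      by (rule measurable_prob_algebraD[OF kernel_measurable[OF K]]) measurable
  qed measurable
  then have G: "(\<lambda>(\<omega>, x). ?G \<omega> x) \<in> borel_measurable (M \<Otimes>\<^sub>M borel)" by (simp add: case_prod_beta)
  have "(\<integral>\<^sup>+\<omega>. emeasure (\<Psi> K \<omega>) B \<partial>M) = (\<integral>\<^sup>+\<omega>. (\<integral>\<^sup>+x. ?G (\<theta> x \<omega>) x \<partial>\<Phi> \<omega>) \<partial>M)"
  proof (rule nn_integral_cong)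
    fix \<omega> assume \<omega>: "\<omega> \<in> space M"
    have "emeasure (K \<omega> x) B = ?G (\<theta> x \<omega>) x" for x
    proof -
      note [measurable_cong] = kernel_space(2)[OF K flow_space[OF \<omega>]]
      have "emeasure (K \<omega> x) B = (\<integral>\<^sup>+y. indicator B y \<partial>distr (K (\<theta> x \<omega>) 0) borel (\<lambda>y. y + x))"
        unfolding kernel_shift[OF K \<omega>, of x] by simp
      also have "\<dots> = ?G (\<theta> x \<omega>) x" by (rule nn_integral_distr) measurable
      finally show ?thesis .
    qed
    then show "emeasure (\<Psi> K \<omega>) B = (\<integral>\<^sup>+x. ?G (\<theta> x \<omega>) x \<partial>\<Phi> \<omega>)"
      by (simp add: emeasure_kernel_measure[OF rm K \<omega> B])
  qed
  also have "\<dots> = \<gamma> * (\<integral>\<^sup>+\<omega>. (\<integral>\<^sup>+t. ?G \<omega> t \<partial>lborel) \<partial>P0)"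
    by (rule refined_campbell[OF G])
  also have "(\<integral>\<^sup>+\<omega>. (\<integral>\<^sup>+t. ?G \<omega> t \<partial>lborel) \<partial>P0) = (\<integral>\<^sup>+\<omega>. emeasure lborel B \<partial>P0)"
  proof (rule nn_integral_cong)
    fix \<omega> assume "\<omega> \<in> space P0"
    then have \<omega>: "\<omega> \<in> space M" by simp
    note [measurable_cong] = kernel_space(2)[OF K \<omega>]
    interpret k: prob_space "K \<omega> 0" by (rule kernel_space[OF K \<omega>])
    interpret k: pair_sigma_finite "K \<omega> 0" "lborel :: (real ^ 'd) measure" ..
    have "(\<integral>\<^sup>+t. ?G \<omega> t \<partial>lborel) = (\<integral>\<^sup>+y. (\<integral>\<^sup>+t. indicator B (y + t) \<partial>lborel) \<partial>K \<omega> 0)"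
      by (rule k.Fubini') measurable
    also have "\<dots> = (\<integral>\<^sup>+y. emeasure lborel B \<partial>K \<omega> 0)"
    proof (rule nn_integral_cong)
      fix y :: "real ^ 'd"
      show "(\<integral>\<^sup>+t. indicator B (y + t) \<partial>lborel) = emeasure lborel B"
        by (rule nn_integral_indicator_translate) measurable
    qed
    also have "\<dots> = emeasure lborel B" by (simp add: k.emeasure_space_1)
    finally show "(\<integral>\<^sup>+t. ?G \<omega> t \<partial>lborel) = emeasure lborel B" .
  qed
  also have "\<gamma> * \<dots> = \<gamma> * emeasure lborel B"
    using emeasure_palm_space by simp
  finally show ?thesis .
qed

lemma sets_kernel_measure:
  assumes K: "inv_kernel K" and \<omega>: "\<omega> \<in> space M"
  shows "sets (\<Psi> K \<omega>) = sets borel" "space (\<Psi> K \<omega>) = UNIV"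
proof -
  show s: "sets (\<Psi> K \<omega>) = sets borel"
    unfolding kernel_measure_def
    using kernel_space[OF K \<omega>] random_measureD[OF rm \<omega>] by (intro sets_bind) auto
  show "space (\<Psi> K \<omega>) = UNIV" using sets_eq_imp_space_eq[OF s] by simp
qed

lemma kernel_measure_emeasure_measurable:
  assumes K: "inv_kernel K" and B: "B \<in> sets borel"
  shows "(\<lambda>\<omega>. emeasure (\<Psi> K \<omega>) B) \<in> borel_measurable M"
proof (subst measurable_cong)
  show "(\<lambda>\<omega>. \<integral>\<^sup>+x. emeasure (K \<omega> x) B \<partial>\<Phi> \<omega>) \<in> borel_measurable M"
  proof (rule random_measure_nn_integral_measurable[OF rm])
    have "(\<lambda>p. K (fst p) (snd p)) \<in> measurable (M \<Otimes>\<^sub>M borel) (subprob_algebra borel)"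
      by (intro measurable_prob_algebraD kernel_measurable[OF K]) measurable
    from measurable_compose[OF this measurable_emeasure_subprob_algebra[OF B]]
    show "(\<lambda>(\<omega>, x). emeasure (K \<omega> x) B) \<in> borel_measurable (M \<Otimes>\<^sub>M borel)" by (simp add: case_prod_beta)
  qed
qed (rule emeasure_kernel_measure[OF rm K _ B])

text \<open>Infinite mass on a ball has probability zero because the mean mass there is finite.
  Sigma-finiteness is what lets Fubini evaluate the product of \<open>\<Psi> K \<omega>\<close> with
  itself.\<close>

lemma AE_kernel_measure_sigma_finite:
  assumes K: "inv_kernel K"
  shows "AE \<omega> in M. sigma_finite_measure (\<Psi> K \<omega>)"
proof -
  have "AE \<omega> in M. emeasure (\<Psi> K \<omega>) (cball 0 (real n)) \<noteq> \<infinity>" for n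
  proof (rule nn_integral_PInf_AE)
    show "(\<lambda>\<omega>. emeasure (\<Psi> K \<omega>) (cball 0 (real n))) \<in> borel_measurable M"
      by (rule kernel_measure_emeasure_measurable[OF K]) simp
    show "(\<integral>\<^sup>+\<omega>. emeasure (\<Psi> K \<omega>) (cball 0 (real n)) \<partial>M) \<noteq> \<infinity>"
      using kernel_measure_intensity[OF K, of "cball 0 (real n)"] intensity_finite
        emeasure_lborel_cball_finite[of "0 :: real ^ 'd" "real n"]
      by (simp add: ennreal_mult_eq_top_iff)
  qed
  then have "AE \<omega> in M. \<forall>n. emeasure (\<Psi> K \<omega>) (cball 0 (real n)) \<noteq> \<infinity>"
    by (simp add: AE_all_countable)
  then show ?thesis using AE_space
  proof eventually_elim
    case (elim \<omega>)
    then show ?case using sets_kernel_measure[OF K elim(2)]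
      by (intro sigma_finite_measure_locally_finite) auto
  qed
qed

text \<open>This is D_K. The weight is written with real numbers so that Bochner integrals against
  the density can be evaluated; \<open>atom_weight\<close> recovers the extended form.\<close>

definition displacement_law :: "('w \<Rightarrow> real ^ 'd \<Rightarrow> (real ^ 'd) measure) \<Rightarrow> (real ^ 'd) measure" where
  "displacement_law K = density P0 (\<lambda>\<omega>. ennreal (enn2real \<gamma> * measure (\<Phi> \<omega>) {0}))
     \<bind> (\<lambda>\<omega>. displacement K \<omega>)"

lemma displacement_kernel_measurable:
  assumes K: "inv_kernel K"
  shows "(\<lambda>\<omega>. displacement K \<omega>) \<in> measurable M (subprob_algebra borel)"
proof (rule measurable_distr2)
  show "(\<lambda>\<omega>. pair0 K \<omega>) \<in> measurable M (subprob_algebra (borel \<Otimes>\<^sub>M borel))"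
    by (rule kernel_pair_measurable[OF K]) measurable
qed measurable

lemma sets_displacement_law:
  assumes K: "inv_kernel K"
  shows "sets (displacement_law K) = sets borel"
  unfolding displacement_law_def using not_empty by (intro sets_bind) auto

lemma atom_measurable:
  "(\<lambda>\<omega>. emeasure (\<Phi> \<omega>) {0}) \<in> borel_measurable M" "(\<lambda>\<omega>. measure (\<Phi> \<omega>) {0}) \<in> borel_measurable M"
  using random_measure_emeasure_measurable[OF rm, of "{0}"] unfolding measure_def by auto

lemma atom_weight:
  assumes "\<omega> \<in> space M"
  shows "ennreal (enn2real \<gamma> * measure (\<Phi> \<omega>) {0}) = \<gamma> * emeasure (\<Phi> \<omega>) {0}"
  using random_measureD(3)[OF rm assms, of "{0}"] intensity_finite
  by (simp add: ennreal_mult measure_def less_top)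

lemma nn_integral_displacement_law:
  assumes K: "inv_kernel K" and f[measurable]: "f \<in> borel_measurable borel"
  shows "(\<integral>\<^sup>+z. f z \<partial>displacement_law K) = \<gamma> * (\<integral>\<^sup>+\<omega>. emeasure (\<Phi> \<omega>) {0} * (\<integral>\<^sup>+p. f (snd p - fst p) \<partial>(pair0 K \<omega>)) \<partial>P0)"
proof -
  note [measurable] = atom_measurable
  let ?I = "\<lambda>\<omega>. \<integral>\<^sup>+p. f (snd p - fst p) \<partial>(pair0 K \<omega>)"
  have [measurable]: "?I \<in> borel_measurable M"
    by (intro nn_integral_measurable_subprob_algebra2[OF _ kernel_pair_measurable[OF K]]) measurable
  have "(\<integral>\<^sup>+z. f z \<partial>displacement_law K) =
     (\<integral>\<^sup>+\<omega>. (\<integral>\<^sup>+z. f z \<partial>displacement K \<omega>) \<partial>density P0 (\<lambda>\<omega>. ennreal (enn2real \<gamma> * measure (\<Phi> \<omega>) {0})))"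
    unfolding displacement_law_def using displacement_kernel_measurable[OF K]
    by (intro nn_integral_bind[OF f]) simp
  also have "\<dots> = (\<integral>\<^sup>+\<omega>. ?I \<omega> \<partial>density P0 (\<lambda>\<omega>. ennreal (enn2real \<gamma> * measure (\<Phi> \<omega>) {0})))"
  proof (rule nn_integral_cong)
    fix \<omega> assume "\<omega> \<in> space (density P0 (\<lambda>\<omega>. ennreal (enn2real \<gamma> * measure (\<Phi> \<omega>) {0})))"
    then have \<omega>: "\<omega> \<in> space M" by simp
    note [measurable_cong] = kernel_space(2)[OF K \<omega>]
    show "(\<integral>\<^sup>+z. f z \<partial>displacement K \<omega>) = ?I \<omega>"
      by (rule nn_integral_distr) measurable
  qed
  also have "\<dots> = (\<integral>\<^sup>+\<omega>. ennreal (enn2real \<gamma> * measure (\<Phi> \<omega>) {0}) * ?I \<omega> \<partial>P0)"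
    by (rule nn_integral_density) measurable
  also have "\<dots> = (\<integral>\<^sup>+\<omega>. \<gamma> * (emeasure (\<Phi> \<omega>) {0} * ?I \<omega>) \<partial>P0)"
    by (intro nn_integral_cong) (simp add: atom_weight mult.assoc)
  also have "\<dots> = \<gamma> * (\<integral>\<^sup>+\<omega>. emeasure (\<Phi> \<omega>) {0} * ?I \<omega> \<partial>P0)"
    by (rule nn_integral_cmult) measurable
  finally show ?thesis .
qed

text \<open>The total mass is \<gamma> E_0 \<Phi>{0}: at this point the moment assumption on the
  atom at the origin turns into finiteness.\<close>

lemma displacement_law_finite:
  assumes K: "inv_kernel K" and "finite_atoms"
  shows "finite_measure (displacement_law K)"
proof (rule finite_measureI)
  have sp: "space (displacement_law K) = UNIV" using sets_eq_imp_space_eq[OF sets_displacement_law[OF K]] by simp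
  have "emeasure (displacement_law K) UNIV = (\<integral>\<^sup>+z. 1 \<partial>displacement_law K)" using sp by simp
  also have "\<dots> = \<gamma> * (\<integral>\<^sup>+\<omega>. emeasure (\<Phi> \<omega>) {0} * (\<integral>\<^sup>+p. 1 \<partial>(pair0 K \<omega>)) \<partial>P0)"
    by (rule nn_integral_displacement_law[OF K]) simp
  also have "(\<integral>\<^sup>+\<omega>. emeasure (\<Phi> \<omega>) {0} * (\<integral>\<^sup>+p. 1 \<partial>(pair0 K \<omega>)) \<partial>P0) = (\<integral>\<^sup>+\<omega>. emeasure (\<Phi> \<omega>) {0} \<partial>P0)"
  proof (rule nn_integral_cong)
    fix \<omega> assume "\<omega> \<in> space P0"
    then have \<omega>: "\<omega> \<in> space M" by simp
    interpret kk: prob_space "pair0 K \<omega>" by (intro prob_space_pair kernel_space[OF K \<omega>])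
    show "emeasure (\<Phi> \<omega>) {0} * (\<integral>\<^sup>+p. 1 \<partial>(pair0 K \<omega>)) = emeasure (\<Phi> \<omega>) {0}"
      by (simp add: kk.emeasure_space_1)
  qed
  finally show "emeasure (displacement_law K) (space (displacement_law K)) \<noteq> \<infinity>"
    using assms(2) intensity_finite sp by (simp add: ennreal_mult_eq_top_iff less_top)
qed

text \<open>An atom at \<open>x\<close> enters the squared measure with mass \<Phi>{x}^2, one factor
  being the integrator. Seen from \<open>x\<close>, the two kernel points are an independent pair
  shifted by \<open>x\<close>. After refined Campbell the shift runs over Lebesgue measure and
  integrates the first coordinate to the volume of \<open>A\<close>, leaving only the
  displacement.\<close>

lemma diagonal_campbell:
  assumes K: "inv_kernel K" and A[measurable]: "A \<in> sets borel" and B[measurable]: "B \<in> sets borel"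
  shows "(\<integral>\<^sup>+\<omega>. (\<integral>\<^sup>+x. emeasure (\<Phi> \<omega>) {x} * emeasure (K \<omega> x \<Otimes>\<^sub>M K \<omega> x) {(x, y). x \<in> A \<and> y - x \<in> B} \<partial>\<Phi> \<omega>) \<partial>M)
    = emeasure lborel A * emeasure (displacement_law K) B"
proof -
  interpret palm: finite_measure "P0" by (rule finite_measure_palm)
  note [measurable] = atom_measurable
  note C[measurable] = displacement_set_measurable[OF A B]
  let ?J = "\<lambda>\<omega> x. \<integral>\<^sup>+p. indicator A (fst p + x) * indicator B (snd p - fst p) \<partial>(pair0 K \<omega>) :: ennreal"
  let ?G = "\<lambda>\<omega> x. emeasure (\<Phi> \<omega>) {0} * ?J \<omega> x"
  have "(\<lambda>q. ?J (fst q) (snd q)) \<in> borel_measurable (M \<Otimes>\<^sub>M borel)"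
    by (intro nn_integral_measurable_subprob_algebra2[OF _ kernel_pair_measurable[OF K]]) measurable
  then have "(\<lambda>q. ?G (fst q) (snd q)) \<in> borel_measurable (M \<Otimes>\<^sub>M borel)" by measurable
  then have G: "(\<lambda>(\<omega>, x). ?G \<omega> x) \<in> borel_measurable (M \<Otimes>\<^sub>M borel)" by (simp add: case_prod_beta)
  have "(\<integral>\<^sup>+\<omega>. (\<integral>\<^sup>+x. emeasure (\<Phi> \<omega>) {x} * emeasure (K \<omega> x \<Otimes>\<^sub>M K \<omega> x) {(x, y). x \<in> A \<and> y - x \<in> B} \<partial>\<Phi> \<omega>) \<partial>M)
     = (\<integral>\<^sup>+\<omega>. (\<integral>\<^sup>+x. ?G (\<theta> x \<omega>) x \<partial>\<Phi> \<omega>) \<partial>M)"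
  proof (rule nn_integral_cong, rule nn_integral_cong)
    fix \<omega> x assume \<omega>: "\<omega> \<in> space M"
    let ?k = "K (\<theta> x \<omega>) 0"
    note ks = kernel_space[OF K flow_space[OF \<omega>, of x], of 0]
    note [measurable_cong] = ks(2)
    interpret k: prob_space ?k by (rule ks)
    have sf: "sigma_finite_measure (distr ?k borel (\<lambda>y. y + x))"
      by (intro prob_space_imp_sigma_finite k.prob_space_distr) measurable
    have "K \<omega> x \<Otimes>\<^sub>M K \<omega> x = distr (?k \<Otimes>\<^sub>M ?k) (borel \<Otimes>\<^sub>M borel) (\<lambda>(y, z). (y + x, z + x))"
      unfolding kernel_shift[OF K \<omega>, of x] by (rule pair_measure_distr[OF _ _ sf]) measurable
    then have "emeasure (K \<omega> x \<Otimes>\<^sub>M K \<omega> x) {(x, y). x \<in> A \<and> y - x \<in> B}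
       = (\<integral>\<^sup>+p. indicator {(x, y). x \<in> A \<and> y - x \<in> B} p \<partial>distr (?k \<Otimes>\<^sub>M ?k) (borel \<Otimes>\<^sub>M borel) (\<lambda>(y, z). (y + x, z + x)))"
      using C by simp
    also have "\<dots> = (\<integral>\<^sup>+p. indicator {(x, y). x \<in> A \<and> y - x \<in> B} (case p of (y, z) \<Rightarrow> (y + x, z + x)) \<partial>(?k \<Otimes>\<^sub>M ?k))"
      by (rule nn_integral_distr) measurable
    also have "\<dots> = ?J (\<theta> x \<omega>) x"
      by (intro nn_integral_cong) (auto simp: indicator_def)
    finally show "emeasure (\<Phi> \<omega>) {x} * emeasure (K \<omega> x \<Otimes>\<^sub>M K \<omega> x) {(x, y). x \<in> A \<and> y - x \<in> B} = ?G (\<theta> x \<omega>) x"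
      by (simp add: \<Phi>_atom_shift[OF \<omega>])
  qed
  also have "\<dots> = \<gamma> * (\<integral>\<^sup>+\<omega>. (\<integral>\<^sup>+t. ?G \<omega> t \<partial>lborel) \<partial>P0)"
    by (rule refined_campbell[OF G])
  also have "(\<integral>\<^sup>+\<omega>. (\<integral>\<^sup>+t. ?G \<omega> t \<partial>lborel) \<partial>P0)
     = (\<integral>\<^sup>+\<omega>. emeasure lborel A * (emeasure (\<Phi> \<omega>) {0} * (\<integral>\<^sup>+p. indicator B (snd p - fst p) \<partial>(pair0 K \<omega>))) \<partial>P0)"
  proof (rule nn_integral_cong)
    fix \<omega> assume "\<omega> \<in> space P0"
    then have \<omega>[measurable]: "\<omega> \<in> space M" by simp
    note [measurable_cong] = kernel_space(2)[OF K \<omega>]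
    interpret kk: prob_space "pair0 K \<omega>" by (intro prob_space_pair kernel_space[OF K \<omega>])
    interpret kk: pair_sigma_finite "pair0 K \<omega>" "lborel :: (real ^ 'd) measure" ..
    have "(\<integral>\<^sup>+t. ?J \<omega> t \<partial>lborel) = (\<integral>\<^sup>+p. (\<integral>\<^sup>+t. indicator A (fst p + t) * indicator B (snd p - fst p) \<partial>lborel) \<partial>(pair0 K \<omega>))"
      by (rule kk.Fubini') measurable
    also have "\<dots> = (\<integral>\<^sup>+p. emeasure lborel A * indicator B (snd p - fst p) \<partial>(pair0 K \<omega>))"
    proof (rule nn_integral_cong)
      fix p :: "(real ^ 'd) \<times> (real ^ 'd)"
      have "(\<integral>\<^sup>+t. indicator A (fst p + t) \<partial>lborel) = emeasure lborel A"
        by (rule nn_integral_indicator_translate) measurable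
      then show "(\<integral>\<^sup>+t. indicator A (fst p + t) * indicator B (snd p - fst p) \<partial>lborel) = emeasure lborel A * indicator B (snd p - fst p)"
        by (subst nn_integral_multc) auto
    qed
    also have "\<dots> = emeasure lborel A * (\<integral>\<^sup>+p. indicator B (snd p - fst p) \<partial>(pair0 K \<omega>))"
      by (rule nn_integral_cmult) measurable
    finally have J: "(\<integral>\<^sup>+t. ?J \<omega> t \<partial>lborel) = emeasure lborel A * (\<integral>\<^sup>+p. indicator B (snd p - fst p) \<partial>(pair0 K \<omega>))" .
    have "(\<lambda>t. ?J \<omega> t) \<in> borel_measurable lborel"
      by (intro nn_integral_measurable_subprob_algebra2[OF _ kernel_pair_measurable[OF K]]) measurable
    then have "(\<integral>\<^sup>+t. ?G \<omega> t \<partial>lborel) = emeasure (\<Phi> \<omega>) {0} * (\<integral>\<^sup>+t. ?J \<omega> t \<partial>lborel)"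
      by (rule nn_integral_cmult)
    then show "(\<integral>\<^sup>+t. ?G \<omega> t \<partial>lborel) = emeasure lborel A * (emeasure (\<Phi> \<omega>) {0} * (\<integral>\<^sup>+p. indicator B (snd p - fst p) \<partial>(pair0 K \<omega>)))"
      unfolding J by (simp add: mult.left_commute)
  qed
  also have "\<dots> = emeasure lborel A * (\<integral>\<^sup>+\<omega>. emeasure (\<Phi> \<omega>) {0} * (\<integral>\<^sup>+p. indicator B (snd p - fst p) \<partial>(pair0 K \<omega>)) \<partial>P0)"
  proof (rule nn_integral_cmult)
    have [measurable]: "(\<lambda>\<omega>. \<integral>\<^sup>+p. indicator B (snd p - fst p) \<partial>(pair0 K \<omega>) :: ennreal) \<in> borel_measurable M"
      by (intro nn_integral_measurable_subprob_algebra2[OF _ kernel_pair_measurable[OF K]]) measurable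
    show "(\<lambda>\<omega>. emeasure (\<Phi> \<omega>) {0} * (\<integral>\<^sup>+p. indicator B (snd p - fst p) \<partial>(pair0 K \<omega>))) \<in> borel_measurable P0"
      by measurable
  qed
  also have "\<gamma> * \<dots> = emeasure lborel A * (\<integral>\<^sup>+z. indicator B z \<partial>displacement_law K)"
    by (subst nn_integral_displacement_law[OF K]) (auto simp: mult.left_commute)
  also have "(\<integral>\<^sup>+z. indicator B z \<partial>displacement_law K) = emeasure (displacement_law K) B"
    using B sets_displacement_law[OF K] by simp
  finally show ?thesis .
qed

end

section \<open>Fourier transform of the displacement law\<close>

context stationary_random_measure
begin

text \<open>For two independent points with common law the displacement has as its transform the
  product of the transform of that law with its conjugate, hence the squared modulus. Since this is
  at most 1, the atom mass is an integrable majorant.\<close>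

lemma fourier_displacement_law:
  assumes K: "inv_kernel K" and fin: "finite_atoms"
  shows "fourier_measure (displacement_law K) k = complex_of_real (enn2real \<gamma> *
      (\<integral>\<omega>. (cmod (fourier_measure (K \<omega> 0) k))\<^sup>2 * measure (\<Phi> \<omega>) {0} \<partial>P0))"
    and "integrable P0 (\<lambda>\<omega>. (cmod (fourier_measure (K \<omega> 0) k))\<^sup>2 * measure (\<Phi> \<omega>) {0})"
proof -
  note [measurable] = atom_measurable
  let ?c = "\<lambda>\<omega>. enn2real \<gamma> * measure (\<Phi> \<omega>) {0}"
  let ?p = "density P0 (\<lambda>\<omega>. ennreal (?c \<omega>))"
  let ?\<phi> = "\<lambda>\<omega>. fourier_measure (K \<omega> 0) k"
  interpret D: finite_measure "displacement_law K" by (rule displacement_law_finite[OF K fin])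
  have finp: "finite_measure ?p"
  proof (rule finite_measureI)
    have "emeasure ?p (space ?p) = (\<integral>\<^sup>+\<omega>. ennreal (?c \<omega>) \<partial>P0)"
      by (subst emeasure_density) (auto intro!: nn_integral_cong)
    also have "\<dots> = (\<integral>\<^sup>+\<omega>. \<gamma> * emeasure (\<Phi> \<omega>) {0} \<partial>P0)"
      by (intro nn_integral_cong) (simp add: atom_weight)
    also have "\<dots> = \<gamma> * (\<integral>\<^sup>+\<omega>. emeasure (\<Phi> \<omega>) {0} \<partial>P0)"
      by (rule nn_integral_cmult) measurable
    finally show "emeasure ?p (space ?p) \<noteq> \<infinity>"
      using fin intensity_finite by (simp add: ennreal_mult_eq_top_iff less_top)
  qed
  \<comment> \<open>Integration over a bind is done for bounded real functions. \<open>f\<close>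
    stands for \<open>Re\<close> or \<open>Im\<close>, and the property used is that it commutes
    with integrals.\<close>
  have key: "(\<integral>z. f (cis (- (k \<bullet> z))) \<partial>displacement_law K) = (\<integral>\<omega>. ?c \<omega> * f (complex_of_real ((cmod (?\<phi> \<omega>))\<^sup>2)) \<partial>P0)"
    if f: "\<And>N :: ((real ^ 'd) \<times> (real ^ 'd)) measure. \<And>g. integrable N g \<Longrightarrow> (\<integral>p. f (g p) \<partial>N) = f (\<integral>p. g p \<partial>N)"
      and fm[measurable]: "f \<in> borel_measurable borel" and fb: "\<And>u. \<bar>f (cis u)\<bar> \<le> 1" for f :: "complex \<Rightarrow> real"
  proof -
    have I: "(\<integral>z. f (cis (- (k \<bullet> z))) \<partial>displacement K \<omega>) = f (complex_of_real ((cmod (?\<phi> \<omega>))\<^sup>2))"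
      if \<omega>: "\<omega> \<in> space M" for \<omega>
    proof -
      note [measurable_cong] = kernel_space(2)[OF K \<omega>]
      interpret k: prob_space "K \<omega> 0" by (rule kernel_space[OF K \<omega>])
      interpret kk: prob_space "pair0 K \<omega>" by (intro prob_space_pair kernel_space[OF K \<omega>])
      interpret kp: pair_sigma_finite "K \<omega> 0" "K \<omega> 0" ..
      let ?g = "\<lambda>p :: (real ^ 'd) \<times> (real ^ 'd). cis (- (k \<bullet> (snd p - fst p)))"
      have gi: "integrable (pair0 K \<omega>) ?g"
        by (rule kk.integrable_const_bound[of _ 1]) auto
      have "(\<integral>p. ?g p \<partial>(pair0 K \<omega>)) = (\<integral>x. (\<integral>y. ?g (x, y) \<partial>K \<omega> 0) \<partial>K \<omega> 0)"
        by (rule kp.integral_fst'[OF gi, symmetric])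
      also have "\<dots> = (\<integral>x. (\<integral>y. cnj (cis (- (k \<bullet> x))) * cis (- (k \<bullet> y)) \<partial>K \<omega> 0) \<partial>K \<omega> 0)"
        by (intro Bochner_Integration.integral_cong) (auto simp: cis_cnj cis_mult inner_diff_right)
      also have "\<dots> = cnj (?\<phi> \<omega>) * ?\<phi> \<omega>"
        unfolding integral_mult_right_zero integral_mult_left_zero Bochner_Integration.integral_cnj fourier_measure_def ..
      also have "\<dots> = complex_of_real ((cmod (?\<phi> \<omega>))\<^sup>2)"
        by (subst mult.commute) (rule complex_norm_square[symmetric])
      finally have G: "(\<integral>p. ?g p \<partial>(pair0 K \<omega>)) = complex_of_real ((cmod (?\<phi> \<omega>))\<^sup>2)" .
      have "(\<integral>z. f (cis (- (k \<bullet> z))) \<partial>displacement K \<omega>) = (\<integral>p. f (?g p) \<partial>(pair0 K \<omega>))"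
        by (rule integral_distr) measurable
      also have "\<dots> = f (complex_of_real ((cmod (?\<phi> \<omega>))\<^sup>2))" unfolding f[OF gi] G ..
      finally show ?thesis .
    qed
    have m: "(\<lambda>z :: real ^ 'd. f (cis (- (k \<bullet> z)))) \<in> borel_measurable borel" by measurable
    have dm: "(\<lambda>\<omega>. displacement K \<omega>) \<in> measurable ?p (subprob_algebra borel)"
      using displacement_kernel_measurable[OF K] by simp
    have "(\<integral>z. f (cis (- (k \<bullet> z))) \<partial>displacement_law K)
      = (\<integral>\<omega>. (\<integral>z. f (cis (- (k \<bullet> z))) \<partial>displacement K \<omega>) \<partial>?p)"
      unfolding displacement_law_def
    proof (rule integral_bind[OF m _ dm finp, of 1 1])
      show "AE \<omega> in ?p. emeasure (displacement K \<omega>) (space (displacement K \<omega>)) \<le> ennreal 1"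
        using subprob_space.subprob_emeasure_le_1[OF subprob_space_kernel[OF dm]] by (intro AE_I2) auto
    qed (use fb in auto)
    also have "\<dots> = (\<integral>\<omega>. f (complex_of_real ((cmod (?\<phi> \<omega>))\<^sup>2)) \<partial>?p)"
      by (intro Bochner_Integration.integral_cong I) auto
    also have "\<dots> = (\<integral>\<omega>. ?c \<omega> *\<^sub>R f (complex_of_real ((cmod (?\<phi> \<omega>))\<^sup>2)) \<partial>P0)"
    proof (rule integral_density)
      have "(\<lambda>\<omega>. \<integral>z. f (cis (- (k \<bullet> z))) \<partial>displacement K \<omega>) \<in> borel_measurable M"
        by (rule measurable_compose[OF displacement_kernel_measurable[OF K] integral_measurable_subprob_algebra[OF m]])
      then show "(\<lambda>\<omega>. f (complex_of_real ((cmod (?\<phi> \<omega>))\<^sup>2))) \<in> borel_measurable P0"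
        by (simp add: I cong: measurable_cong)
    qed (auto simp: enn2real_nonneg)
    finally show ?thesis by simp
  qed
  have ci: "integrable (displacement_law K) (\<lambda>z. cis (- (k \<bullet> z)))"
    by (intro integrable_cis D.finite_measure_axioms sets_displacement_law K)
  have "Re (fourier_measure (displacement_law K) k) = (\<integral>\<omega>. ?c \<omega> * (cmod (?\<phi> \<omega>))\<^sup>2 \<partial>P0)"
    unfolding fourier_measure_def integral_Re[OF ci, symmetric]
    by (subst key) (auto simp: integral_Re fourier_measure_def)
  moreover have "Im (fourier_measure (displacement_law K) k) = 0"
    unfolding fourier_measure_def integral_Im[OF ci, symmetric]
    by (subst key) (auto simp: integral_Im)
  ultimately have "fourier_measure (displacement_law K) k = complex_of_real (\<integral>\<omega>. ?c \<omega> * (cmod (?\<phi> \<omega>))\<^sup>2 \<partial>P0)"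
    by (simp add: complex_eq_iff)
  also have "(\<integral>\<omega>. ?c \<omega> * (cmod (?\<phi> \<omega>))\<^sup>2 \<partial>P0) = enn2real \<gamma> * (\<integral>\<omega>. (cmod (?\<phi> \<omega>))\<^sup>2 * measure (\<Phi> \<omega>) {0} \<partial>P0)"
    by (subst integral_mult_right_zero[symmetric]) (simp add: mult_ac)
  finally show "fourier_measure (displacement_law K) k = complex_of_real (enn2real \<gamma> *
      (\<integral>\<omega>. (cmod (fourier_measure (K \<omega> 0) k))\<^sup>2 * measure (\<Phi> \<omega>) {0} \<partial>P0))" .
  show "integrable P0 (\<lambda>\<omega>. (cmod (?\<phi> \<omega>))\<^sup>2 * measure (\<Phi> \<omega>) {0})"
  proof (rule Bochner_Integration.integrable_bound)
    have "(\<integral>\<^sup>+\<omega>. ennreal (measure (\<Phi> \<omega>) {0}) \<partial>P0) = (\<integral>\<^sup>+\<omega>. emeasure (\<Phi> \<omega>) {0} \<partial>P0)"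
      using random_measureD(3)[OF rm, of _ "{0}"] by (intro nn_integral_cong) (auto simp: measure_def less_top)
    then show "integrable P0 (\<lambda>\<omega>. measure (\<Phi> \<omega>) {0})"
      using fin by (intro integrableI_bounded) auto
    have kM: "(\<lambda>\<omega>. K \<omega> 0) \<in> measurable M (subprob_algebra borel)"
      by (rule measurable_prob_algebraD[OF kernel_measurable[OF K]]) measurable
    \<comment> \<open>Measurability of the squared modulus in \<omega> is obtained from its real and
      imaginary parts, which are up to sign integrals of fixed bounded real functions against the
      kernel.\<close>
    have "(\<lambda>\<omega>. \<integral>x. cos (k \<bullet> x) \<partial>K \<omega> 0) \<in> borel_measurable M" "(\<lambda>\<omega>. \<integral>x. sin (k \<bullet> x) \<partial>K \<omega> 0) \<in> borel_measurable M"
      by (intro measurable_compose[OF kM integral_measurable_subprob_algebra]; measurable)+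
    then have "(\<lambda>\<omega>. (\<integral>x. cos (k \<bullet> x) \<partial>K \<omega> 0)\<^sup>2 + (\<integral>x. sin (k \<bullet> x) \<partial>K \<omega> 0)\<^sup>2) \<in> borel_measurable M"
      by measurable
    moreover have sq2: "(cmod (?\<phi> \<omega>))\<^sup>2 = (\<integral>x. cos (k \<bullet> x) \<partial>K \<omega> 0)\<^sup>2 + (\<integral>x. sin (k \<bullet> x) \<partial>K \<omega> 0)\<^sup>2 \<and> (cmod (?\<phi> \<omega>))\<^sup>2 \<le> 1"
      if \<omega>: "\<omega> \<in> space M" for \<omega>
    proof
      interpret k: prob_space "K \<omega> 0" by (rule kernel_space[OF K \<omega>])
      have i: "integrable (K \<omega> 0) (\<lambda>x. cis (- (k \<bullet> x)))"
        by (intro integrable_cis k.finite_measure_axioms kernel_space[OF K \<omega>])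
      have "Re (?\<phi> \<omega>) = (\<integral>x. cos (k \<bullet> x) \<partial>K \<omega> 0)" "Im (?\<phi> \<omega>) = - (\<integral>x. sin (k \<bullet> x) \<partial>K \<omega> 0)"
        unfolding fourier_measure_def integral_Re[OF i, symmetric] integral_Im[OF i, symmetric] by simp_all
      then show "(cmod (?\<phi> \<omega>))\<^sup>2 = (\<integral>x. cos (k \<bullet> x) \<partial>K \<omega> 0)\<^sup>2 + (\<integral>x. sin (k \<bullet> x) \<partial>K \<omega> 0)\<^sup>2"
        by (simp add: cmod_power2)
      have "cmod (?\<phi> \<omega>) \<le> (\<integral>x. cmod (cis (- (k \<bullet> x))) \<partial>K \<omega> 0)"
        unfolding fourier_measure_def by (rule integral_norm_bound)
      then show "(cmod (?\<phi> \<omega>))\<^sup>2 \<le> 1" by (simp add: k.prob_space power_le_one)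
    qed
    ultimately have "(\<lambda>\<omega>. (cmod (?\<phi> \<omega>))\<^sup>2) \<in> borel_measurable M"
      by (simp cong: measurable_cong)
    then show "(\<lambda>\<omega>. (cmod (?\<phi> \<omega>))\<^sup>2 * measure (\<Phi> \<omega>) {0}) \<in> borel_measurable P0" by simp
    show "AE \<omega> in P0. norm ((cmod (?\<phi> \<omega>))\<^sup>2 * measure (\<Phi> \<omega>) {0}) \<le> norm (measure (\<Phi> \<omega>) {0})"
    proof (rule AE_I2)
      fix \<omega> assume "\<omega> \<in> space P0"
      then have "(cmod (?\<phi> \<omega>))\<^sup>2 \<le> 1" using sq2 unfolding space_palm by blast
      then have "(cmod (?\<phi> \<omega>))\<^sup>2 * measure (\<Phi> \<omega>) {0} \<le> 1 * measure (\<Phi> \<omega>) {0}"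
        by (intro mult_right_mono measure_nonneg)
      then show "norm ((cmod (?\<phi> \<omega>))\<^sup>2 * measure (\<Phi> \<omega>) {0}) \<le> norm (measure (\<Phi> \<omega>) {0})"
        by (simp add: abs_mult)
    qed
  qed
qed

end

section \<open>Enumerated atoms and pairs of distinct atoms\<close>

locale atom_enumeration = stationary_random_measure M \<theta> \<Phi>
  for M :: "'w measure" and \<theta> :: "real ^ 'd \<Rightarrow> 'w \<Rightarrow> 'w" and \<Phi> :: "'w \<Rightarrow> (real ^ 'd) measure" +
  fixes F :: "'w measure" and X :: "nat \<Rightarrow> 'w \<Rightarrow> real ^ 'd"
  assumes subalg: "subalgebra M F"
    and rmF: "random_measure F \<Phi>"
    and X_F[measurable]: "\<And>n. X n \<in> borel_measurable F"
    and null: "\<And>\<omega>. \<omega> \<in> space M \<Longrightarrow> emeasure (\<Phi> \<omega>) (- range (\<lambda>n. X n \<omega>)) = 0"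
begin

text \<open>The sequence may hit an atom several times; only the first index counts.\<close>

definition weight :: "nat \<Rightarrow> 'w \<Rightarrow> ennreal" where
  "weight n \<omega> = (if \<exists>m<n. X m \<omega> = X n \<omega> then 0 else emeasure (\<Phi> \<omega>) {X n \<omega>})"

abbreviation pair_mass where
  "pair_mass K C m n \<omega> \<equiv> weight m \<omega> * (weight n \<omega> * emeasure (K \<omega> (X m \<omega>) \<Otimes>\<^sub>M K \<omega> (X n \<omega>)) C)"

lemma X_M[measurable]: "X n \<in> borel_measurable M"
  by (rule measurable_from_subalg[OF subalg X_F])

text \<open>Measurability with respect to \<open>F\<close>, and not merely \<open>M\<close>, lets
  the weights be moved through conditional expectations.\<close>

lemma weight_F[measurable]: "weight n \<in> borel_measurable F"
proof -
  \<comment> \<open>The mass at a random point is written as an integral of a jointly measurable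
    function, to which the parametrised measurability lemma applies.\<close>
  have "(\<lambda>\<omega>. \<integral>\<^sup>+x. indicator {0} (x - X n \<omega>) \<partial>\<Phi> \<omega>) \<in> borel_measurable F"
    by (rule random_measure_nn_integral_measurable[OF rmF]) measurable
  moreover have "(\<integral>\<^sup>+x. indicator {0} (x - X n \<omega>) \<partial>\<Phi> \<omega>) = emeasure (\<Phi> \<omega>) {X n \<omega>}" if "\<omega> \<in> space F" for \<omega>
  proof -
    have "(\<integral>\<^sup>+x. indicator {0} (x - X n \<omega>) \<partial>\<Phi> \<omega>) = (\<integral>\<^sup>+x. indicator {X n \<omega>} x \<partial>\<Phi> \<omega>)"
      by (intro nn_integral_cong) (auto simp: indicator_def)
    then show ?thesis using random_measureD(1)[OF rmF that] by simp
  qed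
  ultimately have [measurable]: "(\<lambda>\<omega>. emeasure (\<Phi> \<omega>) {X n \<omega>}) \<in> borel_measurable F"
    by (simp cong: measurable_cong)
  have "Measurable.pred F (\<lambda>\<omega>. \<exists>m. m < n \<and> X m \<omega> - X n \<omega> \<in> {0})" by measurable
  then have [measurable]: "Measurable.pred F (\<lambda>\<omega>. \<exists>m<n. X m \<omega> = X n \<omega>)" by simp
  show ?thesis unfolding weight_def[abs_def] by measurable
qed

lemma weight_M[measurable]: "weight n \<in> borel_measurable M"
  by (rule measurable_from_subalg[OF subalg weight_F])

lemma nn_integral_\<Phi>:
  assumes \<omega>: "\<omega> \<in> space M" and f: "f \<in> borel_measurable borel"
  shows "(\<integral>\<^sup>+x. f x \<partial>\<Phi> \<omega>) = (\<Sum>n. weight n \<omega> * f (X n \<omega>))"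
  unfolding weight_def by (rule nn_integral_countable_support[OF random_measureD(1)[OF rm \<omega>] null[OF \<omega>] f])

lemma nn_integral_kernel_measure:
  assumes K: "inv_kernel K" and \<omega>: "\<omega> \<in> space M" and f: "f \<in> borel_measurable borel"
  shows "(\<integral>\<^sup>+y. f y \<partial>\<Psi> K \<omega>) = (\<Sum>n. weight n \<omega> * (\<integral>\<^sup>+y. f y \<partial>K \<omega> (X n \<omega>)))"
proof -
  have k: "K \<omega> \<in> measurable borel (subprob_algebra borel)"
    by (rule measurable_prob_algebraD[OF invariant_kernel_section[OF K \<omega>]])
  then have "K \<omega> \<in> measurable (\<Phi> \<omega>) (subprob_algebra borel)"
    by (simp add: measurable_cong_sets[OF random_measureD(1)[OF rm \<omega>] refl])
  then have "(\<integral>\<^sup>+y. f y \<partial>\<Psi> K \<omega>) = (\<integral>\<^sup>+x. (\<integral>\<^sup>+y. f y \<partial>K \<omega> x) \<partial>\<Phi> \<omega>)"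
    unfolding kernel_measure_def by (rule nn_integral_bind[OF f])
  also have "\<dots> = (\<Sum>n. weight n \<omega> * (\<integral>\<^sup>+y. f y \<partial>K \<omega> (X n \<omega>)))"
    by (rule nn_integral_\<Phi>[OF \<omega> measurable_compose[OF k nn_integral_measurable_subprob_algebra[OF f]]])
  finally show ?thesis .
qed

text \<open>Both coordinates are expanded over the atoms, first the outer and then the inner one.
  Sigma-finiteness permits writing the product measure as an iterated integral.\<close>

lemma emeasure_pair_kernel_measure:
  assumes K: "inv_kernel K" and \<omega>: "\<omega> \<in> space M"
    and sf: "sigma_finite_measure (\<Psi> K \<omega>)"
    and C[measurable]: "C \<in> sets (borel \<Otimes>\<^sub>M borel)"
  shows "emeasure (\<Psi> K \<omega> \<Otimes>\<^sub>M \<Psi> K \<omega>) C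
    = (\<Sum>m. \<Sum>n. pair_mass K C m n \<omega>)"
proof -
  interpret sigma_finite_measure "\<Psi> K \<omega>" by fact
  note [measurable_cong] = sets_kernel_measure(1)[OF K \<omega>] kernel_space(2)[OF K \<omega>]
  let ?g = "\<lambda>x. \<integral>\<^sup>+y. indicator C (x, y) \<partial>\<Psi> K \<omega> :: ennreal"
  have g: "?g \<in> borel_measurable borel" by measurable
  have "emeasure (\<Psi> K \<omega> \<Otimes>\<^sub>M \<Psi> K \<omega>) C = (\<integral>\<^sup>+x. ?g x \<partial>\<Psi> K \<omega>)"
    by (rule emeasure_pair_measure) measurable
  also have "\<dots> = (\<Sum>m. weight m \<omega> * (\<integral>\<^sup>+x. ?g x \<partial>K \<omega> (X m \<omega>)))"
    by (rule nn_integral_kernel_measure[OF K \<omega> g])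
  also have "\<dots> = (\<Sum>m. \<Sum>n. pair_mass K C m n \<omega>)"
  proof (rule suminf_cong)
    fix m
    have "(\<integral>\<^sup>+x. ?g x \<partial>K \<omega> (X m \<omega>)) = (\<integral>\<^sup>+x. (\<Sum>n. weight n \<omega> * (\<integral>\<^sup>+y. indicator C (x, y) \<partial>K \<omega> (X n \<omega>))) \<partial>K \<omega> (X m \<omega>))"
      by (intro nn_integral_cong nn_integral_kernel_measure[OF K \<omega>]) measurable
    also have "\<dots> = (\<Sum>n. \<integral>\<^sup>+x. weight n \<omega> * (\<integral>\<^sup>+y. indicator C (x, y) \<partial>K \<omega> (X n \<omega>)) \<partial>K \<omega> (X m \<omega>))"
    proof (rule nn_integral_suminf)
      fix n
      interpret k: prob_space "K \<omega> (X n \<omega>)" by (rule kernel_space[OF K \<omega>])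
      show "(\<lambda>x. weight n \<omega> * (\<integral>\<^sup>+y. indicator C (x, y) \<partial>K \<omega> (X n \<omega>))) \<in> borel_measurable (K \<omega> (X m \<omega>))"
        by measurable
    qed
    also have "\<dots> = (\<Sum>n. weight n \<omega> * emeasure (K \<omega> (X m \<omega>) \<Otimes>\<^sub>M K \<omega> (X n \<omega>)) C)"
    proof (rule suminf_cong)
      fix n
      interpret k: prob_space "K \<omega> (X n \<omega>)" by (rule kernel_space[OF K \<omega>])
      have "emeasure (K \<omega> (X m \<omega>) \<Otimes>\<^sub>M K \<omega> (X n \<omega>)) C = (\<integral>\<^sup>+x. (\<integral>\<^sup>+y. indicator C (x, y) \<partial>K \<omega> (X n \<omega>)) \<partial>K \<omega> (X m \<omega>))"
        by (rule k.emeasure_pair_measure) measurable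
      then show "(\<integral>\<^sup>+x. weight n \<omega> * (\<integral>\<^sup>+y. indicator C (x, y) \<partial>K \<omega> (X n \<omega>)) \<partial>K \<omega> (X m \<omega>)) = weight n \<omega> * emeasure (K \<omega> (X m \<omega>) \<Otimes>\<^sub>M K \<omega> (X n \<omega>)) C"
        by (simp add: nn_integral_cmult)
    qed
    finally show "weight m \<omega> * (\<integral>\<^sup>+x. ?g x \<partial>K \<omega> (X m \<omega>)) = (\<Sum>n. pair_mass K C m n \<omega>)"
      by simp
  qed
  finally show ?thesis .
qed

text \<open>The pairs are pairs of indices. A repeated point has weight zero at its later index, so
  only pairs of distinct atoms contribute. The expectation stands inside the double sum, ready for
  conditioning pair by pair.\<close>

definition off_diagonal ::
  "('w \<Rightarrow> real ^ 'd \<Rightarrow> (real ^ 'd) measure) \<Rightarrow> ((real ^ 'd) \<times> (real ^ 'd)) set \<Rightarrow> ennreal" where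
  "off_diagonal K C = (\<Sum>m. \<Sum>n. if m = n then 0 else
     \<integral>\<^sup>+\<omega>. pair_mass K C m n \<omega> \<partial>M)"

lemma emeasure_pair_kernel_measure_AE_measurable:
  assumes K: "inv_kernel K" and C: "C \<in> sets (borel \<Otimes>\<^sub>M borel)"
  shows "AE \<omega> in M. emeasure (\<Psi> K \<omega> \<Otimes>\<^sub>M \<Psi> K \<omega>) C
      = (\<Sum>m. \<Sum>n. pair_mass K C m n \<omega>)"
    and "(\<lambda>\<omega>. pair_mass K C m n \<omega>) \<in> borel_measurable M"
proof -
  show "AE \<omega> in M. emeasure (\<Psi> K \<omega> \<Otimes>\<^sub>M \<Psi> K \<omega>) C
      = (\<Sum>m. \<Sum>n. pair_mass K C m n \<omega>)"
    using AE_kernel_measure_sigma_finite[OF K] AE_space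
    by eventually_elim (rule emeasure_pair_kernel_measure[OF K _ _ C])
  have [measurable]: "(\<lambda>\<omega>. emeasure (K \<omega> (X m \<omega>) \<Otimes>\<^sub>M K \<omega> (X n \<omega>)) C) \<in> borel_measurable M"
    by (rule kernel_pair_emeasure_measurable[OF K measurable_ident_sets[OF refl] X_M X_M C])
  show "(\<lambda>\<omega>. pair_mass K C m n \<omega>) \<in> borel_measurable M"
    by measurable
qed

text \<open>The diagonal index sum is turned back into an integral over
  \<open>\<Phi> \<omega>\<close>, which no longer mentions the enumeration and is the form treated
  by \<open>diagonal_campbell\<close>.\<close>

lemma second_moment_decomposition:
  assumes K: "inv_kernel K" and C: "C \<in> sets (borel \<Otimes>\<^sub>M borel)"
  shows "(\<integral>\<^sup>+\<omega>. emeasure (\<Psi> K \<omega> \<Otimes>\<^sub>M \<Psi> K \<omega>) C \<partial>M)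
    = (\<integral>\<^sup>+\<omega>. (\<integral>\<^sup>+x. emeasure (\<Phi> \<omega>) {x} * emeasure (K \<omega> x \<Otimes>\<^sub>M K \<omega> x) C \<partial>\<Phi> \<omega>) \<partial>M) + off_diagonal K C"
proof -
  let ?a = "\<lambda>m n \<omega>. pair_mass K C m n \<omega>"
  note AM = emeasure_pair_kernel_measure_AE_measurable[OF K C]
  note [measurable] = AM(2)
  have "(\<integral>\<^sup>+\<omega>. emeasure (\<Psi> K \<omega> \<Otimes>\<^sub>M \<Psi> K \<omega>) C \<partial>M) = (\<integral>\<^sup>+\<omega>. (\<Sum>m. \<Sum>n. ?a m n \<omega>) \<partial>M)"
    by (rule nn_integral_cong_AE[OF AM(1)])
  also have "\<dots> = (\<Sum>m. \<integral>\<^sup>+\<omega>. (\<Sum>n. ?a m n \<omega>) \<partial>M)"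
    by (rule nn_integral_suminf) measurable
  also have "\<dots> = (\<Sum>m. \<Sum>n. \<integral>\<^sup>+\<omega>. ?a m n \<omega> \<partial>M)"
    by (intro suminf_cong nn_integral_suminf) measurable
  also have "\<dots> = (\<Sum>m. \<integral>\<^sup>+\<omega>. ?a m m \<omega> \<partial>M) + off_diagonal K C"
    unfolding off_diagonal_def by (rule suminf_split_diagonal)
  also have "(\<Sum>m. \<integral>\<^sup>+\<omega>. ?a m m \<omega> \<partial>M) = (\<integral>\<^sup>+\<omega>. (\<Sum>m. ?a m m \<omega>) \<partial>M)"
    by (rule nn_integral_suminf[symmetric]) measurable
  also have "\<dots> = (\<integral>\<^sup>+\<omega>. (\<integral>\<^sup>+x. emeasure (\<Phi> \<omega>) {x} * emeasure (K \<omega> x \<Otimes>\<^sub>M K \<omega> x) C \<partial>\<Phi> \<omega>) \<partial>M)"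
  proof (rule nn_integral_cong)
    fix \<omega> assume \<omega>: "\<omega> \<in> space M"
    note [measurable_cong] = random_measureD(1)[OF rm \<omega>]
    interpret \<Phi>: sigma_finite_measure "\<Phi> \<omega>" by (rule random_measure_sigma_finite[OF rm \<omega>])
    have "(\<lambda>x. \<integral>\<^sup>+y. indicator {0} (y - x) \<partial>\<Phi> \<omega>) \<in> borel_measurable borel" by measurable
    moreover have "(\<integral>\<^sup>+y. indicator {0} (y - x) \<partial>\<Phi> \<omega>) = emeasure (\<Phi> \<omega>) {x}" for x
    proof -
      have "(\<integral>\<^sup>+y. indicator {0} (y - x) \<partial>\<Phi> \<omega>) = (\<integral>\<^sup>+y. indicator {x} y \<partial>\<Phi> \<omega>)"
        by (intro nn_integral_cong) (auto simp: indicator_def)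
      then show ?thesis using random_measureD(1)[OF rm \<omega>] by simp
    qed
    ultimately have [measurable]: "(\<lambda>x. emeasure (\<Phi> \<omega>) {x}) \<in> borel_measurable borel" by simp
    have [measurable]: "(\<lambda>x. emeasure (K \<omega> x \<Otimes>\<^sub>M K \<omega> x) C) \<in> borel_measurable borel"
      by (rule kernel_pair_emeasure_measurable[OF K measurable_const[OF \<omega>] _ _ C]) measurable
    have "(\<integral>\<^sup>+x. emeasure (\<Phi> \<omega>) {x} * emeasure (K \<omega> x \<Otimes>\<^sub>M K \<omega> x) C \<partial>\<Phi> \<omega>)
      = (\<Sum>m. weight m \<omega> * (emeasure (\<Phi> \<omega>) {X m \<omega>} * emeasure (K \<omega> (X m \<omega>) \<Otimes>\<^sub>M K \<omega> (X m \<omega>)) C))"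
      by (rule nn_integral_\<Phi>[OF \<omega>]) measurable
    \<comment> \<open>A nonzero weight equals the atom mass, so weight times mass is the squared
      weight.\<close>
    also have "\<dots> = (\<Sum>m. ?a m m \<omega>)"
      by (intro suminf_cong) (auto simp: weight_def)
    finally show "(\<Sum>m. ?a m m \<omega>) = (\<integral>\<^sup>+x. emeasure (\<Phi> \<omega>) {x} * emeasure (K \<omega> x \<Otimes>\<^sub>M K \<omega> x) C \<partial>\<Phi> \<omega>)" by simp
  qed
  finally show ?thesis .
qed

text \<open>The product of two weights is measurable with respect to \<open>F\<close> and vanishes
  unless the two points are distinct atoms, which is exactly the event of the conditional identity.
  Equality holds in the extended sense, possibly with both sides infinite, so it is available before
  any square-integrability.\<close>

lemma off_diagonal_eq:
  assumes K: "inv_kernel K" and L: "inv_kernel L" and C: "C \<in> sets (borel \<Otimes>\<^sub>M borel)"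
    and cond: "\<And>m n. AE \<omega> in M.
       emeasure (\<Phi> \<omega>) {X m \<omega>} > 0 \<and> emeasure (\<Phi> \<omega>) {X n \<omega>} > 0 \<and> X m \<omega> \<noteq> X n \<omega> \<longrightarrow>
       real_cond_exp M F (\<lambda>\<omega>. measure (K \<omega> (X m \<omega>) \<Otimes>\<^sub>M K \<omega> (X n \<omega>)) C) \<omega>
         = measure (L \<omega> (X m \<omega>) \<Otimes>\<^sub>M L \<omega> (X n \<omega>)) C"
  shows "off_diagonal K C = off_diagonal L C"
proof -
  have sub: "sigma_finite_subalgebra M F"
    by (intro finite_measure_subalgebra_is_sigma_finite finite_measure_subalgebra.intro finite_measure_axioms
        finite_measure_subalgebra_axioms.intro subalg)
  have em: "emeasure (J \<omega> x \<Otimes>\<^sub>M J \<omega> y) C = ennreal (measure (J \<omega> x \<Otimes>\<^sub>M J \<omega> y) C) \<and> measure (J \<omega> x \<Otimes>\<^sub>M J \<omega> y) C \<le> 1"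
    if "inv_kernel J" "\<omega> \<in> space M" for J \<omega> x y
  proof -
    interpret J: prob_space "J \<omega> x \<Otimes>\<^sub>M J \<omega> y" by (intro prob_space_pair kernel_space[OF that])
    show ?thesis by (simp add: J.emeasure_eq_measure)
  qed
  have "(\<integral>\<^sup>+\<omega>. pair_mass K C m n \<omega> \<partial>M)
      = (\<integral>\<^sup>+\<omega>. pair_mass L C m n \<omega> \<partial>M)"
    if mn: "m \<noteq> n" for m n
  proof -
    let ?g = "\<lambda>J \<omega>. measure (J \<omega> (X m \<omega>) \<Otimes>\<^sub>M J \<omega> (X n \<omega>)) C"
    have e: "(\<integral>\<^sup>+\<omega>. pair_mass J C m n \<omega> \<partial>M)
       = (\<integral>\<^sup>+\<omega>. (weight m \<omega> * weight n \<omega>) * ennreal (?g J \<omega>) \<partial>M)" if "inv_kernel J" for J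
      using em[OF that] by (intro nn_integral_cong) (simp add: mult.assoc)
    have "(\<integral>\<^sup>+\<omega>. (weight m \<omega> * weight n \<omega>) * ennreal (?g K \<omega>) \<partial>M) = (\<integral>\<^sup>+\<omega>. (weight m \<omega> * weight n \<omega>) * ennreal (?g L \<omega>) \<partial>M)"
    proof (rule nn_integral_cond_exp_weighted[OF sub])
      have "(\<lambda>\<omega>. emeasure (K \<omega> (X m \<omega>) \<Otimes>\<^sub>M K \<omega> (X n \<omega>)) C) \<in> borel_measurable M"
        by (rule kernel_pair_emeasure_measurable[OF K measurable_ident_sets[OF refl] X_M X_M C])
      then show "?g K \<in> borel_measurable M" unfolding measure_def by (rule borel_measurable_enn2real)
      show "AE \<omega> in M. 0 < weight m \<omega> * weight n \<omega> \<longrightarrow> real_cond_exp M F (?g K) \<omega> = ?g L \<omega>"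
        using cond[of m n]
      proof eventually_elim
        case (elim \<omega>)
        show ?case
        proof
          assume "0 < weight m \<omega> * weight n \<omega>"
          then have w: "weight m \<omega> \<noteq> 0" "weight n \<omega> \<noteq> 0" by auto
          have "X m \<omega> \<noteq> X n \<omega>"
          proof
            assume eq: "X m \<omega> = X n \<omega>"
            have "m < n \<or> n < m" using mn by auto
            then show False
            proof
              assume "m < n"
              then have "weight n \<omega> = 0" using eq unfolding weight_def by (metis (full_types))
              with w show False by blast
            next
              assume "n < m"
              then have "weight m \<omega> = 0" using eq unfolding weight_def by (metis (full_types))
              with w show False by blast
            qed
          qed
          moreover have "emeasure (\<Phi> \<omega>) {X m \<omega>} \<noteq> 0" "emeasure (\<Phi> \<omega>) {X n \<omega>} \<noteq> 0"
            using w unfolding weight_def by (metis (full_types))+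
          ultimately show "real_cond_exp M F (?g K) \<omega> = ?g L \<omega>"
            using elim by (simp add: zero_less_iff_neq_zero)
        qed
      qed
    qed (use em[OF K] in auto)
    then show ?thesis unfolding e[OF K] e[OF L] .
  qed
  then show ?thesis unfolding off_diagonal_def by (intro suminf_cong) simp
qed

end

section \<open>Reduced second moment measures and local square-integrability\<close>

context atom_enumeration
begin

text \<open>Pathwise additivity is clear, but interchanging sum and expectation needs measurability
  in \<omega>. The series over index pairs supplies it, as it agrees with the product measure almost
  surely.\<close>

lemma emeasure_second_moment:
  assumes K: "inv_kernel K" and B: "B \<in> sets borel"
  shows "emeasure (second_moment M (\<Psi> K)) B =
    (\<integral>\<^sup>+\<omega>. emeasure (\<Psi> K \<omega> \<Otimes>\<^sub>M \<Psi> K \<omega>) {(x, y). x \<in> unit_cube \<and> y - x \<in> B} \<partial>M)"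
  unfolding second_moment_def
proof (rule emeasure_measure_of_sigma[OF _ _ _ B])
  let ?C = "\<lambda>B :: (real ^ 'd) set. {(x, y). x \<in> unit_cube \<and> y - x \<in> B}"
  let ?E = "\<lambda>B \<omega>. emeasure (\<Psi> K \<omega> \<Otimes>\<^sub>M \<Psi> K \<omega>) (?C B)"
  let ?S = "\<lambda>B \<omega>. \<Sum>m. \<Sum>n. pair_mass K (?C B) m n \<omega>"
  show "sigma_algebra UNIV (sets (borel :: (real ^ 'd) measure))"
    using sets.sigma_algebra_axioms[of "borel :: (real ^ 'd) measure"] by simp
  show "positive (sets borel) (\<lambda>B. \<integral>\<^sup>+\<omega>. ?E B \<omega> \<partial>M)" by (simp add: positive_def)
  show "countably_additive (sets borel) (\<lambda>B. \<integral>\<^sup>+\<omega>. ?E B \<omega> \<partial>M)"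
  proof (rule countably_additiveI)
    fix A :: "nat \<Rightarrow> (real ^ 'd) set" assume A: "range A \<subseteq> sets borel" "disjoint_family A"
    have C: "?C (A i) \<in> sets (borel \<Otimes>\<^sub>M borel)" for i
      using A(1) by (intro displacement_set_measurable) auto
    note AM = emeasure_pair_kernel_measure_AE_measurable[OF K C]
    have m: "?S (A i) \<in> borel_measurable M" for i using AM(2)[of _ _ i] by measurable
    have eq: "AE \<omega> in M. \<forall>i. ?E (A i) \<omega> = ?S (A i) \<omega>"
      unfolding AE_all_countable using AM(1) by blast
    have "(\<integral>\<^sup>+\<omega>. ?E (\<Union>i. A i) \<omega> \<partial>M) = (\<integral>\<^sup>+\<omega>. (\<Sum>i. ?E (A i) \<omega>) \<partial>M)"
    proof (rule nn_integral_cong)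
      fix \<omega> assume \<omega>: "\<omega> \<in> space M"
      have "sets (\<Psi> K \<omega> \<Otimes>\<^sub>M \<Psi> K \<omega>) = sets (borel \<Otimes>\<^sub>M borel)"
        by (intro sets_pair_measure_cong sets_kernel_measure[OF K \<omega>])
      moreover have "?C (\<Union>i. A i) = (\<Union>i. ?C (A i))" by auto
      moreover have "disjoint_family (\<lambda>i. ?C (A i))"
        using A(2) by (auto simp: disjoint_family_on_def)
      ultimately show "?E (\<Union>i. A i) \<omega> = (\<Sum>i. ?E (A i) \<omega>)"
        using C by (subst suminf_emeasure) auto
    qed
    also have "\<dots> = (\<integral>\<^sup>+\<omega>. (\<Sum>i. ?S (A i) \<omega>) \<partial>M)"
      by (rule nn_integral_cong_AE) (use eq in eventually_elim, simp)
    also have "\<dots> = (\<Sum>i. \<integral>\<^sup>+\<omega>. ?S (A i) \<omega> \<partial>M)"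
      by (rule nn_integral_suminf[OF m])
    also have "\<dots> = (\<Sum>i. \<integral>\<^sup>+\<omega>. ?E (A i) \<omega> \<partial>M)"
      by (intro suminf_cong nn_integral_cong_AE) (use eq in eventually_elim, simp)
    finally show "(\<Sum>i. \<integral>\<^sup>+\<omega>. ?E (A i) \<omega> \<partial>M) = (\<integral>\<^sup>+\<omega>. ?E (\<Union>i. A i) \<omega> \<partial>M)" ..
  qed
qed

lemma sets_second_moment: "sets (second_moment N R) = sets borel"
  unfolding second_moment_def using sets.sigma_sets_eq[of borel] by (simp add: sets_measure_of_conv)

text \<open>The cube has volume one, so for the set defining the reduced second moment the diagonal
  part is the displacement law itself.\<close>

lemma second_moment_displacement:
  assumes K: "inv_kernel K" and B: "B \<in> sets borel"
  shows "emeasure (second_moment M (\<Psi> K)) B =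
    emeasure (displacement_law K) B + off_diagonal K {(x, y). x \<in> unit_cube \<and> y - x \<in> B}"
proof -
  have C: "{(x, y). x \<in> unit_cube \<and> y - x \<in> B} \<in> sets (borel \<Otimes>\<^sub>M borel)"
    by (intro displacement_set_measurable B) simp
  show ?thesis
    unfolding emeasure_second_moment[OF K B] second_moment_decomposition[OF K C]
    by (subst diagonal_campbell[OF K _ B]) (simp_all add: emeasure_lborel_unit_cube)
qed

lemma square_kernel_measure:
  assumes K: "inv_kernel K" and B: "B \<in> sets borel"
  shows "(\<integral>\<^sup>+\<omega>. (emeasure (\<Psi> K \<omega>) B)\<^sup>2 \<partial>M) =
    (\<integral>\<^sup>+\<omega>. emeasure (\<Psi> K \<omega> \<Otimes>\<^sub>M \<Psi> K \<omega>) (B \<times> B) \<partial>M)"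
proof (rule nn_integral_cong_AE)
  show "AE \<omega> in M. (emeasure (\<Psi> K \<omega>) B)\<^sup>2 = emeasure (\<Psi> K \<omega> \<Otimes>\<^sub>M \<Psi> K \<omega>) (B \<times> B)"
    using AE_kernel_measure_sigma_finite[OF K] AE_space
  proof eventually_elim
    case (elim \<omega>)
    then show ?case using B sets_kernel_measure[OF K elim(2)]
      by (simp add: sigma_finite_measure.emeasure_pair_measure_Times power2_eq_square)
  qed
qed

text \<open>The off-diagonal part is common to both kernels and is dominated by the second moment
  that is assumed finite. The diagonal part is finite on bounded sets in its own right, because the
  displacement law is a finite measure.\<close>

lemma locally_square_integrable_transfer:
  assumes K: "inv_kernel K" and L: "inv_kernel L"
    and off: "\<And>C. C \<in> sets (borel \<Otimes>\<^sub>M borel) \<Longrightarrow> off_diagonal K C = off_diagonal L C"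
    and fin: "finite_atoms"
    and lsi: "square_integrable (\<Psi> L)"
  shows "square_integrable (\<Psi> K)"
  unfolding locally_square_integrable_def
proof (intro ballI impI)
  fix B :: "(real ^ 'd) set" assume B[measurable]: "B \<in> sets borel" and bB: "bounded B"
  interpret D: finite_measure "displacement_law K" by (rule displacement_law_finite[OF K fin])
  have BB: "B \<times> B \<in> sets (borel \<Otimes>\<^sub>M borel)" by measurable
  \<comment> \<open>Dropping the constraint on the second point gives a set covered by
    \<open>diagonal_campbell\<close>, with a finite value: the volume of \<open>B\<close> times the
    mass of the displacement law.\<close>
  let ?C = "{(x, y). x \<in> B \<and> y - x \<in> UNIV}"
  have "(\<integral>\<^sup>+\<omega>. (\<integral>\<^sup>+x. emeasure (\<Phi> \<omega>) {x} * emeasure (K \<omega> x \<Otimes>\<^sub>M K \<omega> x) (B \<times> B) \<partial>\<Phi> \<omega>) \<partial>M)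
     \<le> (\<integral>\<^sup>+\<omega>. (\<integral>\<^sup>+x. emeasure (\<Phi> \<omega>) {x} * emeasure (K \<omega> x \<Otimes>\<^sub>M K \<omega> x) ?C \<partial>\<Phi> \<omega>) \<partial>M)"
  proof (intro nn_integral_mono mult_left_mono emeasure_mono)
    fix \<omega> x assume \<omega>: "\<omega> \<in> space M"
    have "sets (K \<omega> x \<Otimes>\<^sub>M K \<omega> x) = sets (borel \<Otimes>\<^sub>M borel)"
      by (intro sets_pair_measure_cong kernel_space[OF K \<omega>])
    then show "?C \<in> sets (K \<omega> x \<Otimes>\<^sub>M K \<omega> x)"
      using displacement_set_measurable[OF B, of UNIV] by simp
  qed auto
  also have "\<dots> = emeasure lborel B * emeasure (displacement_law K) UNIV"
    by (rule diagonal_campbell[OF K B]) simp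
  also have "\<dots> < \<infinity>"
    using emeasure_bounded_finite[OF bB] D.emeasure_finite[of UNIV]
    by (auto simp: ennreal_mult_eq_top_iff less_top[symmetric])
  finally have 1: "(\<integral>\<^sup>+\<omega>. (\<integral>\<^sup>+x. emeasure (\<Phi> \<omega>) {x} * emeasure (K \<omega> x \<Otimes>\<^sub>M K \<omega> x) (B \<times> B) \<partial>\<Phi> \<omega>) \<partial>M) < \<infinity>" .
  have "off_diagonal L (B \<times> B) \<le> (\<integral>\<^sup>+\<omega>. (emeasure (\<Psi> L \<omega>) B)\<^sup>2 \<partial>M)"
    unfolding square_kernel_measure[OF L B] second_moment_decomposition[OF L BB] by simp
  also have "\<dots> < \<infinity>" using lsi B bB unfolding locally_square_integrable_def by blast
  finally show "(\<integral>\<^sup>+\<omega>. (emeasure (\<Psi> K \<omega>) B)\<^sup>2 \<partial>M) < \<infinity>"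
    unfolding square_kernel_measure[OF K B] second_moment_decomposition[OF K BB] off[OF BB]
    using 1 by simp
qed

text \<open>A point of the unit cube together with a bounded displacement confines both coordinates
  to one ball, where the second moment of the mass is finite.\<close>

lemma second_moment_bounded_finite:
  assumes K: "inv_kernel K" and lsi: "square_integrable (\<Psi> K)"
    and B: "B \<in> sets borel" "bounded B"
  shows "emeasure (second_moment M (\<Psi> K)) B < \<infinity>"
proof -
  obtain r where r: "\<And>x. x \<in> B \<Longrightarrow> norm x \<le> r"
    using B(2) unfolding bounded_iff by blast
  obtain s where s: "\<And>x. x \<in> (unit_cube :: (real ^ 'd) set) \<Longrightarrow> norm x \<le> s"
    using bounded_cbox[of "0 :: real ^ 'd" 1] unfolding bounded_iff by blast
  \<comment> \<open>A bound obtained for an empty \<open>B\<close> may be negative; absolute values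
    make the radius valid in every case.\<close>
  let ?G = "cball 0 (\<bar>r\<bar> + \<bar>s\<bar>) :: (real ^ 'd) set"
  have sub: "{(x, y). x \<in> unit_cube \<and> y - x \<in> B} \<subseteq> ?G \<times> ?G"
  proof clarsimp
    fix x y :: "real ^ 'd" assume x: "x \<in> unit_cube" and y: "y - x \<in> B"
    have "norm y \<le> norm (y - x) + norm x" using norm_triangle_ineq[of "y - x" x] by simp
    then show "norm x \<le> \<bar>r\<bar> + \<bar>s\<bar> \<and> norm y \<le> \<bar>r\<bar> + \<bar>s\<bar>"
      using r[OF y] s[OF x] by auto
  qed
  have "emeasure (second_moment M (\<Psi> K)) B \<le>
      (\<integral>\<^sup>+\<omega>. emeasure (\<Psi> K \<omega> \<Otimes>\<^sub>M \<Psi> K \<omega>) (?G \<times> ?G) \<partial>M)"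
    unfolding emeasure_second_moment[OF K B(1)]
  proof (intro nn_integral_mono emeasure_mono sub)
    fix \<omega> assume \<omega>: "\<omega> \<in> space M"
    show "?G \<times> ?G \<in> sets (\<Psi> K \<omega> \<Otimes>\<^sub>M \<Psi> K \<omega>)"
      using sets_kernel_measure[OF K \<omega>] by (intro pair_measureI) auto
  qed
  also have "\<dots> = (\<integral>\<^sup>+\<omega>. (emeasure (\<Psi> K \<omega>) ?G)\<^sup>2 \<partial>M)"
    by (rule square_kernel_measure[OF K, symmetric]) simp
  also have "\<dots> < \<infinity>"
    using lsi bounded_cball[of "0 :: real ^ 'd"] unfolding locally_square_integrable_def by simp
  finally show ?thesis .
qed

lemma intensity_kernel_measure:
  assumes "inv_kernel K"
  shows "intensity M (\<Psi> K) = \<gamma>"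
  using kernel_measure_intensity[OF assms, of unit_cube]
  unfolding intensity_def by (simp add: emeasure_lborel_unit_cube)

end

section \<open>The sigma-field of a transport\<close>

lemma transport_emeasure_measurable:
  fixes \<Phi> :: "'w \<Rightarrow> (real ^ 'd) measure"
  assumes rm: "random_measure M \<Phi>" and L: "invariant_kernel M \<theta> L" and C: "C \<in> sets borel"
  shows "(\<lambda>\<omega>. emeasure (transport L \<Phi> \<omega>) C) \<in> borel_measurable M"
proof -
  have C'[measurable]: "C \<in> sets (borel \<Otimes>\<^sub>M borel)" using C unfolding borel_prod[symmetric] .
  have "(\<lambda>(\<omega>, x). L \<omega> x) \<in> measurable (M \<Otimes>\<^sub>M borel) (prob_algebra borel)"
    using L unfolding invariant_kernel_def by (rule conjunct1)
  then have "(\<lambda>p. L (fst p) (snd p)) \<in> measurable (M \<Otimes>\<^sub>M borel) (subprob_algebra borel)"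
    by (intro measurable_prob_algebraD) (simp add: case_prod_beta)
  then have "(\<lambda>p. \<integral>\<^sup>+y. indicator C (snd p, y) \<partial>L (fst p) (snd p) :: ennreal) \<in> borel_measurable (M \<Otimes>\<^sub>M borel)"
    by (rule nn_integral_measurable_subprob_algebra2[rotated]) measurable
  then have m: "(\<lambda>\<omega>. \<integral>\<^sup>+x. (\<integral>\<^sup>+y. indicator C (x, y) \<partial>L \<omega> x) \<partial>\<Phi> \<omega>) \<in> borel_measurable M"
    by (intro random_measure_nn_integral_measurable[OF rm]) (simp add: case_prod_beta)
  have "emeasure (transport L \<Phi> \<omega>) C = (\<integral>\<^sup>+x. (\<integral>\<^sup>+y. indicator C (x, y) \<partial>L \<omega> x) \<partial>\<Phi> \<omega>)"
    if \<omega>: "\<omega> \<in> space M" for \<omega>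
  proof -
    have "emeasure (L \<omega> x) {y. (x, y) \<in> C} = (\<integral>\<^sup>+y. indicator C (x, y) \<partial>L \<omega> x)" for x
    proof -
      have s: "sets (L \<omega> x) = sets borel"
        using measurable_space[OF invariant_kernel_section[OF L \<omega>], of x] by (auto simp: space_prob_algebra)
      have "{y. (x, y) \<in> C} \<in> sets (L \<omega> x)" using sets_Pair1[OF C', of x] s by (simp add: vimage_def)
      then show ?thesis
        by (subst nn_integral_indicator[symmetric], assumption) (intro nn_integral_cong, auto split: split_indicator)
    qed
    then show ?thesis by (simp add: emeasure_transport[OF rm L \<omega> C])
  qed
  then show ?thesis using m by (simp cong: measurable_cong)
qed

lemma transport_field_subalgebra:
  fixes \<Phi> :: "'w \<Rightarrow> (real ^ 'd) measure"
  assumes rm: "random_measure M \<Phi>" and L: "invariant_kernel M \<theta> L"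
  shows "subalgebra M (transport_field M (transport L \<Phi>))"
  unfolding subalgebra_def
proof
  show "space (transport_field M (transport L \<Phi>)) = space M"
    by (auto simp: transport_field_def space_measure_of_conv)
  let ?G = "{(\<lambda>\<omega>. emeasure (transport L \<Phi> \<omega>) C) -` U \<inter> space M | C U. C \<in> sets borel \<and> U \<in> sets borel}"
  have "?G \<subseteq> sets M"
    using transport_emeasure_measurable[OF rm L] by (auto intro: measurable_sets)
  then have "sigma_sets (space M) ?G \<subseteq> sets M" by (rule sets.sigma_sets_subset)
  moreover have "?G \<subseteq> Pow (space M)" by auto
  ultimately show "sets (transport_field M (transport L \<Phi>)) \<subseteq> sets M"
    by (simp add: transport_field_def sets_measure_of)
qed

text \<open>\<Phi> is the first marginal of the transport, because the kernel has mass one. Hence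
  its masses are measurable with respect to the field that the transport generates.\<close>

lemma transport_field_random_measure:
  fixes \<Phi> :: "'w \<Rightarrow> (real ^ 'd) measure"
  assumes rm: "random_measure M \<Phi>" and L: "invariant_kernel M \<theta> L"
  shows "random_measure (transport_field M (transport L \<Phi>)) \<Phi>"
proof -
  let ?T = "transport L \<Phi>" and ?F = "transport_field M (transport L \<Phi>)"
  have sp: "space ?F = space M"
    using transport_field_subalgebra[OF rm L] by (simp add: subalgebra_def)
  have T: "(\<lambda>\<omega>. emeasure (?T \<omega>) C) \<in> borel_measurable ?F" if "C \<in> sets borel" for C
  proof (rule measurableI)
    fix U :: "ennreal set" assume "U \<in> sets borel"
    then show "(\<lambda>\<omega>. emeasure (?T \<omega>) C) -` U \<inter> space ?F \<in> sets ?F"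
      unfolding sp using that unfolding transport_field_def by (intro in_measure_of) auto
  qed simp
  have "emeasure (?T \<omega>) (B \<times> UNIV) = emeasure (\<Phi> \<omega>) B" if \<omega>: "\<omega> \<in> space M" and B: "B \<in> sets borel" for \<omega> B
  proof -
    have BU: "B \<times> UNIV \<in> sets (borel :: ((real ^ 'd) \<times> (real ^ 'd)) measure)"
      using B by (simp add: borel_prod[symmetric])
    have "emeasure (L \<omega> x) {y. (x, y) \<in> B \<times> UNIV} = indicator B x" for x
    proof -
      have "prob_space (L \<omega> x)" "space (L \<omega> x) = UNIV"
        using measurable_space[OF invariant_kernel_section[OF L \<omega>], of x] by (auto simp: space_prob_algebra dest: sets_eq_imp_space_eq)
      then show ?thesis using prob_space.emeasure_space_1[of "L \<omega> x"] by (auto simp: indicator_def)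
    qed
    then show ?thesis
      unfolding emeasure_transport[OF rm L \<omega> BU] using B random_measureD(1)[OF rm \<omega>] by simp
  qed
  note e = this
  have "(\<lambda>\<omega>. emeasure (\<Phi> \<omega>) B) \<in> borel_measurable ?F" if B: "B \<in> sets borel" for B
  proof (rule measurable_cong[THEN iffD1])
    show "emeasure (?T \<omega>) (B \<times> UNIV) = emeasure (\<Phi> \<omega>) B" if "\<omega> \<in> space ?F" for \<omega>
      using that e B unfolding sp by blast
    show "(\<lambda>\<omega>. emeasure (?T \<omega>) (B \<times> UNIV)) \<in> borel_measurable ?F"
      using B by (intro T) (simp add: borel_prod[symmetric])
  qed
  then show ?thesis
    using rm unfolding random_measure_def sp by blast
qed

section \<open>The spectral measures of the transported measures\<close>

lemma integrable_locally_finite: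
  fixes h :: "'a::euclidean_space \<Rightarrow> real"
  assumes P: "sets P = sets borel" "emeasure P (cball 0 r) < \<infinity>"
    and h: "h \<in> borel_measurable borel" "\<And>x. \<bar>h x\<bar> \<le> C" "\<And>x. r < norm x \<Longrightarrow> h x = 0"
  shows "integrable P h"
proof (rule Bochner_Integration.integrable_bound)
  show "integrable P (\<lambda>x. C * indicator (cball 0 r) x)"
    using P by (intro integrable_mult_right) (simp add: integrable_indicator_iff less_top)
  show "h \<in> borel_measurable P" using h(1) by (simp add: measurable_cong_sets[OF P(1) refl])
  show "AE x in P. norm (h x) \<le> norm (C * indicator (cball 0 r) x)"
  proof (rule AE_I2)
    fix x
    show "norm (h x) \<le> norm (C * indicator (cball 0 r) x)"
      using h(2)[of x] h(3)[of x] by (cases "r < norm x") auto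
  qed
qed

context atom_enumeration
begin

text \<open>Transport does not change the intensity, so the Lebesgue terms cancel and the second
  moments remain. These may be infinite in total and are compared through a sum identity with the
  finite displacement laws.\<close>

lemma covariance_integral_difference:
  assumes K: "inv_kernel K" and L: "inv_kernel L"
    and off: "\<And>C. C \<in> sets (borel \<Otimes>\<^sub>M borel) \<Longrightarrow> off_diagonal K C = off_diagonal L C"
    and fin: "finite_atoms"
    and lK: "square_integrable (\<Psi> K)"
    and lL: "square_integrable (\<Psi> L)"
    and h: "h \<in> borel_measurable borel" "\<And>x. \<bar>h x\<bar> \<le> C" "\<And>x. r < norm x \<Longrightarrow> h x = 0"
  shows "covariance_integral M (\<Psi> K) h - covariance_integral M (\<Psi> L) h
    = (\<integral>x. h x \<partial>displacement_law K) - (\<integral>x. h x \<partial>displacement_law L)"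
proof -
  let ?A = "\<lambda>K. second_moment M (\<Psi> K)" and ?D = displacement_law
  have iA: "integrable (?A J) h" if "inv_kernel J" "square_integrable (\<Psi> J)" for J
    by (rule integrable_locally_finite[OF sets_second_moment second_moment_bounded_finite[OF that] h]) auto
  have iD: "integrable (?D J) h" if "inv_kernel J" for J
  proof -
    interpret D: finite_measure "?D J" by (rule displacement_law_finite[OF that fin])
    show ?thesis
      by (rule integrable_locally_finite[OF sets_displacement_law[OF that] _ h]) (simp add: less_top[symmetric])
  qed
  have s: "sets (?D L) = sets (?A K)" "sets (?D K) = sets (?A L)"
    by (simp_all add: sets_second_moment sets_displacement_law[OF K] sets_displacement_law[OF L])
  have "add_measure (?A K) (?D L) = add_measure (?A L) (?D K)"
  proof (rule add_measure_eqI)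
    fix B assume "B \<in> sets (?A K)"
    then have B: "B \<in> sets borel" by (simp add: sets_second_moment)
    have C: "{(x, y). x \<in> unit_cube \<and> y - x \<in> B} \<in> sets (borel \<Otimes>\<^sub>M borel)"
      by (intro displacement_set_measurable B) simp
    show "emeasure (?A K) B + emeasure (?D L) B = emeasure (?A L) B + emeasure (?D K) B"
      unfolding second_moment_displacement[OF K B] second_moment_displacement[OF L B] off[OF C]
      by (simp add: ac_simps)
  qed (use s in \<open>simp_all add: sets_second_moment sets_displacement_law[OF K]\<close>)
  then have "(\<integral>x. h x \<partial>?A K) + (\<integral>x. h x \<partial>?D L) = (\<integral>x. h x \<partial>?A L) + (\<integral>x. h x \<partial>?D K)"
    using real_integral_add_measure(2)[OF s(1) iA[OF K lK] iD[OF L]]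
      real_integral_add_measure(2)[OF s(2) iA[OF L lL] iD[OF K]] by simp
  then show ?thesis
    unfolding covariance_integral_def intensity_kernel_measure[OF K] intensity_kernel_measure[OF L] by simp
qed

text \<open>The displacement laws satisfy the hypotheses of \<open>spectral_comparison\<close>. What
  remains is the passage from extended sums to a complex identity, possible since \<open>B\<close>
  is bounded and the transforms are continuous.\<close>

lemma bartlett_difference:
  assumes K: "inv_kernel K" and L: "inv_kernel L"
    and off: "\<And>C. C \<in> sets (borel \<Otimes>\<^sub>M borel) \<Longrightarrow> off_diagonal K C = off_diagonal L C"
    and fin: "finite_atoms"
    and lK: "square_integrable (\<Psi> K)"
    and lL: "square_integrable (\<Psi> L)"
    and \<beta>K: "is_bartlett_measure M (\<Psi> K) \<beta>K"
    and \<beta>L: "is_bartlett_measure M (\<Psi> L) \<beta>L"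
    and B: "B \<in> sets borel" "bounded B"
  shows "complex_of_real (measure \<beta>K B) = complex_of_real (measure \<beta>L B)
    + (LINT k:B|lborel. fourier_measure (displacement_law K) k - fourier_measure (displacement_law L) k)"
proof -
  let ?D = displacement_law
  let ?F = "\<lambda>K k. enn2real \<gamma> * (\<integral>\<omega>. (cmod (fourier_measure (K \<omega> 0) k))\<^sup>2 * measure (\<Phi> \<omega>) {0} \<partial>P0)"
  note DK = displacement_law_finite[OF K fin] sets_displacement_law[OF K]
  note DL = displacement_law_finite[OF L fin] sets_displacement_law[OF L]
  note FK = fourier_displacement_law(1)[OF K fin]
  note FL = fourier_displacement_law(1)[OF L fin]
  have F0: "0 \<le> ?F J k" for J k by (intro mult_nonneg_nonneg integral_nonneg_AE) auto
  have \<beta>: "sets \<beta>K = sets borel" "sets \<beta>L = sets borel" "emeasure \<beta>K B < \<infinity>" "emeasure \<beta>L B < \<infinity>"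
    using \<beta>K \<beta>L B unfolding is_bartlett_measure_def by auto
  have iK: "integrable \<beta>K (\<lambda>k. fourier_fun f k * cnj (fourier_fun g k))"
     and vK: "complex_of_real (covariance_integral M (\<Psi> K) (cross_corr f g)) =
          complex_of_real (1 / (2 * pi) ^ CARD('d)) * (\<integral>k. fourier_fun f k * cnj (fourier_fun g k) \<partial>\<beta>K)"
    if "test_fun f" "test_fun g" for f g
    using \<beta>K that unfolding is_bartlett_measure_def by blast+
  have iL: "integrable \<beta>L (\<lambda>k. fourier_fun f k * cnj (fourier_fun g k))"
     and vL: "complex_of_real (covariance_integral M (\<Psi> L) (cross_corr f g)) =
          complex_of_real (1 / (2 * pi) ^ CARD('d)) * (\<integral>k. fourier_fun f k * cnj (fourier_fun g k) \<partial>\<beta>L)"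
    if "test_fun f" "test_fun g" for f g
    using \<beta>L that unfolding is_bartlett_measure_def by blast+
  have eq: "emeasure \<beta>K B + (\<integral>\<^sup>+k\<in>B. ennreal (?F L k) \<partial>lborel) = emeasure \<beta>L B + (\<integral>\<^sup>+k\<in>B. ennreal (?F K k) \<partial>lborel)"
  proof (rule spectral_comparison[where FK="?F K" and FL="?F L" and DK="?D K" and DL="?D L"])
    fix r :: real and t :: "real ^ 'd" assume r: "0 < r"
    let ?f = "\<lambda>x :: real ^ 'd. tent r (x - t)" and ?g = "tent r :: real ^ 'd \<Rightarrow> real"
    have test: "test_fun ?f" "test_fun ?g" using test_fun_tent[OF r, of t] test_fun_tent[OF r, of 0] by simp_all
    have g: "continuous_on UNIV ?g" "\<And>x. r \<le> norm x \<Longrightarrow> ?g x = 0" "\<And>x. \<bar>?g x\<bar> \<le> r"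
      using r continuous_on_tent by auto
    have gm: "?g \<in> borel_measurable borel" using g(1) by (rule borel_measurable_continuous_onI)
    have h: "cross_corr ?f ?g y = cross_corr ?g ?g (y - t)" for y by (rule cross_corr_translate[OF gm gm])
    have hm: "cross_corr ?f ?g \<in> borel_measurable borel"
      unfolding h[abs_def]
      by (intro borel_measurable_continuous_onI continuous_on_compose2[OF continuous_on_cross_corr[OF g]] continuous_intros) auto
    have diff: "covariance_integral M (\<Psi> K) (cross_corr ?f ?g) - covariance_integral M (\<Psi> L) (cross_corr ?f ?g)
      = (\<integral>y. cross_corr ?f ?g y \<partial>?D K) - (\<integral>y. cross_corr ?f ?g y \<partial>?D L)"
    proof (rule covariance_integral_difference[OF K L off fin lK lL hm])
      show "\<bar>cross_corr ?f ?g y\<bar> \<le> r * (\<integral>x. \<bar>?g x\<bar> \<partial>lborel)" for y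
        unfolding h by (rule cross_corr_le[OF g])
      \<comment> \<open>The autocorrelation is supported within radius 2 r, and translation by
        \<open>t\<close> enlarges this by at most \<open>norm t\<close>.\<close>
      show "cross_corr ?f ?g y = 0" if "2 * r + norm t < norm y" for y
      proof -
        have "norm y \<le> norm (y - t) + norm t" using norm_triangle_ineq[of "y - t" t] by simp
        then show ?thesis unfolding h using that by (intro cross_corr_support[where r=r, OF g]) linarith+
      qed
    qed
    \<comment> \<open>This solves the Bartlett identity for the spectral integral; the factor (2
      pi)^d is the one expected by \<open>spectral_comparison\<close>.\<close>
    have v: "(\<integral>k. fourier_fun ?f k * cnj (fourier_fun ?g k) \<partial>\<beta>) = complex_of_real ((2 * pi) ^ CARD('d) * c)"
      if "complex_of_real c = complex_of_real (1 / (2 * pi) ^ CARD('d)) * (\<integral>k. fourier_fun ?f k * cnj (fourier_fun ?g k) \<partial>\<beta>)" for \<beta> c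
    proof -
      have "complex_of_real ((2 * pi) ^ CARD('d) * c) = complex_of_real ((2 * pi) ^ CARD('d)) * complex_of_real c"
        by (rule of_real_mult)
      also have "\<dots> = complex_of_real ((2 * pi) ^ CARD('d) * (1 / (2 * pi) ^ CARD('d))) * (\<integral>k. fourier_fun ?f k * cnj (fourier_fun ?g k) \<partial>\<beta>)"
        unfolding that of_real_mult mult.assoc ..
      also have "(2 * pi) ^ CARD('d) * (1 / (2 * pi) ^ CARD('d)) = 1" by simp
      finally show ?thesis by simp
    qed
    show "(\<integral>k. fourier_fun ?f k * cnj (fourier_fun ?g k) \<partial>\<beta>K) - (\<integral>k. fourier_fun ?f k * cnj (fourier_fun ?g k) \<partial>\<beta>L)
      = complex_of_real ((2 * pi) ^ CARD('d) * ((\<integral>y. cross_corr ?f ?g y \<partial>?D K) - (\<integral>y. cross_corr ?f ?g y \<partial>?D L)))"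
      unfolding v[OF vK[OF test]] v[OF vL[OF test]] diff[symmetric] by (simp add: right_diff_distrib)
  qed (rule \<beta> DK DL FK FL F0 B | (rule iK iL, assumption+))+
  have Fc: "continuous_on UNIV (?F J)" if J: "inv_kernel J" for J
  proof -
    have "?F J = (\<lambda>k. Re (fourier_measure (?D J) k))" by (simp add: fourier_displacement_law(1)[OF J fin])
    then show ?thesis
      by (simp only:) (intro continuous_intros continuous_on_fourier_measure displacement_law_finite[OF J fin] sets_displacement_law[OF J])
  qed
  have Fi: "set_integrable lborel B (?F J)" if J: "inv_kernel J" for J
  proof -
    obtain R where R: "B \<subseteq> cball 0 R" using B(2) by (auto simp: bounded_iff subset_eq)
    have "set_integrable lborel (cball 0 R) (?F J)"
      unfolding set_integrable_def
      by (rule borel_integrable_compact) (auto intro: continuous_on_subset[OF Fc[OF J]])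
    then show ?thesis by (rule set_integrable_subset) (use B R in auto)
  qed
  have nn: "(\<integral>\<^sup>+k\<in>B. ennreal (?F J k) \<partial>lborel) = ennreal (LINT k:B|lborel. ?F J k)" if J: "inv_kernel J" for J
  proof -
    have "(\<integral>\<^sup>+k\<in>B. ennreal (?F J k) \<partial>lborel) = (\<integral>\<^sup>+k. ennreal (indicator B k *\<^sub>R ?F J k) \<partial>lborel)"
      by (intro nn_integral_cong) (auto simp: indicator_def)
    also have "\<dots> = ennreal (LINT k:B|lborel. ?F J k)"
      unfolding set_lebesgue_integral_def using Fi[OF J] F0 unfolding set_integrable_def
      by (intro nn_integral_eq_integral) (auto simp: indicator_def)
    finally show ?thesis .
  qed
  have pos: "0 \<le> (LINT k:B|lborel. ?F J k)" for J
    unfolding set_lebesgue_integral_def using F0 by (intro integral_nonneg_AE) (auto simp: indicator_def)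
  have e: "emeasure \<beta>K B = ennreal (measure \<beta>K B)" "emeasure \<beta>L B = ennreal (measure \<beta>L B)"
    using \<beta>(3,4) by (simp_all add: emeasure_eq_ennreal_measure less_top)
  \<comment> \<open>All terms are finite and nonnegative, so the sum identity descends to real
    numbers; only afterwards is a term moved across.\<close>
  have "ennreal (measure \<beta>K B + (LINT k:B|lborel. ?F L k)) = ennreal (measure \<beta>L B + (LINT k:B|lborel. ?F K k))"
    using eq unfolding nn[OF K] nn[OF L] e ennreal_plus[OF measure_nonneg pos] .
  then have "measure \<beta>K B + (LINT k:B|lborel. ?F L k) = measure \<beta>L B + (LINT k:B|lborel. ?F K k)"
    by (rule ennreal_inj[THEN iffD1, rotated 2]) (intro add_nonneg_nonneg measure_nonneg pos)+
  moreover have "(LINT k:B|lborel. fourier_measure (?D K) k - fourier_measure (?D L) k) = complex_of_real ((LINT k:B|lborel. ?F K k) - (LINT k:B|lborel. ?F L k))"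
    unfolding set_integral_diff(2)[OF Fi[OF K] Fi[OF L], symmetric] FK FL
    by (simp only: set_integral_complex_of_real of_real_diff[symmetric])
  ultimately show ?thesis by (simp add: algebra_simps flip: of_real_add of_real_diff)
qed

text \<open>Formulated for an abstract field \<open>F\<close> and enumeration \<open>X\<close>, so
  that the transport enters only through the field it generates.\<close>

lemma transport_comparison:
  assumes K: "inv_kernel K" and L: "inv_kernel L"
    and cond: "\<And>m n C. C \<in> sets (borel \<Otimes>\<^sub>M borel) \<Longrightarrow> AE \<omega> in M.
       emeasure (\<Phi> \<omega>) {X m \<omega>} > 0 \<and> emeasure (\<Phi> \<omega>) {X n \<omega>} > 0 \<and> X m \<omega> \<noteq> X n \<omega> \<longrightarrow>
       real_cond_exp M F (\<lambda>\<omega>. measure (K \<omega> (X m \<omega>) \<Otimes>\<^sub>M K \<omega> (X n \<omega>)) C) \<omega>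
         = measure (L \<omega> (X m \<omega>) \<Otimes>\<^sub>M L \<omega> (X n \<omega>)) C"
    and fin: "finite_atoms"
    and lsi: "square_integrable (\<Psi> K) \<or> square_integrable (\<Psi> L)"
  shows "locally_square_integrable M (kernel_measure K \<Phi>) \<and>
    locally_square_integrable M (kernel_measure L \<Phi>) \<and>
    (\<exists>\<eta>. finite_signed_measure \<eta> \<and>
      (\<forall>B\<in>sets borel. bounded B \<longrightarrow>
         \<eta> B = measure (second_moment M (kernel_measure K \<Phi>)) B
             - measure (second_moment M (kernel_measure L \<Phi>)) B) \<and>
      (\<forall>\<beta>K \<beta>L. is_bartlett_measure M (kernel_measure K \<Phi>) \<beta>K \<longrightarrow>
         is_bartlett_measure M (kernel_measure L \<Phi>) \<beta>L \<longrightarrow>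
         (\<forall>B\<in>sets borel. bounded B \<longrightarrow>
            complex_of_real (measure \<beta>K B) =
            complex_of_real (measure \<beta>L B) + (LINT k:B|lborel. fourier_signed \<eta> k))) \<and>
      (\<forall>k. fourier_signed \<eta> k = complex_of_real (enn2real (intensity M \<Phi>) *
         (\<integral>\<omega>. ((cmod (fourier_measure (K \<omega> 0) k))\<^sup>2 - (cmod (fourier_measure (L \<omega> 0) k))\<^sup>2)
               * measure (\<Phi> \<omega>) {0} \<partial>palm M \<theta> \<Phi>))) \<and>
      continuous_on UNIV (fourier_signed \<eta>) \<and>
      fourier_signed \<eta> 0 = 0)"
proof -
  have off: "off_diagonal K C = off_diagonal L C" if "C \<in> sets (borel \<Otimes>\<^sub>M borel)" for C
    by (rule off_diagonal_eq[OF K L that cond[OF that]])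
  have lK: "locally_square_integrable M (kernel_measure K \<Phi>)"
    using lsi locally_square_integrable_transfer[OF K L off fin] by blast
  have lL: "locally_square_integrable M (kernel_measure L \<Phi>)"
    using lK locally_square_integrable_transfer[OF L K off[symmetric] fin] by blast
  let ?D = displacement_law
  note DK = displacement_law_finite[OF K fin] sets_displacement_law[OF K]
  note DL = displacement_law_finite[OF L fin] sets_displacement_law[OF L]
  interpret DK: finite_measure "?D K" by (rule DK)
  interpret DL: finite_measure "?D L" by (rule DL)
  \<comment> \<open>The displacement laws define \<open>\<eta>\<close> on all Borel sets. On
    unbounded sets the second moment measures may be infinite, and the difference of their real
    values would be meaningless there.\<close>
  define \<eta> where "\<eta> = (\<lambda>B. measure (?D K) B - measure (?D L) B)"
  have F\<eta>: "fourier_signed \<eta> k = fourier_measure (?D K) k - fourier_measure (?D L) k" for k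
    unfolding \<eta>_def by (rule fourier_signed_diff[OF DK DL])
  have formula: "fourier_signed \<eta> k = complex_of_real (enn2real (intensity M \<Phi>) *
         (\<integral>\<omega>. ((cmod (fourier_measure (K \<omega> 0) k))\<^sup>2 - (cmod (fourier_measure (L \<omega> 0) k))\<^sup>2)
               * measure (\<Phi> \<omega>) {0} \<partial>palm M \<theta> \<Phi>))" for k
    unfolding F\<eta> fourier_displacement_law(1)[OF K fin] fourier_displacement_law(1)[OF L fin] left_diff_distrib
      Bochner_Integration.integral_diff[OF fourier_displacement_law(2)[OF K fin] fourier_displacement_law(2)[OF L fin]]
    by (simp add: right_diff_distrib)
  have \<eta>: "\<eta> B = measure (second_moment M (kernel_measure K \<Phi>)) B - measure (second_moment M (kernel_measure L \<Phi>)) B"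
    if B: "B \<in> sets borel" "bounded B" for B
  proof -
    have C: "{(x, y). x \<in> unit_cube \<and> y - x \<in> B} \<in> sets (borel \<Otimes>\<^sub>M borel)"
      by (intro displacement_set_measurable B) simp
    let ?O = "off_diagonal L {(x, y). x \<in> unit_cube \<and> y - x \<in> B}"
    have a: "emeasure (second_moment M (kernel_measure K \<Phi>)) B = emeasure (?D K) B + ?O"
        "emeasure (second_moment M (kernel_measure L \<Phi>)) B = emeasure (?D L) B + ?O"
      unfolding second_moment_displacement[OF K B(1)] second_moment_displacement[OF L B(1)] off[OF C] by simp_all
    \<comment> \<open>The common off-diagonal mass has to be finite before it can cancel in a
      difference of real values; boundedness of \<open>B\<close> guarantees this.\<close>
    have "?O < \<top>" using second_moment_bounded_finite[OF L lL B] unfolding a by simp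
    then show ?thesis
      unfolding \<eta>_def measure_def a
      by (simp add: enn2real_plus less_top[symmetric])
  qed
  show ?thesis
  proof (intro conjI exI[of _ \<eta>] lK lL)
    show "finite_signed_measure \<eta>" unfolding \<eta>_def by (rule finite_signed_measure_diff[OF DK DL])
    show "continuous_on UNIV (fourier_signed \<eta>)"
      unfolding F\<eta>[abs_def] by (intro continuous_intros continuous_on_fourier_measure DK DL)
    \<comment> \<open>A probability measure has transform 1 at the origin, so the two squared moduli
      cancel there.\<close>
    have one: "(cmod (fourier_measure (J \<omega> 0) 0))\<^sup>2 = 1" if "invariant_kernel M \<theta> J" "\<omega> \<in> space M" for J \<omega>
    proof -
      interpret J: prob_space "J \<omega> 0" by (rule kernel_space[OF that])
      show ?thesis by (simp add: fourier_measure_def J.prob_space)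
    qed
    have "(\<integral>\<omega>. ((cmod (fourier_measure (K \<omega> 0) 0))\<^sup>2 - (cmod (fourier_measure (L \<omega> 0) 0))\<^sup>2) * measure (\<Phi> \<omega>) {0} \<partial>palm M \<theta> \<Phi>)
       = (\<integral>\<omega>. 0 \<partial>palm M \<theta> \<Phi>)"
      by (intro Bochner_Integration.integral_cong) (auto simp: one[OF K] one[OF L])
    then show "fourier_signed \<eta> 0 = 0" unfolding formula by simp
    show "\<forall>\<beta>K \<beta>L. is_bartlett_measure M (kernel_measure K \<Phi>) \<beta>K \<longrightarrow>
         is_bartlett_measure M (kernel_measure L \<Phi>) \<beta>L \<longrightarrow>
         (\<forall>B\<in>sets borel. bounded B \<longrightarrow>
            complex_of_real (measure \<beta>K B) =
            complex_of_real (measure \<beta>L B) + (LINT k:B|lborel. fourier_signed \<eta> k))"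
      unfolding F\<eta> using bartlett_difference[OF K L off fin lK lL] by blast
  qed (use \<eta> formula in auto)
qed

end

theorem theorem4p2:
  fixes M :: "'w measure"
    and \<theta> :: "real ^ 'd \<Rightarrow> 'w \<Rightarrow> 'w"
    and \<Phi> :: "'w \<Rightarrow> (real ^ 'd) measure"
    and K L :: "'w \<Rightarrow> real ^ 'd \<Rightarrow> (real ^ 'd) measure"
  assumes "prob_space M" and "borel_space M" and "stationary_flow M \<theta>"
    and "random_measure M \<Phi>" and "invariant_measure M \<theta> \<Phi>" and "purely_discrete M \<Phi>"
    and "0 < intensity M \<Phi>" and "intensity M \<Phi> < \<infinity>"
    and "invariant_kernel M \<theta> L" and "invariant_kernel M \<theta> K"
    and "conditional_product_condition M \<Phi> (transport L \<Phi>) K L"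
    and "(\<integral>\<^sup>+\<omega>. emeasure (\<Phi> \<omega>) {0} \<partial>palm M \<theta> \<Phi>) < \<infinity>"
    and "locally_square_integrable M (kernel_measure K \<Phi>) \<or>
         locally_square_integrable M (kernel_measure L \<Phi>)"
  shows "locally_square_integrable M (kernel_measure K \<Phi>) \<and>
    locally_square_integrable M (kernel_measure L \<Phi>) \<and>
    (\<exists>\<eta>. finite_signed_measure \<eta> \<and>
      (\<forall>B\<in>sets borel. bounded B \<longrightarrow>
         \<eta> B = measure (second_moment M (kernel_measure K \<Phi>)) B
             - measure (second_moment M (kernel_measure L \<Phi>)) B) \<and>
      (\<forall>\<beta>K \<beta>L. is_bartlett_measure M (kernel_measure K \<Phi>) \<beta>K \<longrightarrow>
         is_bartlett_measure M (kernel_measure L \<Phi>) \<beta>L \<longrightarrow>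
         (\<forall>B\<in>sets borel. bounded B \<longrightarrow>
            complex_of_real (measure \<beta>K B) =
            complex_of_real (measure \<beta>L B) + (LINT k:B|lborel. fourier_signed \<eta> k))) \<and>
      (\<forall>k. fourier_signed \<eta> k = complex_of_real (enn2real (intensity M \<Phi>) *
         (\<integral>\<omega>. ((cmod (fourier_measure (K \<omega> 0) k))\<^sup>2 - (cmod (fourier_measure (L \<omega> 0) k))\<^sup>2)
               * measure (\<Phi> \<omega>) {0} \<partial>palm M \<theta> \<Phi>))) \<and>
      continuous_on UNIV (fourier_signed \<eta>) \<and>
      fourier_signed \<eta> 0 = 0)"
proof -
  note rm = assms(4) and L = assms(9) and K = assms(10)
  let ?F = "transport_field M (transport L \<Phi>)"
  obtain X :: "nat \<Rightarrow> 'w \<Rightarrow> real ^ 'd" where X: "\<And>n. X n \<in> borel_measurable ?F"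
    and atoms: "\<And>\<omega> x. \<omega> \<in> space M \<Longrightarrow> emeasure (\<Phi> \<omega>) {x} > 0 \<Longrightarrow> \<exists>n. X n \<omega> = x"
    and cond: "\<And>m n C. C \<in> sets (borel \<Otimes>\<^sub>M borel) \<Longrightarrow> AE \<omega> in M.
           emeasure (\<Phi> \<omega>) {X m \<omega>} > 0 \<and> emeasure (\<Phi> \<omega>) {X n \<omega>} > 0 \<and> X m \<omega> \<noteq> X n \<omega> \<longrightarrow>
           real_cond_exp M ?F (\<lambda>\<omega>. measure (K \<omega> (X m \<omega>) \<Otimes>\<^sub>M K \<omega> (X n \<omega>)) C) \<omega>
           = measure (L \<omega> (X m \<omega>) \<Otimes>\<^sub>M L \<omega> (X n \<omega>)) C"
    using assms(11) unfolding conditional_product_condition_def by blast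
  have "stationary_random_measure M \<theta> \<Phi>"
    using assms by (intro stationary_random_measure.intro stationary_random_measure_axioms.intro) auto
  \<comment> \<open>The sequence from the conditional hypothesis may list points without mass. What
    matters is that it exhausts the atoms; pure discreteness then leaves no mass elsewhere.\<close>
  moreover have "atom_enumeration_axioms M \<Phi> ?F X"
  proof
    show "emeasure (\<Phi> \<omega>) (- range (\<lambda>n. X n \<omega>)) = 0" if "\<omega> \<in> space M" for \<omega>
      by (rule purely_discrete_null[OF assms(6) that atoms[OF that]])
  qed (use X transport_field_subalgebra[OF rm L] transport_field_random_measure[OF rm L] in auto)
  ultimately have "atom_enumeration M \<theta> \<Phi> ?F X" by (rule atom_enumeration.intro)
  from atom_enumeration.transport_comparison[OF this K L cond assms(12,13)]
  show ?thesis .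
qed

end
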